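(* Let $A$ be a (not necessarily bounded) normal operator in a complex Hilbert space $H$ and let $B\in B(H)$ be hyponormal. If $BA\subset AB$, then $$|A-B|\leq |A|+|B|.$$
   Context: $B(H)$ is the algebra of bounded everywhere defined linear operators on $H$. Operators are linear, not necessarily bounded, defined on a subspace $D(T)$ of $H$. $S\subset T$ means $D(S)\subset D(T)$ and $S=T$ on $D(S)$. Natural domains are used: $D(ST)=\{x\in D(T): Tx\in D(S)\}$, $D(S\pm T)=D(S)\cap D(T)$. A densely defined operator $T$ is normal if it is closed and $TT^*=T^*T$. A densely defined operator $T$ is hyponormal if $D(T)\subset D(T^* )$ and $\|T^*x\|\le\|Tx\|$ for all $x\in D(T)$. For a closed densely defined operator $T$, $|T|$ denotes the unique positive self-adjoint square root of $T^*T$. For positive self-adjoint operators $S,T$ (possibly unbounded), $T\le S$ means $D(S^{1/2})\subset D(T^{1/2})$ and $\|T^{1/2}x\|\le\|S^{1/2}x\|$ for all $x\in D(S^{1/2})$. *)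

theory Defs
  imports "HOL-Analysis.Analysis" "HOL-Library.Complex_Order"
begin

section \<open>Complex Hilbert spaces\<close>

text \<open>
  A complex Hilbert space carries the real inner product \<open>Re \<langle>x, y\<rangle>\<close>, which induces the same norm;
  building on \<^class>\<open>real_inner\<close> provides the norm, the metric and the topology.
  The complex inner product is linear in its first argument.
\<close>

class complex_hilbert_space = real_inner + complete_space +
  fixes scaleC :: "complex \<Rightarrow> 'a \<Rightarrow> 'a"  (infixr \<open>*\<^sub>C\<close> 75)
    and cinner :: "'a \<Rightarrow> 'a \<Rightarrow> complex"
  assumes scaleC_add_right: "c *\<^sub>C (x + y) = c *\<^sub>C x + c *\<^sub>C y"
    and scaleC_add_left: "(c + d) *\<^sub>C x = c *\<^sub>C x + d *\<^sub>C x"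
    and scaleC_scaleC: "c *\<^sub>C d *\<^sub>C x = (c * d) *\<^sub>C x"
    and scaleC_of_real: "complex_of_real r *\<^sub>C x = r *\<^sub>R x"
    and cinner_commute: "cinner x y = cnj (cinner y x)"
    and cinner_add_left: "cinner (x + y) z = cinner x z + cinner y z"
    and cinner_scaleC_left: "cinner (c *\<^sub>C x) y = c * cinner x y"
    and Re_cinner: "Re (cinner x y) = inner x y"

instantiation complex :: complex_hilbert_space
begin

definition scaleC_complex :: "complex \<Rightarrow> complex \<Rightarrow> complex" where
  "scaleC_complex c x = c * x"

definition cinner_complex :: "complex \<Rightarrow> complex \<Rightarrow> complex" where
  "cinner_complex x y = x * cnj y"

instance
  by standard
    (auto simp: scaleC_complex_def cinner_complex_def algebra_simps scaleR_conv_of_real inner_complex_def)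

end

section \<open>Unbounded operators\<close>

text \<open>
  An operator is a partial function \<open>T :: 'a \<rightharpoonup> 'a\<close> with \<open>D(T) = dom T\<close> and \<open>T x = the (T x)\<close> for
  \<open>x \<in> D(T)\<close>.  Thus \<open>S \<subset> T\<close> is \<^term>\<open>S \<subseteq>\<^sub>m T\<close>, equality of operators is equality of partial
  functions, and \<^term>\<open>S \<circ>\<^sub>m T\<close> is the product \<open>ST\<close> on its natural domain.
\<close>

definition linear_op :: "('a::complex_hilbert_space \<rightharpoonup> 'a) \<Rightarrow> bool" where
  "linear_op T \<longleftrightarrow>
     0 \<in> dom T \<and>
     (\<forall>x\<in>dom T. \<forall>y\<in>dom T. x + y \<in> dom T \<and> the (T (x + y)) = the (T x) + the (T y)) \<and>
     (\<forall>c. \<forall>x\<in>dom T. c *\<^sub>C x \<in> dom T \<and> the (T (c *\<^sub>C x)) = c *\<^sub>C the (T x))"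

definition op_plus :: "('a::complex_hilbert_space \<rightharpoonup> 'a) \<Rightarrow> ('a \<rightharpoonup> 'a) \<Rightarrow> ('a \<rightharpoonup> 'a)"
    (infixl \<open>+\<^sub>m\<close> 65) where
  "S +\<^sub>m T = (\<lambda>x. if x \<in> dom S \<inter> dom T then Some (the (S x) + the (T x)) else None)"

definition op_minus :: "('a::complex_hilbert_space \<rightharpoonup> 'a) \<Rightarrow> ('a \<rightharpoonup> 'a) \<Rightarrow> ('a \<rightharpoonup> 'a)"
    (infixl \<open>-\<^sub>m\<close> 65) where
  "S -\<^sub>m T = (\<lambda>x. if x \<in> dom S \<inter> dom T then Some (the (S x) - the (T x)) else None)"

definition densely_defined :: "('a::complex_hilbert_space \<rightharpoonup> 'a) \<Rightarrow> bool" where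
  "densely_defined T \<longleftrightarrow> closure (dom T) = UNIV"

definition closed_op :: "('a::complex_hilbert_space \<rightharpoonup> 'a) \<Rightarrow> bool" where
  "closed_op T \<longleftrightarrow> closed (Map.graph T)"

definition bounded_op :: "('a::complex_hilbert_space \<rightharpoonup> 'a) \<Rightarrow> bool" where
  "bounded_op T \<longleftrightarrow>
     linear_op T \<and> dom T = UNIV \<and> (\<exists>K. \<forall>x. norm (the (T x)) \<le> K * norm x)"

text \<open>The vector \<open>z\<close> is unique, and \<open>adj T\<close> is meaningful, only for densely defined \<open>T\<close>.\<close>

definition adj :: "('a::complex_hilbert_space \<rightharpoonup> 'a) \<Rightarrow> ('a \<rightharpoonup> 'a)" where
  "adj T = (\<lambda>y. if \<exists>z. \<forall>x\<in>dom T. cinner (the (T x)) y = cinner x z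
                then Some (THE z. \<forall>x\<in>dom T. cinner (the (T x)) y = cinner x z)
                else None)"

definition normal_op :: "('a::complex_hilbert_space \<rightharpoonup> 'a) \<Rightarrow> bool" where
  "normal_op T \<longleftrightarrow>
     linear_op T \<and> densely_defined T \<and> closed_op T \<and> T \<circ>\<^sub>m adj T = adj T \<circ>\<^sub>m T"

definition hyponormal_op :: "('a::complex_hilbert_space \<rightharpoonup> 'a) \<Rightarrow> bool" where
  "hyponormal_op T \<longleftrightarrow>
     linear_op T \<and> densely_defined T \<and> dom T \<subseteq> dom (adj T) \<and>
     (\<forall>x\<in>dom T. norm (the (adj T x)) \<le> norm (the (T x)))"

definition selfadjoint_op :: "('a::complex_hilbert_space \<rightharpoonup> 'a) \<Rightarrow> bool" where
  "selfadjoint_op T \<longleftrightarrow> linear_op T \<and> densely_defined T \<and> adj T = T"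

text \<open>The order on \<^typ>\<open>complex\<close> makes \<open>0 \<le> c\<close> say that \<open>c\<close> is real and nonnegative.\<close>

definition positive_selfadjoint_op :: "('a::complex_hilbert_space \<rightharpoonup> 'a) \<Rightarrow> bool" where
  "positive_selfadjoint_op T \<longleftrightarrow>
     selfadjoint_op T \<and> (\<forall>x\<in>dom T. 0 \<le> cinner (the (T x)) x)"

text \<open>Existence and uniqueness of the root hold for positive self-adjoint \<open>T\<close>.\<close>

definition sqrt_op :: "('a::complex_hilbert_space \<rightharpoonup> 'a) \<Rightarrow> ('a \<rightharpoonup> 'a)" where
  "sqrt_op T = (THE R. positive_selfadjoint_op R \<and> R \<circ>\<^sub>m R = T)"

definition abs_op :: "('a::complex_hilbert_space \<rightharpoonup> 'a) \<Rightarrow> ('a \<rightharpoonup> 'a)" where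
  "abs_op T = sqrt_op (adj T \<circ>\<^sub>m T)"

text \<open>
  The order is defined between positive self-adjoint operators only; as this is part of the
  definition, the relation never holds because of an undefined root or adjoint.
\<close>

definition op_le :: "('a::complex_hilbert_space \<rightharpoonup> 'a) \<Rightarrow> ('a \<rightharpoonup> 'a) \<Rightarrow> bool"
    (infix \<open>\<le>\<^sub>m\<close> 50) where
  "T \<le>\<^sub>m S \<longleftrightarrow>
     positive_selfadjoint_op T \<and> positive_selfadjoint_op S \<and>
     dom (sqrt_op S) \<subseteq> dom (sqrt_op T) \<and>
     (\<forall>x\<in>dom (sqrt_op S). norm (the (sqrt_op T x)) \<le> norm (the (sqrt_op S x)))"

end

theory Submission
  imports Defs
begin

text \<open>
  The order between two positive self-adjoint operators compares their square roots.  By the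
  inequality of Heinz it is enough to compare the operators themselves:
  \<open>\<parallel>(A - B) x\<parallel> \<le> \<parallel>(\<bar>A\<bar> + \<bar>B\<bar>) x\<parallel>\<close> for x in the domain of A, where the left side is also \<open>\<parallel>\<bar>A - B\<bar> x\<parallel>\<close>.
  Because \<open>\<parallel>A x\<parallel> = \<parallel>\<bar>A\<bar> x\<parallel>\<close> and \<open>\<parallel>B x\<parallel> = \<parallel>\<bar>B\<bar> x\<parallel>\<close>, expanding the squares leaves
  \<open>- Re \<langle>A x, B x\<rangle> \<le> Re \<langle>\<bar>A\<bar> x, \<bar>B\<bar> x\<rangle>\<close> (\<open>interaction_bound\<close>).

  Both the inequality of Heinz (\<open>op_le_if_norm_le\<close>) and this last estimate follow from one
  form inequality, \<open>heinz_form_bound\<close>: if h is symmetric, p is positive with \<open>p + e\<close> surjective for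
  every \<open>e > 0\<close>, and \<open>\<parallel>h x\<parallel> \<le> \<parallel>p x\<parallel>\<close>, then \<open>\<bar>\<langle>h x, x\<rangle>\<bar> \<le> \<langle>p x, x\<rangle>\<close>.  For the estimate,
  \<open>h = - (A\<^sup>*B + B\<^sup>*A) / 2\<close> and \<open>p = \<bar>A\<bar> \<bar>B\<bar>\<close>; the hypothesis \<open>\<parallel>h x\<parallel> \<le> \<parallel>p x\<parallel>\<close> is where
  hyponormality enters, through \<open>\<parallel>B\<^sup>*A x\<parallel> \<le> \<parallel>B A x\<parallel>\<close>, and it needs B to commute with \<open>\<bar>A\<bar>\<close> and
  with \<open>A\<^sup>*\<close>.  That is Fuglede's theorem for an unbounded normal A (\<open>fuglede\<close>).

  No spectral theorem is used.  An unbounded operator T is handled through the bounded operator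
  \<open>C = (1 + T\<^sup>*T)\<^sup>-\<^sup>1\<close> (\<open>gram_resolvent\<close>), obtained by projecting onto the graph of T.  The range of C is
  a core of T, and C determines the domain of T and the numbers \<open>\<parallel>T x\<parallel>\<close>; this yields
  \<open>\<parallel>\<bar>T\<bar> x\<parallel> = \<parallel>T x\<parallel>\<close> and, for normal A, \<open>\<parallel>A\<^sup>*x\<parallel> = \<parallel>A x\<parallel>\<close>.  Square roots of unbounded operators are
  built from the bounded square roots of C and \<open>1 - C\<close>, which come from a norm convergent
  iteration and therefore commute with everything that commutes with C.

  The inner product used throughout is the real part of the complex one; complex linearity is kept
  as the property of commuting with all scalars.
\<close>

section \<open>Complex scalars, quadratic forms and orthogonal projection\<close>

instance complex_hilbert_space \<subseteq> banach ..

lemma inner_scaleC_left: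
  fixes x y :: "'a::complex_hilbert_space"
  shows "inner (c *\<^sub>C x) y = inner x (cnj c *\<^sub>C y)"
proof -
  have "cinner (c *\<^sub>C x) y = cnj (cinner (cnj c *\<^sub>C y) x)"
    by (simp add: cinner_scaleC_left cinner_commute[of y x])
  also have "\<dots> = cinner x (cnj c *\<^sub>C y)" by (rule cinner_commute[symmetric])
  finally show ?thesis by (simp flip: Re_cinner)
qed

lemma norm_scaleC:
  fixes x :: "'a::complex_hilbert_space"
  shows "norm (c *\<^sub>C x) = cmod c * norm x"
proof -
  have "inner (c *\<^sub>C x) (c *\<^sub>C x) = inner x ((cnj c * c) *\<^sub>C x)"
    by (simp add: inner_scaleC_left scaleC_scaleC)
  also have "cnj c * c = complex_of_real ((cmod c)\<^sup>2)"
    by (metis complex_norm_square mult.commute)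
  finally have "(norm (c *\<^sub>C x))\<^sup>2 = (cmod c * norm x)\<^sup>2"
    by (simp only: scaleC_of_real power2_norm_eq_inner inner_scaleR_right power_mult_distrib)
  then show ?thesis by simp
qed

lemma scaleR_scaleC_commute:
  fixes x :: "'a::complex_hilbert_space"
  shows "c *\<^sub>C (r *\<^sub>R x) = r *\<^sub>R (c *\<^sub>C x)"
  by (metis scaleC_of_real scaleC_scaleC mult.commute)

lemma bounded_linear_scaleC: "bounded_linear (\<lambda>x::'a::complex_hilbert_space. c *\<^sub>C x)"
  by (rule bounded_linear_intro[where K = "cmod c"])
    (simp_all add: scaleC_add_right scaleR_scaleC_commute norm_scaleC mult.commute)

lemma scaleC_zero_right: "c *\<^sub>C (0::'a::complex_hilbert_space) = 0"
  using bounded_linear.linear[OF bounded_linear_scaleC] by (rule linear_0)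

lemma scaleC_sum_right: "c *\<^sub>C (\<Sum>i\<in>I. f i :: 'a::complex_hilbert_space) = (\<Sum>i\<in>I. c *\<^sub>C f i)"
  using bounded_linear.linear[OF bounded_linear_scaleC] by (rule linear_sum)

lemma scaleC_zero_left: "0 *\<^sub>C (x::'a::complex_hilbert_space) = 0"
  using scaleC_of_real[of 0 x] by simp

lemma scaleC_one: "1 *\<^sub>C (x::'a::complex_hilbert_space) = x"
  using scaleC_of_real[of 1 x] by simp

lemma scaleC_minus_left: "(- c) *\<^sub>C (x::'a::complex_hilbert_space) = - (c *\<^sub>C x)"
  using scaleC_add_left[of c "- c" x] by (simp add: scaleC_zero_left eq_neg_iff_add_eq_0 add.commute)

lemma scaleC_sum_left: "(\<Sum>i\<in>I. g i) *\<^sub>C (x::'a::complex_hilbert_space) = (\<Sum>i\<in>I. g i *\<^sub>C x)"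
  by (induction I rule: infinite_finite_induct) (simp_all add: scaleC_zero_left scaleC_add_left)

lemma Im_cinner:
  fixes x y :: "'a::complex_hilbert_space"
  shows "Im (cinner x y) = inner x (\<i> *\<^sub>C y)"
proof -
  have "cinner x (\<i> *\<^sub>C y) = cnj (\<i> * cinner y x)"
    by (metis cinner_commute cinner_scaleC_left)
  also have "\<dots> = - \<i> * cinner x y"
    by (metis cinner_commute complex_cnj_i complex_cnj_mult)
  finally show ?thesis by (simp flip: Re_cinner)
qed

text \<open>Behind the inequality of Cauchy and Schwarz and the vanishing of first variations.\<close>

lemma discriminant_le:
  fixes a b c :: real
  assumes "\<And>t. 0 \<le> a + 2 * t * b + t\<^sup>2 * c"
  shows "b\<^sup>2 \<le> a * c"
proof (cases "c = 0")
  case True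
  have "b = 0"
  proof (rule ccontr)
    assume "b \<noteq> 0"
    then show False using assms[of "- (a + 1) / (2 * b)"] True by (simp add: field_simps)
  qed
  then show ?thesis using True by simp
next
  case False
  have "c \<ge> 0"
  proof (rule ccontr)
    assume neg: "\<not> c \<ge> 0"
    have 1: "0 \<le> a + 2 * (t * b) + t\<^sup>2 * c" for t using assms[of t] by (simp add: mult.assoc)
    have "0 \<le> a + t\<^sup>2 * c" for t using 1[of t] 1[of "-t"] by simp
    from this[of "sqrt ((\<bar>a\<bar> + 1) / - c)"] neg have "0 \<le> a + (\<bar>a\<bar> + 1) / - c * c"
      by (simp add: divide_nonneg_neg real_sqrt_pow2)
    also have "(\<bar>a\<bar> + 1) / - c * c = - (\<bar>a\<bar> + 1)" using neg by simp
    finally show False by simp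
  qed
  with False have "c > 0" by simp
  then show ?thesis using assms[of "- b / c"] by (simp add: field_simps power2_eq_square)
qed

definition linear_map_on :: "'a::real_vector set \<Rightarrow> ('a \<Rightarrow> 'b::real_vector) \<Rightarrow> bool" where
  "linear_map_on D f \<longleftrightarrow> subspace D \<and> (\<forall>x\<in>D. \<forall>y\<in>D. f (x + y) = f x + f y)
     \<and> (\<forall>r. \<forall>x\<in>D. f (r *\<^sub>R x) = r *\<^sub>R f x)"

lemma linear_map_onD:
  assumes "linear_map_on D f"
  shows "subspace D"
    and "x \<in> D \<Longrightarrow> y \<in> D \<Longrightarrow> f (x + y) = f x + f y"
    and "x \<in> D \<Longrightarrow> f (r *\<^sub>R x) = r *\<^sub>R f x"
    and "x \<in> D \<Longrightarrow> y \<in> D \<Longrightarrow> f (x - y) = f x - f y"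
    and "f 0 = 0"
proof -
  note a = assms[unfolded linear_map_on_def]
  show s: "subspace D" using a by blast
  show "x \<in> D \<Longrightarrow> y \<in> D \<Longrightarrow> f (x + y) = f x + f y" using a by blast
  show "x \<in> D \<Longrightarrow> f (r *\<^sub>R x) = r *\<^sub>R f x" using a by blast
  show "f (x - y) = f x - f y" if "x \<in> D" "y \<in> D"
  proof -
    have m: "(-1) *\<^sub>R y \<in> D" using s that by (simp add: subspace_neg)
    then have "f (x + (-1) *\<^sub>R y) = f x + f ((-1) *\<^sub>R y)" using a that by blast
    also have "f ((-1) *\<^sub>R y) = (-1) *\<^sub>R f y" using a that by blast
    finally show ?thesis by simp
  qed
  have "0 \<in> D" by (simp add: s subspace_0)
  then have "f (0 *\<^sub>R 0) = 0 *\<^sub>R f 0" using a by blast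
  then show "f 0 = 0" by simp
qed

lemma cauchy_schwarz_form:
  fixes D :: "'a::real_inner set"
  assumes "linear_map_on D p"
    and sym: "\<And>x y. x \<in> D \<Longrightarrow> y \<in> D \<Longrightarrow> inner (p x) y = inner x (p y)"
    and pos: "\<And>x. x \<in> D \<Longrightarrow> 0 \<le> inner (p x) x"
    and "x \<in> D" "y \<in> D"
  shows "(inner (p x) y)\<^sup>2 \<le> inner (p x) x * inner (p y) y"
proof (rule discriminant_le)
  note lin = linear_map_onD[OF assms(1)]
  fix t :: real
  have ty: "t *\<^sub>R y \<in> D" using lin(1) assms(5) by (simp add: subspace_scale)
  then have D: "x + t *\<^sub>R y \<in> D" using lin(1) assms(4) by (simp add: subspace_add)
  have "p (x + t *\<^sub>R y) = p x + t *\<^sub>R p y" using lin assms(4,5) ty by simp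
  moreover have "inner (p y) x = inner (p x) y"
    using sym[OF assms(4,5)] by (simp add: inner_commute)
  ultimately have "inner (p (x + t *\<^sub>R y)) (x + t *\<^sub>R y)
      = inner (p x) x + 2 * t * inner (p x) y + t\<^sup>2 * inner (p y) y"
    by (simp add: inner_add power2_eq_square algebra_simps)
  then show "0 \<le> inner (p x) x + 2 * t * inner (p x) y + t\<^sup>2 * inner (p y) y"
    using pos[OF D] by simp
qed

text \<open>
  A sequence in S minimizing the distance to p is Cauchy by the parallelogram law, and at the
  minimum the first variation of the squared distance vanishes.  The main use is for graphs of
  closed operators, as subspaces of the product space.
\<close>

lemma orthogonal_projection_exists:
  fixes S :: "'a::{real_inner, complete_space} set"
  assumes "subspace S" "closed S"
  obtains g where "g \<in> S" "\<And>s. s \<in> S \<Longrightarrow> inner (p - g) s = 0"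
proof -
  define d where "d = infdist p S"
  have ne: "S \<noteq> {}" using assms(1) subspace_0 by blast
  have d0: "0 \<le> d" by (simp add: d_def infdist_nonneg)
  have dle: "d \<le> dist p s" if "s \<in> S" for s using that by (simp add: d_def infdist_le)
  have "\<exists>s\<in>S. dist p s < d + 1 / Suc n" for n
  proof -
    have "(INF a\<in>S. dist p a) < d + 1 / Suc n" using ne by (simp add: d_def infdist_def)
    then show ?thesis using ne by (subst (asm) cINF_less_iff) auto
  qed
  then obtain u where u: "\<And>n. u n \<in> S" "\<And>n::nat. dist p (u n) < d + 1 / Suc n" by metis
  have par: "(norm (u m - u n))\<^sup>2 \<le> 2 * (dist p (u m))\<^sup>2 + 2 * (dist p (u n))\<^sup>2 - 4 * d\<^sup>2" for m n
  proof -
    have "(1/2) *\<^sub>R (u m + u n) \<in> S" using assms(1) u(1) by (simp add: subspace_add subspace_scale)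
    then have "d \<le> dist p ((1/2) *\<^sub>R (u m + u n))" by (rule dle)
    then have "d\<^sup>2 \<le> (norm (p - (1/2) *\<^sub>R (u m + u n)))\<^sup>2"
      using d0 by (simp add: dist_norm power_mono)
    then show ?thesis
      by (simp add: dist_norm power2_norm_eq_inner inner_diff inner_add inner_commute algebra_simps)
  qed
  have "Cauchy u"
  proof (rule metric_CauchyI)
    fix e :: real assume "e > 0"
    have "(\<lambda>n. 4 * (d + 1 / Suc n)\<^sup>2 - 4 * d\<^sup>2) \<longlonglongrightarrow> 4 * (d + 0)\<^sup>2 - 4 * d\<^sup>2"
      using LIMSEQ_inverse_real_of_nat by (intro tendsto_intros) (simp add: inverse_eq_divide)
    then have "eventually (\<lambda>n. 4 * (d + 1 / Suc n)\<^sup>2 - 4 * d\<^sup>2 < e\<^sup>2) sequentially"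
      using \<open>e > 0\<close> by (intro order_tendstoD(2)) auto
    then obtain N where N: "4 * (d + 1 / Suc N)\<^sup>2 - 4 * d\<^sup>2 < e\<^sup>2"
      by (auto simp: eventually_sequentially)
    have le: "(dist p (u n))\<^sup>2 \<le> (d + 1 / Suc N)\<^sup>2" if "n \<ge> N" for n
    proof (rule power_mono)
      have "1 / real (Suc n) \<le> 1 / Suc N" using that by (simp add: frac_le)
      then show "dist p (u n) \<le> d + 1 / Suc N" using u(2)[of n] by linarith
    qed simp
    have "dist (u m) (u n) < e" if "m \<ge> N" "n \<ge> N" for m n
    proof -
      have "(norm (u m - u n))\<^sup>2 < e\<^sup>2" using par[of m n] le[OF that(1)] le[OF that(2)] N by linarith
      then show ?thesis using \<open>e > 0\<close> by (simp add: dist_norm power_less_imp_less_base)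
    qed
    then show "\<exists>M. \<forall>m\<ge>M. \<forall>n\<ge>M. dist (u m) (u n) < e" by blast
  qed
  then obtain g where g: "u \<longlonglongrightarrow> g" using Cauchy_convergent convergent_def by blast
  have gS: "g \<in> S" using closed_sequentially[OF assms(2) _ g] u(1) by blast
  have "(\<lambda>n. d + 1 / Suc n) \<longlonglongrightarrow> d + 0"
    using LIMSEQ_inverse_real_of_nat by (intro tendsto_intros) (simp add: inverse_eq_divide)
  then have "dist p g \<le> d"
    using u(2) by (intro LIMSEQ_le[OF tendsto_dist[OF tendsto_const g]]) (auto intro: less_imp_le)
  then have gd: "(norm (p - g))\<^sup>2 \<le> d\<^sup>2" by (simp add: dist_norm power_mono)
  have "inner (p - g) s = 0" if s: "s \<in> S" for s
  proof -
    have "(inner (p - g) s)\<^sup>2 \<le> 0 * inner s s"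
    proof (rule discriminant_le)
      fix t :: real
      have "g - t *\<^sub>R s \<in> S" using gS s assms(1) by (simp add: subspace_diff subspace_scale)
      then have "d \<le> norm (p - g + t *\<^sub>R s)" using dle[of "g - t *\<^sub>R s"] by (simp add: dist_norm algebra_simps)
      then have "d\<^sup>2 \<le> (norm (p - g + t *\<^sub>R s))\<^sup>2" using d0 by (simp add: power_mono)
      also have "\<dots> = (norm (p - g))\<^sup>2 + 2 * t * inner (p - g) s + t\<^sup>2 * inner s s"
        unfolding power2_norm_eq_inner
        by (simp add: inner_add power2_eq_square inner_commute algebra_simps)
      finally show "0 \<le> 0 + 2 * t * inner (p - g) s + t\<^sup>2 * inner s s" using gd by linarith
    qed
    then show ?thesis by simp
  qed
  with gS show thesis by (rule that)
qed

section \<open>Bounded positive operators and their square roots\<close>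

definition pos_bounded :: "('a::real_inner \<Rightarrow> 'a) \<Rightarrow> bool" where
  "pos_bounded T \<longleftrightarrow> bounded_linear T \<and> (\<forall>x y. inner (T x) y = inner x (T y)) \<and> (\<forall>x. 0 \<le> inner (T x) x)"

lemma pos_boundedI:
  assumes "bounded_linear T" "\<And>x y. inner (T x) y = inner x (T y)" "\<And>x. 0 \<le> inner (T x) x"
  shows "pos_bounded T"
  using assms by (simp add: pos_bounded_def)

lemma pos_boundedD:
  assumes "pos_bounded T"
  shows "bounded_linear T" and "linear T" and "inner (T x) y = inner x (T y)" and "0 \<le> inner (T x) x"
  using assms unfolding pos_bounded_def by (blast intro: bounded_linear.linear)+

lemma linear_map_on_UNIV: "linear_map_on UNIV f \<longleftrightarrow> linear f"
  by (auto simp: linear_map_on_def linear_iff)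

lemma pos_bounded_cauchy_schwarz:
  assumes "pos_bounded T"
  shows "(inner (T x) y)\<^sup>2 \<le> inner (T x) x * inner (T y) y"
  by (rule cauchy_schwarz_form[where D = UNIV])
    (use pos_boundedD[OF assms] in \<open>simp_all add: linear_map_on_UNIV\<close>)

text \<open>Apply the Cauchy--Schwarz inequality of the form of T to the vectors x and \<open>T x\<close>.\<close>

lemma pos_bounded_norm_le:
  assumes "pos_bounded T" "0 \<le> c" "\<And>x. inner (T x) x \<le> c * (norm x)\<^sup>2"
  shows "norm (T x) \<le> c * norm x"
proof (cases "T x = 0")
  case True then show ?thesis using assms(2) by simp
next
  case False
  have "(inner (T x) (T x))\<^sup>2 \<le> inner (T x) x * inner (T (T x)) (T x)"
    by (rule pos_bounded_cauchy_schwarz[OF assms(1)])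
  also have "\<dots> \<le> (c * (norm x)\<^sup>2) * (c * (norm (T x))\<^sup>2)"
    by (intro mult_mono assms(3) pos_boundedD(4)[OF assms(1)]) (simp add: assms(2))
  finally have "(norm (T x))\<^sup>2 * (norm (T x))\<^sup>2 \<le> (c * norm x)\<^sup>2 * (norm (T x))\<^sup>2"
    by (simp add: power2_norm_eq_inner[symmetric] power_mult_distrib power2_eq_square mult_ac)
  then have "(norm (T x))\<^sup>2 \<le> (c * norm x)\<^sup>2"
    by (rule mult_right_le_imp_le) (use False in simp)
  then show ?thesis by (rule power2_le_imp_le) (simp add: assms(2))
qed

lemma pos_bounded_zero_form:
  assumes "pos_bounded T" "inner (T x) x = 0"
  shows "T x = 0"
  using pos_bounded_cauchy_schwarz[OF assms(1), of x "T x"] assms(2) by simp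

lemma pos_bounded_gram:
  assumes X: "bounded_linear X" "bounded_linear Y" and adj: "\<And>x y. inner (X x) y = inner x (Y y)"
  shows "pos_bounded (\<lambda>x. Y (X x))"
proof (rule pos_boundedI)
  show "bounded_linear (\<lambda>x. Y (X x))" by (rule bounded_linear_compose[OF X(2,1)])
  have Y: "inner (Y (X x)) y = inner (X x) (X y)" for x y
    by (metis adj inner_commute)
  show "inner (Y (X x)) y = inner x (Y (X y))" for x y by (simp only: Y adj[symmetric])
  show "0 \<le> inner (Y (X x)) x" for x by (simp only: Y inner_ge_zero)
qed

text \<open>
  The scalar iteration converging to \<open>1\<close>, the double root of \<open>y = (1 + y\<^sup>2) / 2\<close>; its increments
  dominate those of the operator iteration below.
\<close>

primrec root_majorant :: "nat \<Rightarrow> real" where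
  "root_majorant 0 = 0"
| "root_majorant (Suc n) = (1 + (root_majorant n)\<^sup>2) / 2"

lemma root_majorant_bounds: "0 \<le> root_majorant n \<and> root_majorant n \<le> 1"
proof (induction n)
  case (Suc n)
  then have "(root_majorant n)\<^sup>2 \<le> 1" by (simp add: power_le_one)
  then show ?case by simp
qed simp

lemma root_majorant_le_Suc: "root_majorant n \<le> root_majorant (Suc n)"
proof -
  have "0 \<le> (1 - root_majorant n)\<^sup>2" by simp
  then show ?thesis by (simp add: power2_eq_square algebra_simps)
qed

lemma root_majorant_Cauchy: "Cauchy root_majorant"
proof -
  have "incseq root_majorant" by (rule incseq_SucI) (rule root_majorant_le_Suc)
  moreover have "\<forall>i. root_majorant i \<le> 1" using root_majorant_bounds by blast
  ultimately obtain L where "root_majorant \<longlonglongrightarrow> L" by (rule incseq_convergent)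
  then show ?thesis by (rule LIMSEQ_imp_Cauchy)
qed

primrec root_iterate :: "('a::{real_inner, banach} \<Rightarrow>\<^sub>L 'a) \<Rightarrow> nat \<Rightarrow> 'a \<Rightarrow>\<^sub>L 'a" where
  "root_iterate Z 0 = 0"
| "root_iterate Z (Suc n) = (1/2) *\<^sub>R (Z + (root_iterate Z n o\<^sub>L root_iterate Z n))"

lemma norm_root_iterate:
  assumes "norm Z \<le> 1"
  shows "norm (root_iterate Z n) \<le> root_majorant n"
proof (induction n)
  case (Suc n)
  have "norm (root_iterate Z n o\<^sub>L root_iterate Z n) \<le> norm (root_iterate Z n) * norm (root_iterate Z n)"
    by (rule norm_blinfun_compose)
  also have "\<dots> \<le> (root_majorant n)\<^sup>2"
    unfolding power2_eq_square by (intro mult_mono Suc norm_ge_zero) (use root_majorant_bounds in blast)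
  finally have "norm (Z + (root_iterate Z n o\<^sub>L root_iterate Z n)) \<le> 1 + (root_majorant n)\<^sup>2"
    using assms norm_triangle_ineq[of Z "root_iterate Z n o\<^sub>L root_iterate Z n"] by linarith
  then show ?case by simp
qed simp

lemma norm_root_iterate_step:
  assumes "norm Z \<le> 1"
  shows "norm (root_iterate Z (Suc n) - root_iterate Z n) \<le> root_majorant (Suc n) - root_majorant n"
proof (induction n)
  case 0 then show ?case using assms by simp
next
  case (Suc n)
  define U V where "U = root_iterate Z (Suc n)" and "V = root_iterate Z n"
  define u v where "u = root_majorant (Suc n)" and "v = root_majorant n"
  have UV: "norm U \<le> u" "norm V \<le> v" "norm (U - V) \<le> u - v" "0 \<le> u - v"
    unfolding U_def V_def u_def v_def
    using norm_root_iterate[OF assms] Suc.IH root_majorant_le_Suc[of n] by (simp_all only: diff_ge_0_iff_ge)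
  have "norm (U o\<^sub>L (U - V)) \<le> u * (u - v)"
    by (rule order_trans[OF norm_blinfun_compose]) (intro mult_mono UV norm_ge_zero order_trans[OF norm_ge_zero UV(1)])
  moreover have "norm ((U - V) o\<^sub>L V) \<le> (u - v) * v"
    by (rule order_trans[OF norm_blinfun_compose]) (intro mult_mono UV norm_ge_zero)
  moreover have "(U o\<^sub>L U) - (V o\<^sub>L V) = (U o\<^sub>L (U - V)) + ((U - V) o\<^sub>L V)"
    by (rule blinfun_eqI) (simp add: blinfun.add_left blinfun.diff_left blinfun.diff_right)
  ultimately have "norm ((U o\<^sub>L U) - (V o\<^sub>L V)) \<le> u\<^sup>2 - v\<^sup>2"
    using norm_triangle_ineq[of "U o\<^sub>L (U - V)" "(U - V) o\<^sub>L V"]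
    by (simp add: power2_eq_square algebra_simps)
  moreover have "root_iterate Z (Suc (Suc n)) - root_iterate Z (Suc n) = (1/2) *\<^sub>R ((U o\<^sub>L U) - (V o\<^sub>L V))"
    unfolding root_iterate.simps(2)[of Z "Suc n"] U_def[symmetric]
    by (simp add: U_def V_def scaleR_diff_right scaleR_add_right)
  moreover have "root_majorant (Suc (Suc n)) - root_majorant (Suc n) = (u\<^sup>2 - v\<^sup>2) / 2"
    unfolding root_majorant.simps(2)[of "Suc n"] u_def[symmetric]
    by (simp add: u_def v_def field_simps)
  ultimately show ?case by simp
qed

lemma root_iterate_Cauchy:
  assumes "norm Z \<le> 1"
  shows "Cauchy (root_iterate Z)"
proof -
  have le: "norm (root_iterate Z (n + k) - root_iterate Z n) \<le> root_majorant (n + k) - root_majorant n" for n k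
  proof (induction k)
    case (Suc k)
    have "root_iterate Z (n + Suc k) - root_iterate Z n
        = (root_iterate Z (Suc (n + k)) - root_iterate Z (n + k)) + (root_iterate Z (n + k) - root_iterate Z n)"
      by simp
    then show ?case
      using norm_root_iterate_step[OF assms, of "n + k"] Suc.IH
        norm_triangle_ineq[of "root_iterate Z (Suc (n + k)) - root_iterate Z (n + k)" "root_iterate Z (n + k) - root_iterate Z n"]
      by (simp only: add_Suc_right)
  qed simp
  show ?thesis
  proof (rule metric_CauchyI)
    fix e :: real assume "e > 0"
    then obtain M where M: "\<And>m n. m \<ge> M \<Longrightarrow> n \<ge> M \<Longrightarrow> dist (root_majorant m) (root_majorant n) < e"
      using metric_CauchyD[OF root_majorant_Cauchy] by blast
    have *: "dist (root_iterate Z m) (root_iterate Z n) < e" if "n \<ge> M" "m \<ge> n" for m n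
    proof -
      have "dist (root_iterate Z m) (root_iterate Z n) \<le> root_majorant m - root_majorant n"
        using le[of n "m - n"] that(2) by (simp add: dist_norm)
      also have "\<dots> \<le> dist (root_majorant m) (root_majorant n)" by (simp add: dist_norm)
      also have "\<dots> < e" using M that by simp
      finally show ?thesis .
    qed
    have "dist (root_iterate Z m) (root_iterate Z n) < e" if "m \<ge> M" "n \<ge> M" for m n
      using *[of n m] *[of m n] that by (cases "m \<ge> n") (auto simp: dist_commute)
    then show "\<exists>M. \<forall>m\<ge>M. \<forall>n\<ge>M. dist (root_iterate Z m) (root_iterate Z n) < e" by blast
  qed
qed

definition commutes :: "('a \<Rightarrow> 'a) \<Rightarrow> ('a \<Rightarrow> 'a) \<Rightarrow> bool" where
  "commutes X T \<longleftrightarrow> (\<forall>x. X (T x) = T (X x))"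

text \<open>
  For \<open>0 \<le> T \<le> 1\<close> put \<open>Z = 1 - T\<close>; the iteration converges in norm to some \<open>Y\<close> with
  \<open>2 Y = Z + Y\<^sup>2\<close>, so that \<open>(1 - Y)\<^sup>2 = T\<close>.  The iterates are polynomials in \<open>Z\<close>, whence the
  commutation property.
\<close>

lemma contraction_sqrt_exists:
  fixes T :: "'a::{real_inner, banach} \<Rightarrow> 'a"
  assumes T: "pos_bounded T" and le1: "\<And>x. inner (T x) x \<le> (norm x)\<^sup>2"
  obtains R where "pos_bounded R" "\<And>x. R (R x) = T x"
    "\<And>X. bounded_linear X \<Longrightarrow> commutes X T \<Longrightarrow> commutes X R"
proof -
  note Tb = pos_boundedD[OF T]
  define z where "z x = x - T x" for x
  have zb: "bounded_linear z" unfolding z_def by (intro bounded_linear_sub bounded_linear_ident Tb(1))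
  have zp: "pos_bounded z"
    by (rule pos_boundedI[OF zb])
      (use Tb(3) le1 in \<open>auto simp: z_def inner_diff power2_norm_eq_inner\<close>)
  have zn: "norm (z x) \<le> 1 * norm x" for x
    by (rule pos_bounded_norm_le[OF zp])
      (use Tb(4) in \<open>auto simp: z_def inner_diff power2_norm_eq_inner\<close>)
  define Z where "Z = Blinfun z"
  have Zz: "blinfun_apply Z = z" using zb by (simp add: Z_def bounded_linear_Blinfun_apply)
  have Z1: "norm Z \<le> 1" by (rule norm_blinfun_bound) (use zn in \<open>simp_all add: Zz\<close>)
  obtain Y where Y: "root_iterate Z \<longlonglongrightarrow> Y"
    using root_iterate_Cauchy[OF Z1] Cauchy_convergent convergent_def by blast
  have Yx: "(\<lambda>n. root_iterate Z n x) \<longlonglongrightarrow> Y x" for x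
    by (intro blinfun.tendsto Y tendsto_const)
  have YY: "(\<lambda>n. root_iterate Z n (root_iterate Z n x)) \<longlonglongrightarrow> Y (Y x)" for x
    by (intro blinfun.tendsto Y Yx)
  have fixpt: "Y x = (1/2) *\<^sub>R (z x + Y (Y x))" for x
  proof -
    have "(\<lambda>n. (1/2) *\<^sub>R (z x + root_iterate Z n (root_iterate Z n x))) \<longlonglongrightarrow> (1/2) *\<^sub>R (z x + Y (Y x))"
      by (intro tendsto_intros YY)
    also have "(\<lambda>n. (1/2) *\<^sub>R (z x + root_iterate Z n (root_iterate Z n x))) = (\<lambda>n. root_iterate Z (Suc n) x)"
      by (simp add: blinfun.scaleR_left blinfun.add_left Zz)
    finally show ?thesis by (rule LIMSEQ_unique[OF LIMSEQ_Suc[OF Yx]])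
  qed
  have sym: "inner (Y x) y = inner x (Y y)" for x y
  proof -
    have zs: "inner (z a) b = inner a (z b)" for a b by (rule pos_boundedD(3)[OF zp])
    have it: "inner (root_iterate Z n x) y = inner x (root_iterate Z n y)" for n x y
      by (induction n arbitrary: x y)
        (simp_all add: blinfun.scaleR_left blinfun.add_left Zz inner_add zs)
    have "(\<lambda>n. inner (root_iterate Z n x) y) \<longlonglongrightarrow> inner (Y x) y" by (intro tendsto_intros Yx)
    moreover have "(\<lambda>n. inner x (root_iterate Z n y)) \<longlonglongrightarrow> inner x (Y y)" by (intro tendsto_intros Yx)
    ultimately show ?thesis unfolding it by (rule LIMSEQ_unique)
  qed
  have Yn: "norm Y \<le> 1"
  proof (rule Lim_bounded[OF tendsto_norm[OF Y]])
    show "\<forall>n\<ge>0. norm (root_iterate Z n) \<le> 1"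
      using norm_root_iterate[OF Z1] root_majorant_bounds order_trans by blast
  qed
  have Ynx: "norm (Y x) \<le> norm x" for x
    using norm_blinfun[of Y x] mult_right_mono[OF Yn norm_ge_zero[of x]] by linarith
  define R where "R x = x - Y x" for x
  have Rb: "bounded_linear R" unfolding R_def
    by (intro bounded_linear_sub bounded_linear_ident blinfun.bounded_linear_right)
  have "0 \<le> inner (R x) x" for x
  proof -
    have "inner (Y x) x \<le> norm (Y x) * norm x" by (rule norm_cauchy_schwarz)
    also have "\<dots> \<le> norm x * norm x" by (simp add: Ynx mult_right_mono)
    finally show ?thesis by (simp add: R_def inner_diff power2_norm_eq_inner[symmetric] power2_eq_square)
  qed
  then have Rp: "pos_bounded R" by (intro pos_boundedI[OF Rb]) (auto simp: R_def inner_diff sym)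
  moreover have "R (R x) = T x" for x
  proof -
    have "2 *\<^sub>R Y x = 2 *\<^sub>R ((1/2) *\<^sub>R (z x + Y (Y x)))" by (rule arg_cong[OF fixpt])
    then have "Y x + Y x - z x = Y (Y x)" by (simp only: scaleR_scaleR scaleR_2) simp
    then have "Y x + Y x - z x - Y (Y x) = 0" by (simp only: diff_self)
    moreover have "R (R x) = x - z x - (Y x + Y x - z x - Y (Y x))"
      by (simp add: R_def blinfun.diff_right)
    ultimately show ?thesis by (simp add: z_def del: diff_diff_eq2)
  qed
  moreover have "commutes X R" if X: "bounded_linear X" "commutes X T" for X
  proof -
    interpret X: bounded_linear X by (rule X)
    have Xz: "X (z x) = z (X x)" for x using X(2) by (simp add: commutes_def z_def X.diff)
    have it: "X (root_iterate Z n x) = root_iterate Z n (X x)" for n x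
      by (induction n arbitrary: x)
        (simp_all add: blinfun.scaleR_left blinfun.add_left Zz X.add X.scaleR X.zero Xz)
    have "X (Y x) = Y (X x)" for x
    proof (rule LIMSEQ_unique)
      show "(\<lambda>n. X (root_iterate Z n x)) \<longlonglongrightarrow> X (Y x)" by (rule X.tendsto[OF Yx])
      show "(\<lambda>n. X (root_iterate Z n x)) \<longlonglongrightarrow> Y (X x)" unfolding it by (rule Yx)
    qed
    then show ?thesis by (simp add: commutes_def R_def X.diff)
  qed
  ultimately show thesis by (rule that)
qed

lemma bounded_sqrt_exists:
  fixes T :: "'a::{real_inner, banach} \<Rightarrow> 'a"
  assumes T: "pos_bounded T"
  obtains R where "pos_bounded R" "\<And>x. R (R x) = T x"
    "\<And>X. bounded_linear X \<Longrightarrow> commutes X T \<Longrightarrow> commutes X R"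
proof -
  note Tb = pos_boundedD[OF T]
  obtain K where K: "K > 0" "\<And>x. norm (T x) \<le> norm x * K"
    using bounded_linear.pos_bounded[OF Tb(1)] by blast
  define T' where "T' x = (1/K) *\<^sub>R T x" for x
  have T'b: "bounded_linear T'" unfolding T'_def by (rule bounded_linear_const_scaleR[OF Tb(1)])
  have T'p: "pos_bounded T'"
    by (rule pos_boundedI[OF T'b]) (use Tb(3,4) K(1) in \<open>auto simp: T'_def\<close>)
  have le: "inner (T' x) x \<le> (norm x)\<^sup>2" for x
  proof -
    have "inner (T x) x \<le> norm (T x) * norm x" by (rule norm_cauchy_schwarz)
    also have "\<dots> \<le> (norm x * K) * norm x" using K(2) by (simp add: mult_right_mono)
    finally have "inner (T x) x \<le> K * (norm x)\<^sup>2" by (simp add: power2_eq_square mult_ac)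
    then show ?thesis using K(1) by (simp add: T'_def pos_divide_le_eq mult.commute)
  qed
  obtain R where R: "pos_bounded R" "\<And>x. R (R x) = T' x"
    "\<And>X. bounded_linear X \<Longrightarrow> commutes X T' \<Longrightarrow> commutes X R"
    using contraction_sqrt_exists[OF T'p le] by blast
  note Rb = pos_boundedD[OF R(1)]
  define S where "S x = sqrt K *\<^sub>R R x" for x
  have Sb: "bounded_linear S" unfolding S_def by (rule bounded_linear_const_scaleR[OF Rb(1)])
  have "pos_bounded S"
    by (rule pos_boundedI[OF Sb]) (use Rb(3,4) K(1) in \<open>auto simp: S_def\<close>)
  moreover have "S (S x) = T x" for x
    using K(1) by (simp add: S_def linear_cmul[OF Rb(2)] R(2) T'_def)
  moreover have "commutes X S" if X: "bounded_linear X" "commutes X T" for X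
  proof -
    interpret X: bounded_linear X by (rule X)
    have "commutes X T'" using X(2) by (simp add: commutes_def T'_def X.scaleR)
    then have "commutes X R" by (rule R(3)[OF X(1)])
    then show ?thesis by (simp add: commutes_def S_def X.scaleR)
  qed
  ultimately show thesis by (rule that)
qed

text \<open>
  If P and R are commuting positive roots and \<open>y = (P - R) x\<close>, then \<open>(P + R) y = 0\<close>, so both forms
  vanish at y and \<open>P y = R y = 0\<close>, whence \<open>\<parallel>y\<parallel>\<^sup>2 = \<langle>(P - R) x, y\<rangle> = 0\<close>.  Any two roots commute with the
  constructed one, because each commutes with its own square.
\<close>

lemma bounded_sqrt_unique:
  fixes P Q :: "'a::{real_inner, banach} \<Rightarrow> 'a"
  assumes P: "pos_bounded P" and Q: "pos_bounded Q" and eq: "\<And>x. P (P x) = Q (Q x)"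
  shows "P = Q"
proof -
  have main: "P = R"
    if P: "pos_bounded P" and R: "pos_bounded R" and PR: "\<And>x. P (P x) = R (R x)" and c: "commutes P R"
    for P R :: "'a \<Rightarrow> 'a"
  proof
    fix x
    note Pb = pos_boundedD[OF P] and Rb = pos_boundedD[OF R]
    define y where "y = P x - R x"
    have "P y + R y = 0"
      using c by (simp add: y_def linear_diff[OF Pb(2)] linear_diff[OF Rb(2)] PR commutes_def)
    then have "inner (P y) y + inner (R y) y = 0" by (simp flip: inner_add_left)
    then have "inner (P y) y = 0" "inner (R y) y = 0" using Pb(4)[of y] Rb(4)[of y] by linarith+
    then have "P y = 0" "R y = 0" by (simp_all add: pos_bounded_zero_form[OF P] pos_bounded_zero_form[OF R])
    have "inner y y = inner (P x) y - inner (R x) y" by (simp add: y_def inner_diff)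
    also have "\<dots> = inner x (P y) - inner x (R y)" by (simp only: Pb(3) Rb(3))
    also have "\<dots> = 0" using \<open>P y = 0\<close> \<open>R y = 0\<close> by simp
    finally show "P x = R x" by (simp add: y_def)
  qed
  have "pos_bounded (\<lambda>x. P (P x))"
    by (rule pos_bounded_gram[OF pos_boundedD(1,1,3)[OF P]])
  then obtain R where R: "pos_bounded R" "\<And>x. R (R x) = P (P x)"
    "\<And>X. bounded_linear X \<Longrightarrow> commutes X (\<lambda>x. P (P x)) \<Longrightarrow> commutes X R"
    using bounded_sqrt_exists by blast
  have "commutes P (\<lambda>x. P (P x))" by (simp add: commutes_def)
  moreover have "commutes Q (\<lambda>x. P (P x))" by (simp add: commutes_def eq)
  ultimately have "commutes P R" "commutes Q R"
    by (auto intro: R(3) pos_boundedD(1)[OF P] pos_boundedD(1)[OF Q])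
  then have "P = R" "Q = R"
    by (auto intro!: main[OF P R(1)] main[OF Q R(1)] simp only: R(2) eq)
  then show ?thesis by simp
qed

lemma bounded_sqrt_commutes:
  fixes R T :: "'a::{real_inner, banach} \<Rightarrow> 'a"
  assumes R: "pos_bounded R" and RT: "\<And>x. R (R x) = T x"
    and X: "bounded_linear X" "commutes X T"
  shows "commutes X R"
proof -
  have "pos_bounded (\<lambda>x. R (R x))"
    by (rule pos_bounded_gram[OF pos_boundedD(1,1,3)[OF R]])
  then have "pos_bounded T" by (simp only: RT)
  then obtain R' where R': "pos_bounded R'" "\<And>x. R' (R' x) = T x"
    "\<And>X. bounded_linear X \<Longrightarrow> commutes X T \<Longrightarrow> commutes X R'"
    using bounded_sqrt_exists by blast
  have "R = R'" by (rule bounded_sqrt_unique[OF R R'(1)]) (simp add: RT R'(2))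
  then show ?thesis using R'(3)[OF X] by simp
qed

text \<open>If \<open>R\<^sup>2 = P\<close>, then \<open>\<langle>P Q x, x\<rangle> = \<langle>Q R x, R x\<rangle>\<close>.\<close>

lemma pos_bounded_compose_commuting:
  fixes P Q :: "'a::{real_inner, banach} \<Rightarrow> 'a"
  assumes P: "pos_bounded P" and Q: "pos_bounded Q" and c: "commutes P Q"
  shows "pos_bounded (\<lambda>x. P (Q x))"
proof -
  note Pb = pos_boundedD[OF P] and Qb = pos_boundedD[OF Q]
  obtain R where R: "pos_bounded R" "\<And>x. R (R x) = P x"
    "\<And>X. bounded_linear X \<Longrightarrow> commutes X P \<Longrightarrow> commutes X R"
    using bounded_sqrt_exists[OF P] by blast
  have RQ: "R (Q x) = Q (R x)" for x using R(3)[OF Qb(1)] c by (simp add: commutes_def)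
  show ?thesis
  proof (rule pos_boundedI)
    show "bounded_linear (\<lambda>x. P (Q x))" by (rule bounded_linear_compose[OF Pb(1) Qb(1)])
    show "inner (P (Q x)) y = inner x (P (Q y))" for x y
      using c by (simp add: Pb(3) Qb(3) commutes_def)
    show "0 \<le> inner (P (Q x)) x" for x
      using Qb(4)[of "R x"] by (simp only: R(2)[symmetric] RQ[symmetric] pos_boundedD(3)[OF R(1)])

  qed
qed

section \<open>A form inequality of Heinz type\<close>

lemma bounded_powers_le_one:
  fixes q b :: real
  assumes "\<And>n::nat. q ^ (2 ^ n) \<le> b"
  shows "q \<le> 1"
proof (rule ccontr)
  assume "\<not> q \<le> 1"
  then obtain n where "b < q ^ n" using real_arch_pow[of q b] by auto
  also have "q ^ n \<le> q ^ (2 ^ n)"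
    by (rule power_increasing) (use \<open>\<not> q \<le> 1\<close> in \<open>auto intro: less_imp_le less_exp\<close>)
  finally show False using assms[of n] by simp
qed

text \<open>
  Fix \<open>e > 0\<close> and let \<open>L = (p + e)\<^sup>-\<^sup>1 h\<close>.  For the scalar product \<open>r(u, v) = \<langle>(p + e) u, v\<rangle>\<close> the map \<open>L\<close> is
  symmetric, so iterating Cauchy--Schwarz gives
  \<open>\<bar>r(L x, x)\<bar> ^ (2 ^ n) \<le> r(L ^ (2 ^ n) x, x) * r(x, x) ^ (2 ^ n - 1)\<close>.
  Since \<open>h (p + e)\<^sup>-\<^sup>1\<close> is a contraction, the first factor stays bounded in \<open>n\<close>, and a \<open>2 ^ n\<close>-th root
  leaves \<open>\<bar>\<langle>h x, x\<rangle>\<bar> = \<bar>r(L x, x)\<bar> \<le> r(x, x)\<close>.  The inequality is the Heinz inequality for the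
  exponent \<open>1/2\<close>, with the positivity of \<open>h\<close> replaced by symmetry.
\<close>

lemma heinz_form_bound:
  fixes h p :: "'a::real_inner \<Rightarrow> 'a"
  assumes h_sym: "\<And>u v. u \<in> D \<Longrightarrow> v \<in> D \<Longrightarrow> inner (h u) v = inner u (h v)"
    and p_lin: "linear_map_on D p"
    and p_sym: "\<And>u v. u \<in> D \<Longrightarrow> v \<in> D \<Longrightarrow> inner (p u) v = inner u (p v)"
    and p_pos: "\<And>u. u \<in> D \<Longrightarrow> 0 \<le> inner (p u) u"
    and onto: "\<And>e y. e > 0 \<Longrightarrow> \<exists>u\<in>D. p u + e *\<^sub>R u = y"
    and le: "\<And>u. u \<in> D \<Longrightarrow> norm (h u) \<le> norm (p u)"
    and x: "x \<in> D"
  shows "\<bar>inner (h x) x\<bar> \<le> inner (p x) x"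
proof (cases "x = 0")
  case True then show ?thesis by simp
next
  case False
  note pl = linear_map_onD[OF p_lin]
  have eps: "\<bar>inner (h x) x\<bar> \<le> inner (p x) x + e * (norm x)\<^sup>2" if e: "e > 0" for e
  proof -
    define q where "q u = p u + e *\<^sub>R u" for u
    have q_lin: "linear_map_on D q"
      using pl by (auto simp: linear_map_on_def q_def scaleR_add_right mult.commute)
    have q_sym: "inner (q u) v = inner u (q v)" if "u \<in> D" "v \<in> D" for u v
      using p_sym[OF that] by (simp add: q_def inner_add)
    have q_pos: "0 \<le> inner (q u) u" if "u \<in> D" for u
      using p_pos[OF that] e by (simp add: q_def inner_add)
    have "\<exists>w. w \<in> D \<and> q w = h u" for u using onto[OF e, of "h u"] by (auto simp: q_def)
    then obtain L where L: "\<And>u. L u \<in> D" "\<And>u. q (L u) = h u" by metis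
    define X where "X k = (L ^^ k) x" for k
    have XD: "X k \<in> D" for k by (cases k) (simp_all add: X_def x L(1))
    have qX: "q (X (Suc k)) = h (X k)" for k by (simp add: X_def L(2))
    define c where "c k = inner (q (X k)) x" for k
    have cX: "inner (q (X i)) (X j) = c (i + j)" for i j
    proof (induction j arbitrary: i)
      case 0 then show ?case by (simp add: c_def X_def)
    next
      case (Suc j)
      have "inner (q (X i)) (X (Suc j)) = inner (h (X i)) (X j)"
        by (simp add: q_sym[OF XD XD] qX h_sym[OF XD XD])
      then show ?case using Suc[of "Suc i"] by (simp add: qX)
    qed
    have hX: "norm (h (X k)) \<le> norm (h x)" for k
    proof (induction k)
      case 0 then show ?case by (simp add: X_def)
    next
      case (Suc k)
      have "(norm (p (X (Suc k))))\<^sup>2 \<le> (norm (q (X (Suc k))))\<^sup>2"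
        using p_pos[OF XD, of "Suc k"] e
        by (simp add: q_def power2_norm_eq_inner inner_add inner_commute)
      then have "norm (p (X (Suc k))) \<le> norm (h (X k))" by (simp flip: qX)
      then show ?case using le[OF XD, of "Suc k"] Suc.IH by linarith
    qed
    have cK: "\<bar>c (Suc k)\<bar> \<le> norm (h x) * norm x" for k
      using Cauchy_Schwarz_ineq2[of "h (X k)" x] mult_right_mono[OF hX norm_ge_zero, of k x]
      by (simp add: c_def qX)
    have c0: "c 0 > 0"
    proof -
      have "0 < e * inner x x" using e False by simp
      then show ?thesis using p_pos[OF x] by (simp add: c_def X_def q_def inner_add)
    qed
    have cs: "(c m)\<^sup>2 \<le> c (2 * m) * c 0" for m
      using cauchy_schwarz_form[OF q_lin q_sym q_pos XD XD, of m 0] by (simp add: cX mult_2)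
    have "(\<bar>c 1\<bar> / c 0) ^ (2 ^ n) \<le> \<bar>c (2 ^ n)\<bar> / c 0" for n
    proof (induction n)
      case (Suc n)
      have "(\<bar>c 1\<bar> / c 0) ^ (2 ^ Suc n) = ((\<bar>c 1\<bar> / c 0) ^ (2 ^ n))\<^sup>2"
        by (simp add: power_mult mult.commute flip: power_mult)
      also have "\<dots> \<le> (\<bar>c (2 ^ n)\<bar> / c 0)\<^sup>2" using Suc c0 by (intro power_mono) auto
      also have "\<dots> \<le> \<bar>c (2 ^ Suc n)\<bar> / c 0"
        using order_trans[OF cs[of "2 ^ n"] mult_right_mono[OF abs_ge_self]] c0
        by (simp add: power_divide power2_eq_square field_simps)
      finally show ?case .
    qed simp
    moreover have "\<bar>c (2 ^ n)\<bar> / c 0 \<le> norm (h x) * norm x / c 0" for n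
      using cK[of "2 ^ n - 1"] c0 by (simp add: divide_right_mono)
    ultimately have "\<bar>c 1\<bar> / c 0 \<le> 1" by (intro bounded_powers_le_one) (rule order_trans)
    then have "\<bar>c 1\<bar> \<le> c 0" using c0 by simp
    moreover have "c 1 = inner (h x) x" by (simp add: c_def X_def L(2))
    ultimately show ?thesis by (simp add: c_def X_def q_def inner_add power2_norm_eq_inner)
  qed
  show ?thesis
  proof (rule field_le_epsilon)
    fix e :: real assume "e > 0"
    then show "\<bar>inner (h x) x\<bar> \<le> inner (p x) x + e"
      using eps[of "e / (norm x)\<^sup>2"] False by simp
  qed
qed

section \<open>Closed operators and their adjoints\<close>

lemma linear_op_map_on:
  assumes "linear_op T"
  shows "linear_map_on (dom T) (\<lambda>x. the (T x))"
proof -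
  have "r *\<^sub>R x \<in> dom T \<and> the (T (r *\<^sub>R x)) = r *\<^sub>R the (T x)" if "x \<in> dom T" for r x
    using assms that unfolding linear_op_def scaleC_of_real[symmetric] by blast
  moreover have "0 \<in> dom T" using assms unfolding linear_op_def by blast
  moreover have "x + y \<in> dom T \<and> the (T (x + y)) = the (T x) + the (T y)"
    if "x \<in> dom T" "y \<in> dom T" for x y
    using assms that unfolding linear_op_def by blast
  ultimately show ?thesis unfolding linear_map_on_def subspace_def by blast
qed

lemmas linear_opD = linear_map_onD[OF linear_op_map_on]

lemma linear_op_scaleC:
  assumes "linear_op T" "x \<in> dom T"
  shows "c *\<^sub>C x \<in> dom T" "the (T (c *\<^sub>C x)) = c *\<^sub>C the (T x)"
  using assms unfolding linear_op_def by blast+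

lemma linear_op_graphI:
  assumes "\<And>x y u v. T x = Some u \<Longrightarrow> T y = Some v \<Longrightarrow> T (x + y) = Some (u + v)"
    and "\<And>c x u. T x = Some u \<Longrightarrow> T (c *\<^sub>C x) = Some (c *\<^sub>C u)" and "T 0 \<noteq> None"
  shows "linear_op T"
  unfolding linear_op_def
proof (intro conjI ballI allI)
  fix x y assume "x \<in> dom T" "y \<in> dom T"
  then obtain u v where uv: "T x = Some u" "T y = Some v" by blast
  show "x + y \<in> dom T" "the (T (x + y)) = the (T x) + the (T y)" using assms(1)[OF uv] uv by auto
next
  fix c x assume "x \<in> dom T"
  then obtain u where u: "T x = Some u" by blast
  show "c *\<^sub>C x \<in> dom T" "the (T (c *\<^sub>C x)) = c *\<^sub>C the (T x)" using assms(2)[OF u] u by auto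
qed (use assms(3) in auto)

lemma closed_opD:
  assumes "closed_op T" "\<And>n. u n \<in> dom T" "u \<longlonglongrightarrow> x" "(\<lambda>n. the (T (u n))) \<longlonglongrightarrow> y"
  shows "T x = Some y"
proof -
  have "(u n, the (T (u n))) \<in> Map.graph T" for n using assms(2)[of n] by (auto simp: Map.graph_def)
  moreover have "(\<lambda>n. (u n, the (T (u n)))) \<longlonglongrightarrow> (x, y)" by (intro tendsto_Pair assms)
  ultimately have "(x, y) \<in> Map.graph T"
    using assms(1) closed_sequentially[of "Map.graph T" "\<lambda>n. (u n, the (T (u n)))"] by (simp add: closed_op_def)
  then show ?thesis by (simp add: Map.graph_def)
qed

lemma closed_opI:
  assumes "\<And>u x y. (\<And>n. u n \<in> dom T) \<Longrightarrow> u \<longlonglongrightarrow> x \<Longrightarrow> (\<lambda>n. the (T (u n))) \<longlonglongrightarrow> y \<Longrightarrow> T x = Some y"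
  shows "closed_op T"
  unfolding closed_op_def closed_sequential_limits
proof (intro allI impI, elim conjE)
  fix w l assume w: "\<forall>n. w n \<in> Map.graph T" and l: "w \<longlonglongrightarrow> l"
  have eq: "T (fst (w n)) = Some (snd (w n))" for n
    using w[rule_format, of n] by (auto simp: Map.graph_def)
  have "T (fst l) = Some (snd l)"
    by (rule assms[of "\<lambda>n. fst (w n)"]) (use eq tendsto_fst[OF l] tendsto_snd[OF l] in auto)
  then show "l \<in> Map.graph T" by (cases l) (simp add: Map.graph_def)
qed

lemma dense_orthogonal_zero:
  fixes z :: "'a::real_inner"
  assumes "closure D = UNIV" "\<And>x. x \<in> D \<Longrightarrow> inner x z = 0"
  shows "z = 0"
proof -
  obtain u where u: "\<And>n. u n \<in> D" "u \<longlonglongrightarrow> z"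
    using assms(1) closure_sequential[of z D] by auto
  have "(\<lambda>n. inner (u n) z) \<longlonglongrightarrow> inner z z" by (intro tendsto_intros u(2))
  then have "(\<lambda>n. 0) \<longlonglongrightarrow> inner z z" using assms(2)[OF u(1)] by simp
  then show ?thesis by (simp add: LIMSEQ_const_iff)
qed

lemma subspace_closure:
  fixes D :: "'a::real_normed_vector set"
  assumes "subspace D"
  shows "subspace (closure D)"
proof (rule subspaceI)
  show "0 \<in> closure D" using subspace_0[OF assms] closure_subset by blast
  show "x + y \<in> closure D" if xy: "x \<in> closure D" "y \<in> closure D" for x y
  proof -
    obtain u v where "\<forall>n. u n \<in> D" "u \<longlonglongrightarrow> x" "\<forall>n. v n \<in> D" "v \<longlonglongrightarrow> y"
      using xy unfolding closure_sequential by blast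
    then have "\<forall>n. u n + v n \<in> D" "(\<lambda>n. u n + v n) \<longlonglongrightarrow> x + y"
      using subspace_add[OF assms] tendsto_add by blast+
    then show ?thesis unfolding closure_sequential by (intro exI[of _ "\<lambda>n. u n + v n"]) simp
  qed
  show "c *\<^sub>R x \<in> closure D" if x: "x \<in> closure D" for c x
  proof -
    obtain u where "\<forall>n. u n \<in> D" "u \<longlonglongrightarrow> x" using x unfolding closure_sequential by blast
    then have "\<forall>n. c *\<^sub>R u n \<in> D" "(\<lambda>n. c *\<^sub>R u n) \<longlonglongrightarrow> c *\<^sub>R x"
      using subspace_scale[OF assms] tendsto_scaleR[OF tendsto_const] by blast+
    then show ?thesis unfolding closure_sequential by (intro exI[of _ "\<lambda>n. c *\<^sub>R u n"]) simp
  qed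
qed

lemma subspace_denseI:
  fixes D :: "'a::{real_inner, complete_space} set"
  assumes "subspace D" and orth: "\<And>y. (\<And>u. u \<in> D \<Longrightarrow> inner y u = 0) \<Longrightarrow> y = 0"
  shows "closure D = UNIV"
proof -
  have "p \<in> closure D" for p
  proof -
    obtain g where g: "g \<in> closure D" "\<And>s. s \<in> closure D \<Longrightarrow> inner (p - g) s = 0"
      using orthogonal_projection_exists[of "closure D" p] assms(1) by (auto intro: subspace_closure)
    have "p - g = 0" by (rule orth) (use g(2) closure_subset in blast)
    then show ?thesis using g(1) by simp
  qed
  then show ?thesis by blast
qed

text \<open>
  The real part of the inner product suffices, because the imaginary part at x is the real part at
  \<open>- \<i> x\<close>, which is also in the domain.
\<close>

lemma adj_eq_Some_iff:
  assumes "linear_op T" "densely_defined T"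
  shows "adj T y = Some z \<longleftrightarrow> (\<forall>x\<in>dom T. inner (the (T x)) y = inner x z)"
proof -
  have re: "(\<forall>x\<in>dom T. cinner (the (T x)) y = cinner x z) \<longleftrightarrow> (\<forall>x\<in>dom T. inner (the (T x)) y = inner x z)" for z
  proof (intro iffI ballI)
    fix x assume "\<forall>x\<in>dom T. cinner (the (T x)) y = cinner x z" "x \<in> dom T"
    then show "inner (the (T x)) y = inner x z" by (metis Re_cinner)
  next
    fix x assume a: "\<forall>x\<in>dom T. inner (the (T x)) y = inner x z" and x: "x \<in> dom T"
    have "inner (the (T (- \<i> *\<^sub>C x))) y = inner (- \<i> *\<^sub>C x) z"
      using a linear_op_scaleC(1)[OF assms(1) x] by blast
    then have "inner (the (T x)) (\<i> *\<^sub>C y) = inner x (\<i> *\<^sub>C z)"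
      by (simp add: linear_op_scaleC(2)[OF assms(1) x] inner_scaleC_left)
    moreover have "inner (the (T x)) y = inner x z" using a x by blast
    ultimately show "cinner (the (T x)) y = cinner x z" by (simp add: complex_eq_iff Re_cinner Im_cinner)
  qed
  have uniq: "z = z'" if "\<forall>x\<in>dom T. inner (the (T x)) y = inner x z" "\<forall>x\<in>dom T. inner (the (T x)) y = inner x z'" for z z'
  proof -
    have "z - z' = 0"
      by (rule dense_orthogonal_zero[of "dom T"])
        (use assms(2) that in \<open>auto simp: densely_defined_def inner_diff\<close>)
    then show ?thesis by simp
  qed
  show ?thesis
  proof (cases "\<exists>z. \<forall>x\<in>dom T. inner (the (T x)) y = inner x z")
    case True
    then obtain z0 where z0: "\<forall>x\<in>dom T. inner (the (T x)) y = inner x z0" by blast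
    have "(THE z. \<forall>x\<in>dom T. inner (the (T x)) y = inner x z) = z0"
      by (rule the_equality) (use z0 uniq in blast)+
    then have "adj T y = Some z0" using True unfolding adj_def re by simp
    then show ?thesis using z0 uniq by auto
  next
    case False
    then have "adj T y = None" unfolding adj_def re by simp
    then show ?thesis using False by auto
  qed
qed

lemma adj_inner:
  assumes "linear_op T" "densely_defined T" "x \<in> dom T" "y \<in> dom (adj T)"
  shows "inner (the (T x)) y = inner x (the (adj T y))"
  using adj_eq_Some_iff[OF assms(1,2), of y "the (adj T y)"] assms(3,4) by auto

lemma linear_op_adj:
  assumes "linear_op T" "densely_defined T"
  shows "linear_op (adj T)"
proof (rule linear_op_graphI)
  show "adj T (x + y) = Some (u + v)" if "adj T x = Some u" "adj T y = Some v" for x y u v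
    using that by (simp add: adj_eq_Some_iff[OF assms] inner_add)
  show "adj T (c *\<^sub>C x) = Some (c *\<^sub>C u)" if "adj T x = Some u" for c x u
    unfolding adj_eq_Some_iff[OF assms]
  proof
    fix w assume w: "w \<in> dom T"
    have "inner (the (T w)) (c *\<^sub>C x) = inner (the (T (cnj c *\<^sub>C w))) x"
      by (simp add: linear_op_scaleC[OF assms(1) w] inner_scaleC_left)
    also have "\<dots> = inner (cnj c *\<^sub>C w) u"
      using that linear_op_scaleC(1)[OF assms(1) w] by (simp only: adj_eq_Some_iff[OF assms])
    finally show "inner (the (T w)) (c *\<^sub>C x) = inner w (c *\<^sub>C u)" by (simp add: inner_scaleC_left)
  qed
  have "adj T 0 = Some 0" by (simp add: adj_eq_Some_iff[OF assms])
  then show "adj T 0 \<noteq> None" by simp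
qed

lemma closed_op_adj:
  assumes "linear_op T" "densely_defined T"
  shows "closed_op (adj T)"
proof (rule closed_opI)
  fix u x y
  assume u: "\<And>n. u n \<in> dom (adj T)" "u \<longlonglongrightarrow> x" "(\<lambda>n. the (adj T (u n))) \<longlonglongrightarrow> y"
  show "adj T x = Some y"
    unfolding adj_eq_Some_iff[OF assms]
  proof
    fix w assume w: "w \<in> dom T"
    have "(\<lambda>n. inner (the (T w)) (u n)) \<longlonglongrightarrow> inner (the (T w)) x" by (intro tendsto_intros u)
    moreover have "(\<lambda>n. inner (the (T w)) (u n)) \<longlonglongrightarrow> inner w y"
      unfolding adj_inner[OF assms w u(1)] by (intro tendsto_intros u)
    ultimately show "inner (the (T w)) x = inner w y" by (rule LIMSEQ_unique)
  qed
qed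

lemma map_comp_eq_Some_iff: "(S \<circ>\<^sub>m T) x = Some z \<longleftrightarrow> (\<exists>y. T x = Some y \<and> S y = Some z)"
  by (auto simp: map_comp_def split: option.splits)

lemma linear_op_comp:
  assumes "linear_op S" "linear_op T"
  shows "linear_op (S \<circ>\<^sub>m T)"
proof -
  have g: "R (x + y) = Some (u + v)" if "linear_op R" "R x = Some u" "R y = Some v" for R :: "'a \<rightharpoonup> 'a" and x y u v
  proof -
    have "x \<in> dom R" "y \<in> dom R" using that by auto
    then have "x + y \<in> dom R" "the (R (x + y)) = u + v"
      using that subspace_add[OF linear_opD(1)] linear_opD(2) by fastforce+
    then show ?thesis by auto
  qed
  have c: "R (c *\<^sub>C x) = Some (c *\<^sub>C u)" if "linear_op R" "R x = Some u" for R :: "'a \<rightharpoonup> 'a" and x c u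
    using linear_op_scaleC[OF that(1), of x c] that(2) by fastforce
  have "S 0 = Some 0" "T 0 = Some 0"
    using linear_opD(1)[OF assms(1)] linear_opD(5)[OF assms(1)] linear_opD(1)[OF assms(2)] linear_opD(5)[OF assms(2)]
    by (auto dest!: subspace_0)
  then show ?thesis
    by (intro linear_op_graphI) (auto simp: map_comp_eq_Some_iff intro: g[OF assms(1)] g[OF assms(2)] c[OF assms(1)] c[OF assms(2)] split: option.splits)
qed

section \<open>Positive self-adjoint operators\<close>

text \<open>
  For a complex linear operator, symmetry with respect to the real inner product already makes the
  number \<open>\<langle>S x, x\<rangle>\<close> real.
\<close>

lemma positive_selfadjoint_maximalI:
  assumes lin: "linear_op S" and dense: "closure (dom S) = UNIV"
    and sym: "\<And>x y. x \<in> dom S \<Longrightarrow> y \<in> dom S \<Longrightarrow> inner (the (S x)) y = inner x (the (S y))"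
    and pos: "\<And>x. x \<in> dom S \<Longrightarrow> 0 \<le> inner (the (S x)) x"
    and max: "\<And>y z. (\<And>x. x \<in> dom S \<Longrightarrow> inner (the (S x)) y = inner x z) \<Longrightarrow> S y = Some z"
  shows "positive_selfadjoint_op S"
proof -
  have dd: "densely_defined S" using dense by (simp add: densely_defined_def)
  have "adj S y = Some z \<longleftrightarrow> S y = Some z" for y z
  proof
    assume "adj S y = Some z"
    then show "S y = Some z" unfolding adj_eq_Some_iff[OF lin dd] by (intro max) blast
  next
    assume y: "S y = Some z"
    show "adj S y = Some z"
      unfolding adj_eq_Some_iff[OF lin dd] using sym[of _ y] y by auto
  qed
  then have "adj S = S" by (metis ext not_None_eq)
  moreover have "0 \<le> cinner (the (S x)) x" if x: "x \<in> dom S" for x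
  proof -
    have "inner (the (S x)) (\<i> *\<^sub>C x) = inner x (\<i> *\<^sub>C the (S x))"
      using sym[OF x linear_op_scaleC(1)[OF lin x]] linear_op_scaleC(2)[OF lin x] by simp
    also have "\<dots> = - inner (the (S x)) (\<i> *\<^sub>C x)"
    proof -
      have "inner x (\<i> *\<^sub>C the (S x)) = inner ((- \<i>) *\<^sub>C x) (the (S x))" by (simp add: inner_scaleC_left)
      also have "(- \<i>) *\<^sub>C x = - (\<i> *\<^sub>C x)"
        using scaleC_scaleC[of "complex_of_real (-1)" \<i> x] by (simp only: scaleC_of_real) simp
      finally show ?thesis by (simp add: inner_commute)
    qed
    finally show ?thesis using pos[OF x] by (simp add: less_eq_complex_def Re_cinner Im_cinner)
  qed
  ultimately show ?thesis using lin dd by (simp add: positive_selfadjoint_op_def selfadjoint_op_def)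
qed

text \<open>
  Surjectivity of \<open>1 + S\<close> replaces both density of the domain and maximality: a vector orthogonal to
  the domain has the form \<open>x + S x\<close>, and pairing it with x shows \<open>x = 0\<close>.
\<close>

lemma positive_selfadjointI:
  assumes lin: "linear_op S"
    and sym: "\<And>x y. x \<in> dom S \<Longrightarrow> y \<in> dom S \<Longrightarrow> inner (the (S x)) y = inner x (the (S y))"
    and pos: "\<And>x. x \<in> dom S \<Longrightarrow> 0 \<le> inner (the (S x)) x"
    and onto: "\<And>z. \<exists>x\<in>dom S. x + the (S x) = z"
  shows "positive_selfadjoint_op S"
proof (rule positive_selfadjoint_maximalI[OF lin _ sym pos])
  show "closure (dom S) = UNIV"
  proof (rule subspace_denseI[OF linear_opD(1)[OF lin]])
    fix y assume y: "\<And>u. u \<in> dom S \<Longrightarrow> inner y u = 0"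
    obtain x where x: "x \<in> dom S" "x + the (S x) = y" using onto by blast
    have "inner x x + inner (the (S x)) x = 0" using y[OF x(1)] x(2) by (auto simp: inner_add_left)
    then have "inner x x = 0" using pos[OF x(1)] inner_ge_zero[of x] by linarith
    then show "y = 0" using x(2) linear_opD(5)[OF lin] by simp
  qed
  fix y z assume a: "\<And>x. x \<in> dom S \<Longrightarrow> inner (the (S x)) y = inner x z"
  obtain x where x: "x \<in> dom S" "x + the (S x) = y + z" using onto by blast
  have "inner (u + the (S u)) (y - x) = 0" if u: "u \<in> dom S" for u
  proof -
    have "inner (u + the (S u)) y = inner u (y + z)" using a[OF u] by (simp add: inner_add)
    also have "\<dots> = inner (u + the (S u)) x"
      using sym[OF u x(1)] by (simp add: inner_add flip: x(2))
    finally show ?thesis by (simp add: inner_diff)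
  qed
  moreover obtain u where "u \<in> dom S" "u + the (S u) = y - x" using onto by blast
  ultimately have "inner (y - x) (y - x) = 0" by metis
  then have "y = x" by simp
  then show "S y = Some z" using x by auto
qed auto

lemma positive_selfadjointD:
  assumes "positive_selfadjoint_op S"
  shows "linear_op S" "densely_defined S" "closed_op S" "adj S = S"
    and "x \<in> dom S \<Longrightarrow> y \<in> dom S \<Longrightarrow> inner (the (S x)) y = inner x (the (S y))"
    and "x \<in> dom S \<Longrightarrow> 0 \<le> inner (the (S x)) x"
proof -
  show a: "linear_op S" "densely_defined S" "adj S = S"
    using assms by (simp_all add: positive_selfadjoint_op_def selfadjoint_op_def)
  show "closed_op S" using closed_op_adj[OF a(1,2)] a(3) by simp
  show "inner (the (S x)) y = inner x (the (S y))" if "x \<in> dom S" "y \<in> dom S"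
    using adj_inner[OF a(1,2) that(1), of y] that(2) a(3) by simp
  show "0 \<le> inner (the (S x)) x" if "x \<in> dom S"
    using assms that by (simp add: positive_selfadjoint_op_def less_eq_complex_def Re_cinner)
qed

text \<open>Used to pass to the limit with a closed operator that is dominated in norm by another one.\<close>

lemma complete_space_Cauchy_bound:
  fixes u :: "nat \<Rightarrow> 'a::{real_normed_vector, complete_space}" and v :: "nat \<Rightarrow> 'b::real_normed_vector"
  assumes "convergent v" "c > 0" "\<And>m n. c * norm (u m - u n) \<le> norm (v m - v n)"
  obtains x where "u \<longlonglongrightarrow> x"
proof -
  have "Cauchy v" using assms(1) by (rule convergent_Cauchy)
  have "Cauchy u"
  proof (rule metric_CauchyI)
    fix e :: real assume "e > 0"
    then obtain M where M: "\<And>m n. m \<ge> M \<Longrightarrow> n \<ge> M \<Longrightarrow> dist (v m) (v n) < c * e"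
      using metric_CauchyD[OF \<open>Cauchy v\<close>, of "c * e"] assms(2) by auto
    have "dist (u m) (u n) < e" if "m \<ge> M" "n \<ge> M" for m n
    proof -
      have "c * norm (u m - u n) < c * e"
        using assms(3)[of m n] M[OF that] by (simp add: dist_norm)
      then show ?thesis using assms(2) by (simp add: dist_norm)
    qed
    then show "\<exists>M. \<forall>m\<ge>M. \<forall>n\<ge>M. dist (u m) (u n) < e" by blast
  qed
  then show thesis using that Cauchy_convergent convergent_def by blast
qed

text \<open>
  The range of \<open>S + e\<close> is closed because \<open>e \<parallel>x\<parallel> \<le> \<parallel>S x + e x\<parallel>\<close>; a vector orthogonal to it is an
  eigenvector of the adjoint of S, which is S, for the eigenvalue \<open>- e\<close>, hence zero.
\<close>

lemma positive_selfadjoint_shift_onto: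
  assumes S: "positive_selfadjoint_op S" and e: "e > 0"
  shows "\<exists>x\<in>dom S. the (S x) + e *\<^sub>R x = z"
proof -
  note SD = positive_selfadjointD[OF S] and Sl = linear_opD[OF positive_selfadjointD(1)[OF S]]
  define f where "f x = the (S x) + e *\<^sub>R x" for x
  have fD: "f (x - y) = f x - f y" if "x \<in> dom S" "y \<in> dom S" for x y
    using Sl(4)[OF that] by (simp add: f_def scaleR_diff_right)
  have low: "e * norm x \<le> norm (f x)" if "x \<in> dom S" for x
  proof (rule power2_le_imp_le)
    have "(norm (f x))\<^sup>2 = (norm (the (S x)))\<^sup>2 + 2 * e * inner (the (S x)) x + (e * norm x)\<^sup>2"
      unfolding f_def power_mult_distrib power2_norm_eq_inner
      by (simp add: inner_add inner_commute power2_eq_square)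
    moreover have "0 \<le> 2 * e * inner (the (S x)) x" using SD(6)[OF that] e by simp
    moreover have "0 \<le> (norm (the (S x)))\<^sup>2" by simp
    ultimately show "(e * norm x)\<^sup>2 \<le> (norm (f x))\<^sup>2" by linarith
  qed simp
  have sub: "subspace (f ` dom S)"
  proof (rule subspaceI)
    show "0 \<in> f ` dom S"
      using subspace_0[OF Sl(1)] Sl(5) by (auto simp: f_def image_iff intro!: bexI[of _ 0])
    show "x + y \<in> f ` dom S" if xy: "x \<in> f ` dom S" "y \<in> f ` dom S" for x y
    proof -
      obtain u v where uv: "u \<in> dom S" "v \<in> dom S" "x = f u" "y = f v" using xy by blast
      have "x + y = f (u + v)" using Sl(2)[OF uv(1,2)] uv by (simp add: f_def scaleR_add_right)
      then show ?thesis using subspace_add[OF Sl(1) uv(1,2)] by blast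
    qed
    show "c *\<^sub>R x \<in> f ` dom S" if x: "x \<in> f ` dom S" for c x
    proof -
      obtain u where u: "u \<in> dom S" "x = f u" using x by blast
      have "c *\<^sub>R x = f (c *\<^sub>R u)" using Sl(3)[OF u(1)] u by (simp add: f_def scaleR_add_right)
      then show ?thesis using subspace_scale[OF Sl(1) u(1)] by blast
    qed
  qed
  have cl: "closed (f ` dom S)"
    unfolding closed_sequential_limits
  proof (intro allI impI, elim conjE)
    fix v l assume v: "\<forall>n. v n \<in> f ` dom S" and l: "v \<longlonglongrightarrow> l"
    then obtain u where u: "\<And>n. u n \<in> dom S" "\<And>n. v n = f (u n)"
      unfolding image_iff by metis
    have "e * norm (u m - u n) \<le> norm (v m - v n)" for m n
      using low[OF subspace_diff[OF Sl(1) u(1) u(1)], of m n] by (simp add: u(2) fD u(1))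
    then obtain x where x: "u \<longlonglongrightarrow> x"
      using complete_space_Cauchy_bound[OF _ e, of v u] l convergent_def by blast
    have "(\<lambda>n. v n - e *\<^sub>R u n) \<longlonglongrightarrow> l - e *\<^sub>R x" by (intro tendsto_intros l x)
    then have "S x = Some (l - e *\<^sub>R x)"
      by (intro closed_opD[OF SD(3) u(1) x]) (simp add: u(2) f_def)
    then have "x \<in> dom S" "f x = l" by (auto simp: f_def)
    then show "l \<in> f ` dom S" by blast
  qed
  obtain g where g: "g \<in> f ` dom S" "\<And>s. s \<in> f ` dom S \<Longrightarrow> inner (z - g) s = 0"
    using orthogonal_projection_exists[OF sub cl] by blast
  have "inner (the (S u)) (z - g) = inner u (- e *\<^sub>R (z - g))" if "u \<in> dom S" for u
  proof -
    have "inner (f u) (z - g) = 0" using g(2) that by (metis imageI inner_commute)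
    then show ?thesis by (simp add: f_def inner_add_left)
  qed
  then have "S (z - g) = Some (- e *\<^sub>R (z - g))"
    using adj_eq_Some_iff[OF SD(1,2)] SD(4) by metis
  then have "0 \<le> - e * inner (z - g) (z - g)" using SD(6)[of "z - g"] by auto
  then have "inner (z - g) (z - g) \<le> 0" using e by (simp add: mult_le_0_iff)
  then have "inner (z - g) (z - g) = 0" using inner_ge_zero[of "z - g"] by linarith
  then have "z = g" by simp
  then show ?thesis using g(1) by (auto simp: f_def)
qed

section \<open>The resolvent of the Gram operator\<close>

text \<open>
  For a closed densely defined T this is \<open>(1 + T\<^sup>*T)\<^sup>-\<^sup>1\<close>, written variationally so that the adjoint does not occur.
\<close>

definition gram_resolvent :: "('a::complex_hilbert_space \<rightharpoonup> 'a) \<Rightarrow> 'a \<Rightarrow> 'a" where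
  "gram_resolvent T z =
     (THE x. x \<in> dom T \<and> (\<forall>w\<in>dom T. inner (the (T x)) (the (T w)) = inner (z - x) w))"

lemma in_graph_iff: "p \<in> Map.graph T \<longleftrightarrow> (\<exists>x\<in>dom T. p = (x, the (T x)))"
  by (cases p) (auto simp: Map.graph_def dom_def)

locale closed_linear_op =
  fixes T :: "'a::complex_hilbert_space \<rightharpoonup> 'a"
  assumes lin: "linear_op T" and cl: "closed_op T"
begin

lemmas lin_rules = linear_opD[OF lin]

lemma subspace_graph: "subspace (Map.graph T)"
proof (rule subspaceI)
  show "0 \<in> Map.graph T"
    using subspace_0[OF lin_rules(1)] lin_rules(5) by (auto simp: Map.graph_def zero_prod_def)
  fix p q assume p: "p \<in> Map.graph T"
  obtain x where x: "x \<in> dom T" "p = (x, the (T x))" using p by (auto simp: in_graph_iff)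
  show "c *\<^sub>R p \<in> Map.graph T" for c
    using subspace_scale[OF lin_rules(1) x(1), of c] lin_rules(3)[OF x(1), of c] x(2)
    by (auto simp: Map.graph_def)
  assume q: "q \<in> Map.graph T"
  obtain y where y: "y \<in> dom T" "q = (y, the (T y))" using q by (auto simp: in_graph_iff)
  show "p + q \<in> Map.graph T"
    using subspace_add[OF lin_rules(1) x(1) y(1)] lin_rules(2)[OF x(1) y(1)] x(2) y(2)
    by (auto simp: Map.graph_def)
qed

text \<open>The solution is the first component of the projection of \<open>(z, 0)\<close> onto the graph of T.\<close>

lemma gram_solution_exists:
  "\<exists>x\<in>dom T. \<forall>w\<in>dom T. inner (the (T x)) (the (T w)) = inner (z - x) w"
proof -
  obtain g where g: "g \<in> Map.graph T" "\<And>s. s \<in> Map.graph T \<Longrightarrow> inner ((z, 0) - g) s = 0"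
    using orthogonal_projection_exists[OF subspace_graph, of "(z, 0)"] cl by (auto simp: closed_op_def)
  obtain x where x: "x \<in> dom T" "g = (x, the (T x))" using g(1) by (auto simp: in_graph_iff)
  have "inner (the (T x)) (the (T w)) = inner (z - x) w" if "w \<in> dom T" for w
  proof -
    have "(w, the (T w)) \<in> Map.graph T" using that by (auto simp: Map.graph_def)
    from g(2)[OF this] show ?thesis by (simp add: x(2))
  qed
  then show ?thesis using x(1) by blast
qed

lemma gram_solution_unique:
  assumes "x \<in> dom T" "\<And>w. w \<in> dom T \<Longrightarrow> inner (the (T x)) (the (T w)) = inner (z - x) w"
    and "y \<in> dom T" "\<And>w. w \<in> dom T \<Longrightarrow> inner (the (T y)) (the (T w)) = inner (z - y) w"
  shows "x = y"
proof -
  have d: "x - y \<in> dom T" using assms(1,3) by (simp add: subspace_diff lin_rules(1))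
  have "inner (the (T (x - y))) (the (T (x - y))) = inner (z - x) (x - y) - inner (z - y) (x - y)"
    using assms(2)[OF d] assms(4)[OF d] by (simp add: lin_rules(4)[OF assms(1,3)] inner_diff_left)
  also have "\<dots> = - inner (x - y) (x - y)" by (simp add: inner_diff_left)
  finally have "inner (x - y) (x - y) = 0"
    using inner_ge_zero[of "the (T (x - y))"] inner_ge_zero[of "x - y"] by linarith
  then show ?thesis by simp
qed

abbreviation "C \<equiv> gram_resolvent T"

lemma gram_resolvent_eqI:
  assumes "x \<in> dom T" "\<And>w. w \<in> dom T \<Longrightarrow> inner (the (T x)) (the (T w)) = inner (z - x) w"
  shows "C z = x"
  unfolding gram_resolvent_def
  by (rule the_equality) (use assms gram_solution_unique[OF _ _ assms] in blast)+

lemma gram_resolvent_dom: "C z \<in> dom T"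
  and gram_resolvent_inner: "w \<in> dom T \<Longrightarrow> inner (the (T (C z))) (the (T w)) = inner (z - C z) w"
proof -
  obtain x where x: "x \<in> dom T" "\<forall>w\<in>dom T. inner (the (T x)) (the (T w)) = inner (z - x) w"
    using gram_solution_exists by blast
  then have "C z = x" by (intro gram_resolvent_eqI) auto
  then show "C z \<in> dom T" "w \<in> dom T \<Longrightarrow> inner (the (T (C z))) (the (T w)) = inner (z - C z) w"
    using x by auto
qed

lemma gram_resolvent_add: "C (y + z) = C y + C z"
proof (rule gram_resolvent_eqI)
  show "C y + C z \<in> dom T" by (simp add: subspace_add lin_rules(1) gram_resolvent_dom)
  show "inner (the (T (C y + C z))) (the (T w)) = inner (y + z - (C y + C z)) w" if "w \<in> dom T" for w
    using gram_resolvent_inner[OF that, of y] gram_resolvent_inner[OF that, of z]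
    by (simp add: lin_rules(2) gram_resolvent_dom inner_add inner_diff)
qed

lemma gram_resolvent_scaleC: "C (c *\<^sub>C z) = c *\<^sub>C C z"
proof (rule gram_resolvent_eqI)
  show "c *\<^sub>C C z \<in> dom T" by (rule linear_op_scaleC(1)[OF lin gram_resolvent_dom])
  show "inner (the (T (c *\<^sub>C C z))) (the (T w)) = inner (c *\<^sub>C z - c *\<^sub>C C z) w" if w: "w \<in> dom T" for w
  proof -
    have "inner (the (T (c *\<^sub>C C z))) (the (T w)) = inner (the (T (C z))) (the (T (cnj c *\<^sub>C w)))"
      by (simp add: linear_op_scaleC(2)[OF lin] w gram_resolvent_dom inner_scaleC_left)
    also have "\<dots> = inner (z - C z) (cnj c *\<^sub>C w)"
      by (rule gram_resolvent_inner[OF linear_op_scaleC(1)[OF lin w]])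
    also have "\<dots> = inner (c *\<^sub>C z - c *\<^sub>C C z) w"
      by (simp add: inner_diff inner_scaleC_left)
    finally show ?thesis .
  qed
qed

lemma gram_resolvent_form:
  "inner (C y) z = inner (the (T (C y))) (the (T (C z))) + inner (C y) (C z)"
  using gram_resolvent_inner[OF gram_resolvent_dom, of z y]
  by (simp add: inner_diff inner_commute)

lemma gram_resolvent_norm: "norm (C z) \<le> norm z" "norm (the (T (C z))) \<le> norm z"
proof -
  have le: "(norm (the (T (C z))))\<^sup>2 + (norm (C z))\<^sup>2 \<le> norm (C z) * norm z"
    using gram_resolvent_form[of z z] norm_cauchy_schwarz[of "C z" z]
    by (simp add: power2_norm_eq_inner)
  then have "norm (C z) * norm (C z) \<le> norm (C z) * norm z"
    using zero_le_power2[of "norm (the (T (C z)))"] power2_eq_square[of "norm (C z)"] by linarith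
  then show 1: "norm (C z) \<le> norm z"
    by (cases "C z = 0") simp_all
  have "(norm (the (T (C z))))\<^sup>2 \<le> norm (C z) * norm z" using le zero_le_power2[of "norm (C z)"] by linarith
  also have "\<dots> \<le> (norm z)\<^sup>2" using 1 by (simp add: power2_eq_square mult_right_mono)
  finally show "norm (the (T (C z))) \<le> norm z" by (rule power2_le_imp_le) simp
qed

lemma gram_resolvent_scaleR: "C (r *\<^sub>R z) = r *\<^sub>R C z"
  using gram_resolvent_scaleC[of "complex_of_real r"] by (simp add: scaleC_of_real)

lemma gram_resolvent_pos: "pos_bounded C"
proof (rule pos_boundedI)
  show "bounded_linear C"
    by (rule bounded_linear_intro[where K = 1])
      (simp_all add: gram_resolvent_add gram_resolvent_scaleR gram_resolvent_norm)
  show "inner (C x) y = inner x (C y)" for x y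
    unfolding gram_resolvent_form[of x y] inner_commute[of x "C y"] gram_resolvent_form[of y x]
    by (simp add: inner_commute)
  show "0 \<le> inner (C x) x" for x
    unfolding gram_resolvent_form[of x x] by simp
qed

lemma bounded_linear_op_resolvent: "bounded_linear (\<lambda>z. the (T (C z)))"
  by (rule bounded_linear_intro[where K = 1])
    (simp_all add: gram_resolvent_add gram_resolvent_scaleR gram_resolvent_norm lin_rules gram_resolvent_dom)

text \<open>
  The range of the resolvent is a core: an element of the graph orthogonal to
  \<open>(C z, T C z)\<close> for all z has a first component orthogonal to every z.
\<close>

lemma gram_resolvent_core:
  assumes x: "x \<in> dom T"
  obtains z where "(\<lambda>n. C (z n)) \<longlonglongrightarrow> x" "(\<lambda>n. the (T (C (z n)))) \<longlonglongrightarrow> the (T x)"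
proof -
  define K where "K = range (\<lambda>z. (C z, the (T (C z))))"
  have "bounded_linear (\<lambda>z. (C z, the (T (C z))))"
    by (rule bounded_linear_Pair[OF pos_boundedD(1)[OF gram_resolvent_pos] bounded_linear_op_resolvent])
  then have sub: "subspace K"
    unfolding K_def by (intro linear_subspace_image[OF bounded_linear.linear] subspace_UNIV)
  have KG: "closure K \<subseteq> Map.graph T"
  proof (rule closure_minimal)
    show "K \<subseteq> Map.graph T" using gram_resolvent_dom by (auto simp: K_def in_graph_iff)
    show "closed (Map.graph T)" using cl by (simp add: closed_op_def)
  qed
  obtain g where g: "g \<in> closure K" "\<And>s. s \<in> closure K \<Longrightarrow> inner ((x, the (T x)) - g) s = 0"
    using orthogonal_projection_exists[OF subspace_closure[OF sub] closed_closure] by blast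
  obtain y where y: "y \<in> dom T" "g = (y, the (T y))" using g(1) KG unfolding in_graph_iff by (blast dest: iffD1[OF in_graph_iff])
  have d: "x - y \<in> dom T" by (simp add: subspace_diff lin_rules(1) x y(1))
  have "inner (x - y) z = 0" for z
  proof -
    have "(C z, the (T (C z))) \<in> closure K" using closure_subset by (force simp: K_def)
    from g(2)[OF this] have "inner (x - y) (C z) + inner (the (T (x - y))) (the (T (C z))) = 0"
      by (simp add: y(2) lin_rules(4)[OF x y(1)])
    then show ?thesis
      using gram_resolvent_inner[OF d, of z] by (simp add: inner_commute inner_diff_right)
  qed
  then have "x - y = 0" by (metis inner_eq_zero_iff)
  then have "(x, the (T x)) \<in> closure K" using g(1) y(2) by simp
  then obtain k where k: "\<And>n. k n \<in> K" "k \<longlonglongrightarrow> (x, the (T x))" unfolding closure_sequential by blast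
  then obtain z where z: "\<And>n. k n = (C (z n), the (T (C (z n))))" unfolding K_def image_iff by metis
  show thesis
  proof (rule that)
    show "(\<lambda>n. C (z n)) \<longlonglongrightarrow> x" using tendsto_fst[OF k(2)] by (simp add: z)
    show "(\<lambda>n. the (T (C (z n)))) \<longlonglongrightarrow> the (T x)" using tendsto_snd[OF k(2)] by (simp add: z)
  qed
qed

end

text \<open>
  Since \<open>\<parallel>T C z\<parallel>\<^sup>2 = \<langle>C z, z\<rangle> - \<parallel>C z\<parallel>\<^sup>2\<close>, the norms of \<open>S x\<close> and \<open>T x\<close> agree on the common core, the
  range of C; closedness carries this over to the domains.
\<close>

lemma gram_resolvent_determines_dom:
  assumes S: "closed_linear_op S" and T: "closed_linear_op T" and eq: "gram_resolvent S = gram_resolvent T"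
  shows "dom S = dom T" and "x \<in> dom S \<Longrightarrow> norm (the (S x)) = norm (the (T x))"
proof -
  have half: "x \<in> dom T \<and> norm (the (S x)) = norm (the (T x))"
    if S: "closed_linear_op S" and T: "closed_linear_op T" and eq: "gram_resolvent S = gram_resolvent T"
      and x: "x \<in> dom S" for S T :: "'a \<rightharpoonup> 'a" and x
  proof -
    interpret S: closed_linear_op S by (rule S)
    interpret T: closed_linear_op T by (rule T)
    have nm: "norm (the (S (S.C z))) = norm (the (T (S.C z)))" for z
      using S.gram_resolvent_form[of z z] T.gram_resolvent_form[of z z] eq by (simp add: norm_eq)
    obtain z where z: "(\<lambda>n. S.C (z n)) \<longlonglongrightarrow> x" "(\<lambda>n. the (S (S.C (z n)))) \<longlonglongrightarrow> the (S x)"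
      using S.gram_resolvent_core[OF x] by blast
    have diff: "S.C (u - v) = S.C u - S.C v" for u v
      by (rule linear_diff[OF pos_boundedD(2)[OF S.gram_resolvent_pos]])
    have Td: "S.C u \<in> dom T" for u using T.gram_resolvent_dom[of u] eq by simp
    have "1 * norm (the (T (S.C (z m))) - the (T (S.C (z n)))) \<le> norm (the (S (S.C (z m))) - the (S (S.C (z n))))" for m n
      using nm[of "z m - z n"]
      by (simp add: diff S.lin_rules(4) T.lin_rules(4) S.gram_resolvent_dom Td)
    moreover have "convergent (\<lambda>n. the (S (S.C (z n))))" using z(2) convergent_def by blast
    ultimately obtain y where y: "(\<lambda>n. the (T (S.C (z n)))) \<longlonglongrightarrow> y"
      using complete_space_Cauchy_bound[of "\<lambda>n. the (S (S.C (z n)))" 1 "\<lambda>n. the (T (S.C (z n)))"] by auto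
    have Tx: "T x = Some y" by (rule closed_opD[OF T.cl Td z(1) y])
    have "(\<lambda>n. norm (the (S (S.C (z n))))) \<longlonglongrightarrow> norm y" using tendsto_norm[OF y] by (simp add: nm)
    with tendsto_norm[OF z(2)] have "norm (the (S x)) = norm y" by (rule LIMSEQ_unique)
    then show ?thesis using Tx by auto
  qed
  show "dom S = dom T" using half[OF S T eq] half[OF T S eq[symmetric]] by blast
  show "x \<in> dom S \<Longrightarrow> norm (the (S x)) = norm (the (T x))" using half[OF S T eq] by blast
qed

locale closed_dense_op = closed_linear_op +
  assumes dense: "densely_defined T"
begin

text \<open>The partial function \<open>T\<^sup>*T\<close> is \<open>C\<^sup>-\<^sup>1 - 1\<close>.\<close>

lemma gram_eq_Some_iff: "(adj T \<circ>\<^sub>m T) x = Some y \<longleftrightarrow> C (x + y) = x"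
proof
  assume "(adj T \<circ>\<^sub>m T) x = Some y"
  then obtain v where v: "T x = Some v" "adj T v = Some y" by (auto simp: map_comp_eq_Some_iff)
  show "C (x + y) = x"
  proof (rule gram_resolvent_eqI)
    show "x \<in> dom T" using v(1) by blast
    show "inner (the (T x)) (the (T w)) = inner (x + y - x) w" if "w \<in> dom T" for w
      using v that by (simp add: adj_eq_Some_iff[OF lin dense] inner_commute)
  qed
next
  assume "C (x + y) = x"
  then have x: "x \<in> dom T" "\<And>w. w \<in> dom T \<Longrightarrow> inner (the (T x)) (the (T w)) = inner y w"
    using gram_resolvent_dom[of "x + y"] gram_resolvent_inner[of _ "x + y"] by auto
  then have "adj T (the (T x)) = Some y"
    by (simp add: adj_eq_Some_iff[OF lin dense] inner_commute)
  then show "(adj T \<circ>\<^sub>m T) x = Some y" using x(1) by (auto simp: map_comp_eq_Some_iff)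
qed

lemma gram_resolvent_in_gram: "(adj T \<circ>\<^sub>m T) (C z) = Some (z - C z)"
  by (simp add: gram_eq_Some_iff)

lemma gram_resolvent_injective: "C z = 0 \<Longrightarrow> z = 0"
  using gram_resolvent_inner[of _ z] lin_rules(5) dense
  by (intro dense_orthogonal_zero[of "dom T" z]) (auto simp: densely_defined_def inner_commute)

text \<open>This is von Neumann's theorem: \<open>1 + T\<^sup>*T\<close> is onto because C is defined everywhere.\<close>

lemma positive_selfadjoint_gram: "positive_selfadjoint_op (adj T \<circ>\<^sub>m T)"
proof (rule positive_selfadjointI)
  show "linear_op (adj T \<circ>\<^sub>m T)" by (intro linear_op_comp linear_op_adj lin dense)
  have in_range: "\<exists>z. x = C z \<and> the ((adj T \<circ>\<^sub>m T) x) = z - C z" if x: "x \<in> dom (adj T \<circ>\<^sub>m T)" for x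
  proof -
    obtain y where y: "(adj T \<circ>\<^sub>m T) x = Some y" using x by blast
    then have "C (x + y) = x" by (simp only: gram_eq_Some_iff)
    then show ?thesis using y by (intro exI[of _ "x + y"]) simp
  qed
  have form: "inner (z - C z) (C v) = inner (the (T (C z))) (the (T (C v)))" for z v
    by (simp add: gram_resolvent_inner gram_resolvent_dom)
  fix x assume "x \<in> dom (adj T \<circ>\<^sub>m T)"
  then obtain z where z: "x = C z" "the ((adj T \<circ>\<^sub>m T) x) = z - C z" using in_range by blast
  show "0 \<le> inner (the ((adj T \<circ>\<^sub>m T) x)) x" unfolding z(2) by (simp add: z(1) form)
  fix y assume "y \<in> dom (adj T \<circ>\<^sub>m T)"
  then obtain v where v: "y = C v" "the ((adj T \<circ>\<^sub>m T) y) = v - C v" using in_range by blast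
  show "inner (the ((adj T \<circ>\<^sub>m T) x)) y = inner x (the ((adj T \<circ>\<^sub>m T) y))"
    unfolding z(2) v(2) using form[of z v] form[of v z] by (simp add: z(1) v(1) inner_commute)
next
  show "\<exists>x\<in>dom (adj T \<circ>\<^sub>m T). x + the ((adj T \<circ>\<^sub>m T) x) = z" for z
    using gram_resolvent_in_gram[of z] by (intro bexI[of _ "C z"]) auto
qed

end

lemma gram_resolvent_eq_if_gram_eq:
  assumes "closed_dense_op S" "closed_dense_op T" "adj S \<circ>\<^sub>m S = adj T \<circ>\<^sub>m T"
  shows "gram_resolvent S = gram_resolvent T"
proof
  fix z
  interpret S: closed_dense_op S by fact
  interpret T: closed_dense_op T by fact
  have "(adj T \<circ>\<^sub>m T) (S.C z) = Some (z - S.C z)" using S.gram_resolvent_in_gram assms(3) by simp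
  then show "S.C z = T.C z" by (simp add: T.gram_eq_Some_iff)
qed

lemma closed_dense_op_positive_selfadjoint: "positive_selfadjoint_op S \<Longrightarrow> closed_dense_op S"
  using positive_selfadjointD by unfold_locales blast+

section \<open>Square roots of positive self-adjoint operators\<close>

lemma linear_op_total:
  assumes "linear f" "\<And>c. commutes (\<lambda>x. c *\<^sub>C x) f"
  shows "linear_op (\<lambda>x. Some (f x))"
  using assms by (auto intro!: linear_op_graphI simp: linear_add commutes_def)

lemma positive_selfadjoint_total:
  assumes p: "pos_bounded p" and c: "\<And>c. commutes (\<lambda>x. c *\<^sub>C x) p"
  shows "positive_selfadjoint_op (\<lambda>x. Some (p x))"
proof (rule positive_selfadjoint_maximalI)
  show "linear_op (\<lambda>x. Some (p x))" by (rule linear_op_total[OF pos_boundedD(2)[OF p] c])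
  fix y z assume a: "\<And>x. x \<in> dom (\<lambda>x. Some (p x)) \<Longrightarrow> inner (the (Some (p x))) y = inner x z"
  have "inner (p y - z) (p y - z) = inner (p (p y - z)) y - inner (p y - z) z"
    by (simp add: pos_boundedD(3)[OF p] inner_diff_right)
  also have "\<dots> = 0" using a[of "p y - z"] by (simp add: dom_def)
  finally show "Some (p y) = Some z" by simp
qed (use pos_boundedD(3,4)[OF p] in \<open>auto simp: dom_def\<close>)

text \<open>
  With \<open>C = (1 + R\<^sup>2)\<^sup>-\<^sup>1\<close> the operator \<open>R C\<close> is the bounded positive root of \<open>C (1 - C)\<close>, so \<open>R\<^sup>2\<close>
  determines R on the range of C, which is a core of R.
\<close>

context
  fixes R :: "'a::complex_hilbert_space \<rightharpoonup> 'a"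
  assumes R: "positive_selfadjoint_op R"
begin

interpretation R: closed_dense_op R by (rule closed_dense_op_positive_selfadjoint[OF R])

lemma root_resolvent_twice: "the (R (R.C z)) \<in> dom R" "the (R (the (R (R.C z)))) = z - R.C z"
proof -
  have "(R \<circ>\<^sub>m R) (R.C z) = Some (z - R.C z)"
    using R.gram_resolvent_in_gram[of z] positive_selfadjointD(4)[OF R] by simp
  then show "the (R (R.C z)) \<in> dom R" "the (R (the (R (R.C z)))) = z - R.C z"
    by (auto simp: map_comp_eq_Some_iff)
qed

lemma root_resolvent_pos: "pos_bounded (\<lambda>z. the (R (R.C z)))"
proof (rule pos_boundedI)
  note sym = positive_selfadjointD(5)[OF R] and d = R.gram_resolvent_dom
  let ?f = "\<lambda>z. the (R (R.C z))"
  show "bounded_linear ?f" by (rule R.bounded_linear_op_resolvent)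
  have split: "z = R.C z + the (R (?f z))" for z by (simp add: root_resolvent_twice)
  have form: "inner (?f y) z = inner (?f y) (R.C z) + inner (the (R (?f y))) (?f z)" for y z
  proof -
    have "inner (?f y) z = inner (?f y) (R.C z) + inner (?f y) (the (R (?f z)))"
      by (simp add: root_resolvent_twice inner_diff_right)
    then show ?thesis by (simp only: sym[OF root_resolvent_twice(1) root_resolvent_twice(1)])
  qed
  show "inner (?f y) z = inner y (?f z)" for y z
  proof -
    have "inner (?f z) y = inner (?f z) (R.C y) + inner (the (R (?f z))) (?f y)" by (rule form)
    also have "inner (?f z) (R.C y) = inner (?f y) (R.C z)" by (simp only: sym[OF d d, of y z]) (rule inner_commute)
    also have "inner (the (R (?f z))) (?f y) = inner (the (R (?f y))) (?f z)"
      by (rule trans[OF sym[OF root_resolvent_twice(1) root_resolvent_twice(1)] inner_commute])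
    finally show ?thesis by (simp only: form[of y z] inner_commute[of y])
  qed
  show "0 \<le> inner (?f z) z" for z
    unfolding form[of z z]
    using positive_selfadjointD(6)[OF R d] positive_selfadjointD(6)[OF R root_resolvent_twice(1)]
    by simp
qed

lemma root_resolvent_square: "the (R (R.C (the (R (R.C z))))) = R.C (z - R.C z)"
proof -
  let ?f = "\<lambda>z. the (R (R.C z))"
  note F = pos_boundedD(3)[OF root_resolvent_pos] and Cs = pos_boundedD(3)[OF R.gram_resolvent_pos]
  have "inner (?f (?f z)) w = inner (R.C (z - R.C z)) w" for w
  proof -
    have "inner (?f (?f z)) w = inner (?f z) (?f w)" by (rule F)
    also have "\<dots> = inner (z - R.C z) (R.C w)" by (rule R.gram_resolvent_inner[OF R.gram_resolvent_dom])
    finally show ?thesis by (simp only: Cs)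
  qed
  then have "inner (?f (?f z) - R.C (z - R.C z)) w = 0" for w by (simp add: inner_diff_left)
  then show ?thesis by (metis inner_eq_zero_iff right_minus_eq)
qed

end

lemma positive_root_unique:
  assumes R: "positive_selfadjoint_op R" and S: "positive_selfadjoint_op S" and eq: "R \<circ>\<^sub>m R = S \<circ>\<^sub>m S"
  shows "R = S"
proof -
  have Ceq: "gram_resolvent R = gram_resolvent S"
    by (rule gram_resolvent_eq_if_gram_eq[OF closed_dense_op_positive_selfadjoint[OF R]
          closed_dense_op_positive_selfadjoint[OF S]])
      (simp add: positive_selfadjointD(4)[OF R] positive_selfadjointD(4)[OF S] eq)
  have feq: "(\<lambda>z. the (R (gram_resolvent R z))) = (\<lambda>z. the (S (gram_resolvent S z)))"
    by (rule bounded_sqrt_unique[OF root_resolvent_pos[OF R] root_resolvent_pos[OF S]])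
      (simp only: root_resolvent_square[OF R] root_resolvent_square[OF S], simp only: Ceq)
  have half: "S x = R x" if R: "closed_dense_op R" and S: "closed_dense_op S" and Ceq: "gram_resolvent R = gram_resolvent S"
    and feq: "\<And>z. the (R (gram_resolvent R z)) = the (S (gram_resolvent S z))" and x: "x \<in> dom R" for R S :: "'a \<rightharpoonup> 'a" and x
  proof -
    interpret R: closed_dense_op R by fact
    interpret S: closed_dense_op S by fact
    obtain z where z: "(\<lambda>n. R.C (z n)) \<longlonglongrightarrow> x" "(\<lambda>n. the (R (R.C (z n)))) \<longlonglongrightarrow> the (R x)"
      using R.gram_resolvent_core[OF x] by blast
    have "S x = Some (the (R x))"
      by (rule closed_opD[OF S.cl S.gram_resolvent_dom]) (use z Ceq feq in simp_all)
    then show ?thesis using x by auto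
  qed
  note RS = closed_dense_op_positive_selfadjoint[OF R] closed_dense_op_positive_selfadjoint[OF S]
  have f1: "the (R (gram_resolvent R z)) = the (S (gram_resolvent S z))" for z using fun_cong[OF feq] .
  show ?thesis
  proof
    fix x
    show "R x = S x"
    proof (cases "x \<in> dom R")
      case True then show ?thesis using half[OF RS Ceq f1] by simp
    next
      case False
      note R_None = this
      show ?thesis
      proof (cases "x \<in> dom S")
        case True then show ?thesis using half[OF RS(2,1) Ceq[symmetric] f1[symmetric]] by simp
      next
        case False then show ?thesis using R_None by (simp add: domIff)
      qed
    qed
  qed
qed

text \<open>
  Let \<open>C = (1 + S)\<^sup>-\<^sup>1\<close> and let P and Q be the bounded roots of C and \<open>1 - C\<close>, which commute.
  The root of \<open>S = (1 - C) C\<^sup>-\<^sup>1\<close> is \<open>Q P\<^sup>-\<^sup>1\<close>, with domain the range of P.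
\<close>

lemma positive_root_exists:
  assumes S: "positive_selfadjoint_op S"
  obtains R where "positive_selfadjoint_op R" "R \<circ>\<^sub>m R = S"
proof -
  note SD = positive_selfadjointD[OF S] and Sl = linear_opD[OF positive_selfadjointD(1)[OF S]]
  have "\<exists>x. x \<in> dom S \<and> the (S x) + x = z" for z
    using positive_selfadjoint_shift_onto[OF S, of 1 z] by auto
  then obtain C where Cd: "\<And>z. C z \<in> dom S" and CS: "\<And>z. the (S (C z)) + C z = z" by metis
  have uniq: "C z = x" if x: "x \<in> dom S" "the (S x) + x = z" for x z
  proof -
    have d: "C z - x \<in> dom S" by (simp add: subspace_diff Sl(1) Cd x(1))
    have "the (S (C z - x)) + (C z - x) = 0"
      using CS[of z] x(2) by (simp add: Sl(4)[OF Cd x(1)] algebra_simps)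
    then have "inner (the (S (C z - x))) (C z - x) + inner (C z - x) (C z - x) = 0"
      by (metis inner_add_left inner_zero_left)
    then have "inner (C z - x) (C z - x) = 0"
      using SD(6)[OF d] inner_ge_zero[of "C z - x"] by linarith
    then show ?thesis by simp
  qed
  have S_iff: "S x = Some y \<longleftrightarrow> C (x + y) = x" for x y
  proof
    assume "S x = Some y" then show "C (x + y) = x" by (intro uniq) (auto simp: add.commute)
  next
    assume "C (x + y) = x"
    then have "x \<in> dom S" "the (S x) = y" using Cd[of "x + y"] CS[of "x + y"] by auto
    then show "S x = Some y" by auto
  qed
  have SC: "the (S (C z)) = z - C z" for z using CS[of z] by (simp add: algebra_simps)
  have form: "inner (C y) z = inner (the (S (C y))) (C z) + inner (C y) (C z)" for y z
    using SD(5)[OF Cd Cd, of y z] by (simp add: SC inner_diff_right)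
  have sym: "inner (C y) z = inner y (C z)" for y z
    unfolding form[of y z] inner_commute[of y] form[of z y]
    using SD(5)[OF Cd Cd, of y z] by (simp add: inner_commute)
  have Cc: "C (c *\<^sub>C z) = c *\<^sub>C C z" for c z
    by (rule uniq)
      (simp_all add: linear_op_scaleC[OF SD(1) Cd] CS flip: scaleC_add_right)
  have Cp: "pos_bounded C"
  proof (rule pos_boundedI[OF _ sym])
    show "0 \<le> inner (C z) z" for z
      unfolding form[of z z] using SD(6)[OF Cd] by simp
    have "norm (C z) \<le> norm z" for z
    proof -
      have "norm (C z) * norm (C z) \<le> norm (C z) * norm z"
        using form[of z z] SD(6)[OF Cd, of z] norm_cauchy_schwarz[of "C z" z]
        by (simp add: power2_norm_eq_inner[symmetric] power2_eq_square)
      then show ?thesis by (cases "C z = 0") simp_all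
    qed
    moreover have "C (y + z) = C y + C z" for y z
    proof (rule uniq)
      show "C y + C z \<in> dom S" by (simp add: subspace_add Sl(1) Cd)
      show "the (S (C y + C z)) + (C y + C z) = y + z" by (simp add: Sl(2)[OF Cd Cd] SC)
    qed
    ultimately show "bounded_linear C"
      by (intro bounded_linear_intro[where K = 1])
        (simp_all add: Cc flip: scaleC_of_real)
  qed
  note CD = pos_boundedD[OF Cp]
  have "bounded_linear (\<lambda>z. z - C z)" by (intro bounded_linear_sub bounded_linear_ident CD(1))
  then have Dp: "pos_bounded (\<lambda>z. z - C z)"
  proof (rule pos_boundedI)
    show "inner (y - C y) z = inner y (z - C z)" for y z by (simp add: inner_diff sym)
    have "inner (z - C z) z = inner (the (S (C z))) (C z) + inner (the (S (C z))) (the (S (C z)))" for z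
      by (simp add: SC inner_diff inner_commute)
    then show "0 \<le> inner (z - C z) z" for z using SD(6)[OF Cd] by simp
  qed
  obtain P where P: "pos_bounded P" "\<And>x. P (P x) = C x" 
    by (rule bounded_sqrt_exists[OF Cp]) (rule that)
  obtain Q where Q: "pos_bounded Q" "\<And>x. Q (Q x) = x - C x" 
    by (rule bounded_sqrt_exists[OF Dp]) (rule that)
  note PD = pos_boundedD[OF P(1)] and QD = pos_boundedD[OF Q(1)]
  have Pc: "P (c *\<^sub>C z) = c *\<^sub>C P z" for c z
    using bounded_sqrt_commutes[OF P bounded_linear_scaleC[of c]] by (simp add: commutes_def Cc)
  have Qc: "Q (c *\<^sub>C z) = c *\<^sub>C Q z" for c z
    using bounded_sqrt_commutes[OF Q bounded_linear_scaleC[of c]]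
    by (simp add: commutes_def Cc linear_diff[OF bounded_linear.linear[OF bounded_linear_scaleC]])
  have PC: "P (C x) = C (P x)" for x by (simp flip: P(2))
  have PQ: "P (Q x) = Q (P x)" for x
    using bounded_sqrt_commutes[OF Q PD(1)] by (simp add: commutes_def linear_diff[OF PD(2)] PC)
  have P0: "x = 0" if "P x = 0" for x
  proof -
    have "C x = 0" using that by (simp flip: P(2) add: linear_0[OF PD(2)])
    then show ?thesis using SC[of x] Sl(5) by simp
  qed
  have Pinj: "x = y" if "P x = P y" for x y
    using P0[of "x - y"] that by (simp add: linear_diff[OF PD(2)])
  define R where "R x = (if x \<in> range P then Some (Q (inv P x)) else None)" for x
  have invP: "inv P (P z) = z" for z using Pinj by (simp add: inj_def)
  have R_iff: "R x = Some y \<longleftrightarrow> (\<exists>z. x = P z \<and> y = Q z)" for x y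
    by (auto simp: R_def invP)
  have Rd: "dom R = range P" by (auto simp: R_def split: if_splits)
  have RP: "the (R (P z)) = Q z" for z by (simp add: R_def invP)
  have Rp: "positive_selfadjoint_op R"
  proof (rule positive_selfadjoint_maximalI)
    show "linear_op R"
    proof (rule linear_op_graphI)
      show "R (x + y) = Some (u + v)" if "R x = Some u" "R y = Some v" for x y u v
        using that unfolding R_iff by (metis linear_add[OF PD(2)] linear_add[OF QD(2)])
      show "R (c *\<^sub>C x) = Some (c *\<^sub>C u)" if "R x = Some u" for c x u
        using that unfolding R_iff by (metis Pc Qc)
      have "R 0 = Some 0" unfolding R_iff by (intro exI[of _ 0]) (simp add: linear_0 PD QD)
      then show "R 0 \<noteq> None" by simp
    qed
    show "closure (dom R) = UNIV"
    proof (rule subspace_denseI)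
      show "subspace (dom R)" unfolding Rd by (intro linear_subspace_image PD(2) subspace_UNIV)
      fix y assume "\<And>u. u \<in> dom R \<Longrightarrow> inner y u = 0"
      then have "inner y (P (P y)) = 0" by (simp add: Rd)
      then have "inner (P y) (P y) = 0" by (simp only: PD(3))
      then show "y = 0" using P0 by simp
    qed
    fix x assume "x \<in> dom R"
    then obtain u where u: "x = P u" by (auto simp: Rd)
    show "0 \<le> inner (the (R x)) x"
      using pos_boundedD(4)[OF pos_bounded_compose_commuting[OF P(1) Q(1)], of u]
      by (simp add: u RP commutes_def PQ PD(3) flip: PQ)
    fix y assume "y \<in> dom R"
    then obtain v where v: "y = P v" by (auto simp: Rd)
    show "inner (the (R x)) y = inner x (the (R y))"
      unfolding u v RP by (simp add: PD(3) QD(3) PQ)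
  next
    fix y z assume a: "\<And>x. x \<in> dom R \<Longrightarrow> inner (the (R x)) y = inner x z"
    have "inner w (Q y - P z) = 0" for w
    proof -
      have "inner (Q w) y = inner (P w) z" using a[of "P w"] by (simp add: Rd RP)
      then show ?thesis by (simp add: inner_diff_right PD(3) QD(3))
    qed
    then have QP: "Q y = P z" by (metis inner_eq_zero_iff right_minus_eq)
    \<comment> \<open>As \<open>P\<^sup>2 + Q\<^sup>2 = 1\<close>, a pair \<open>(y, z) = (P w, Q w)\<close> can only come from \<open>w = P y + Q z\<close>.\<close>
    define w where "w = P y + Q z"
    have "P w = P (P y) + Q (Q y)" by (simp add: w_def linear_add[OF PD(2)] PQ QP)
    moreover have "Q w = P (P z) + Q (Q z)" by (simp add: w_def linear_add[OF QD(2)] QP flip: PQ)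
    ultimately have "y = P w" "z = Q w" by (simp_all add: P(2) Q(2))
    then show "R y = Some z" unfolding R_iff by blast
  qed
  moreover have "R \<circ>\<^sub>m R = S"
  proof -
    have "(R \<circ>\<^sub>m R) x = Some y \<longleftrightarrow> S x = Some y" for x y
    proof
      assume "(R \<circ>\<^sub>m R) x = Some y"
      then obtain z w where zw: "x = P z" "Q z = P w" "y = Q w"
        by (auto simp: map_comp_eq_Some_iff R_iff)
      have "P (x + y) = P (P z) + Q (Q z)" by (simp add: zw linear_add[OF PD(2)] PQ)
      then have "P (x + y) = z" by (simp add: P(2) Q(2))
      then show "S x = Some y" by (simp add: S_iff zw(1) flip: P(2))
    next
      assume "S x = Some y"
      then have x: "x = P (P (x + y))" by (simp add: S_iff P(2))
      have "y = Q (Q (x + y))" using x by (simp add: Q(2) P(2))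
      then show "(R \<circ>\<^sub>m R) x = Some y"
        unfolding map_comp_eq_Some_iff R_iff using x PQ by metis
    qed
    then show ?thesis by (metis ext not_None_eq)
  qed
  ultimately show thesis by (rule that)
qed

lemma sqrt_op_eqI:
  assumes "positive_selfadjoint_op R" "R \<circ>\<^sub>m R = S"
  shows "sqrt_op S = R"
  unfolding sqrt_op_def by (rule the_equality) (use assms positive_root_unique in auto)

lemma sqrt_op:
  assumes "positive_selfadjoint_op S"
  shows "positive_selfadjoint_op (sqrt_op S)" "sqrt_op S \<circ>\<^sub>m sqrt_op S = S"
proof -
  obtain R where R: "positive_selfadjoint_op R" "R \<circ>\<^sub>m R = S" using positive_root_exists[OF assms] by blast
  then show "positive_selfadjoint_op (sqrt_op S)" "sqrt_op S \<circ>\<^sub>m sqrt_op S = S"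
    using sqrt_op_eqI[OF R] by simp_all
qed

text \<open>
  An operator and its absolute value have the same Gram operator, hence the same resolvent C, and so
  C gives the domain and the norms.
\<close>

lemma abs_op:
  assumes T: "closed_dense_op T"
  shows "positive_selfadjoint_op (abs_op T)" "gram_resolvent (abs_op T) = gram_resolvent T"
    "dom (abs_op T) = dom T" "x \<in> dom T \<Longrightarrow> norm (the (abs_op T x)) = norm (the (T x))"
proof -
  note g = sqrt_op[OF closed_dense_op.positive_selfadjoint_gram[OF T], folded abs_op_def]
  show p: "positive_selfadjoint_op (abs_op T)" by (rule g(1))
  note a = closed_dense_op_positive_selfadjoint[OF p]
  show c: "gram_resolvent (abs_op T) = gram_resolvent T"
    by (rule gram_resolvent_eq_if_gram_eq[OF a T]) (simp add: positive_selfadjointD(4)[OF p] g(2))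
  have l: "closed_linear_op (abs_op T)" "closed_linear_op T"
    using a T closed_dense_op.axioms(1) by blast+
  show d: "dom (abs_op T) = dom T" by (rule gram_resolvent_determines_dom(1)[OF l c])
  show "x \<in> dom T \<Longrightarrow> norm (the (abs_op T x)) = norm (the (T x))"
    using gram_resolvent_determines_dom(2)[OF l c] d by simp
qed

section \<open>Normal operators\<close>

locale normal_operator = closed_dense_op A for A :: "'a::complex_hilbert_space \<rightharpoonup> 'a" +
  assumes normal: "A \<circ>\<^sub>m adj A = adj A \<circ>\<^sub>m A"
begin

abbreviation a where "a x \<equiv> the (A x)"
abbreviation s where "s x \<equiv> the (adj A x)"

lemma adj_closed_linear: "closed_linear_op (adj A)"
  by (intro closed_linear_op.intro linear_op_adj closed_op_adj lin dense)

text \<open>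
  Normality says that the Gram operators of A and of its adjoint agree; hence
  \<open>\<parallel>A\<^sup>*x\<parallel> = \<parallel>A x\<parallel>\<close> on a common domain.
\<close>

lemma gram_resolvent_adj: "gram_resolvent (adj A) = C"
proof
  fix z
  interpret S: closed_linear_op "adj A" by (rule adj_closed_linear)
  have "(A \<circ>\<^sub>m adj A) (C z) = Some (z - C z)" using gram_resolvent_in_gram normal by simp
  then obtain v where v: "adj A (C z) = Some v" "A v = Some (z - C z)" by (auto simp: map_comp_eq_Some_iff)
  show "gram_resolvent (adj A) z = C z"
  proof (rule S.gram_resolvent_eqI)
    show "C z \<in> dom (adj A)" using v(1) by blast
    fix w assume w: "w \<in> dom (adj A)"
    have "v \<in> dom A" using v(2) by blast
    from adj_inner[OF lin dense this w] show "inner (s (C z)) (s w) = inner (z - C z) w"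
      using v by simp
  qed
qed

lemma dom_adj: "dom (adj A) = dom A"
  and norm_adj: "x \<in> dom A \<Longrightarrow> norm (s x) = norm (a x)"
  using gram_resolvent_determines_dom[OF adj_closed_linear closed_linear_op_axioms gram_resolvent_adj] by auto

lemma adj: "x \<in> dom A \<Longrightarrow> y \<in> dom A \<Longrightarrow> inner (a x) y = inner x (s y)"
  using adj_inner[OF lin dense] dom_adj by blast

lemmas s_rules = linear_opD[OF linear_op_adj[OF lin dense], unfolded dom_adj]
lemmas a_scaleC = linear_op_scaleC[OF lin]
lemmas s_scaleC = linear_op_scaleC[OF linear_op_adj[OF lin dense], unfolded dom_adj]
lemmas s_closed = closed_opD[OF closed_op_adj[OF lin dense], unfolded dom_adj]

lemma adj_dom_commute:
  assumes "x \<in> dom A" "a x \<in> dom A"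
  shows "s x \<in> dom A" "a (s x) = s (a x)"
proof -
  obtain u where u: "A x = Some u" using assms(1) by blast
  then have "u \<in> dom (adj A)" using assms(2) dom_adj by simp
  then obtain v where v: "adj A u = Some v" by blast
  have "(A \<circ>\<^sub>m adj A) x = Some v" unfolding normal using u v by (auto simp: map_comp_eq_Some_iff)
  then show "s x \<in> dom A" "a (s x) = s (a x)" using u v by (auto simp: map_comp_eq_Some_iff)
qed

lemma dom_adj_commute:
  assumes "x \<in> dom A" "s x \<in> dom A"
  shows "a x \<in> dom A" "s (a x) = a (s x)"
proof -
  obtain u where u: "adj A x = Some u" using assms(1) dom_adj by blast
  then obtain v where v: "A u = Some v" using assms(2) by auto
  have "(adj A \<circ>\<^sub>m A) x = Some v" unfolding normal[symmetric] using u v by (auto simp: map_comp_eq_Some_iff)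
  then obtain w where w: "A x = Some w" "adj A w = Some v" by (auto simp: map_comp_eq_Some_iff)
  then have "w \<in> dom A" using dom_adj by blast
  then show "a x \<in> dom A" "s (a x) = a (s x)" using u v w by auto
qed

lemma resolvent_a: "a (C z) \<in> dom A" "s (a (C z)) = z - C z"
proof -
  obtain v where v: "A (C z) = Some v" "adj A v = Some (z - C z)"
    using gram_resolvent_in_gram[of z] by (auto simp: map_comp_eq_Some_iff)
  then have "v \<in> dom A" using dom_adj by blast
  then show "a (C z) \<in> dom A" "s (a (C z)) = z - C z" using v by auto
qed

lemma resolvent_s: "s (C z) \<in> dom A" "a (s (C z)) = z - C z"
  using adj_dom_commute[OF gram_resolvent_dom resolvent_a(1)] resolvent_a(2) by simp_all

text \<open>The equation \<open>(1 + A\<^sup>*A) v = y\<close>, by which commutation with C is reduced to commutation with A and \<open>A\<^sup>*\<close>.\<close>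

lemma resolvent_eqI:
  assumes "v \<in> dom A" "a v \<in> dom A" "s (a v) = y - v"
  shows "C y = v"
proof -
  have "a v \<in> dom (adj A)" using assms(2) dom_adj by simp
  then have "(adj A \<circ>\<^sub>m A) v = Some (y - v)"
    using assms(1,3) by (auto simp: map_comp_eq_Some_iff)
  then show ?thesis by (simp add: gram_eq_Some_iff)
qed

lemma resolvent_commutes_a:
  assumes x: "x \<in> dom A"
  shows "C (a x) = a (C x)"
proof (rule resolvent_eqI)
  have d: "x - C x \<in> dom A" by (simp add: subspace_diff lin_rules(1) x gram_resolvent_dom)
  show 1: "a (C x) \<in> dom A" by (rule resolvent_a)
  note 2 = dom_adj_commute[OF 1, unfolded resolvent_a(2), OF d]
  show "a (a (C x)) \<in> dom A" by (rule 2(1))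
  show "s (a (a (C x))) = a x - a (C x)" by (simp add: 2(2) lin_rules(4) x gram_resolvent_dom)
qed

lemma resolvent_commutes_s:
  assumes x: "x \<in> dom A"
  shows "C (s x) = s (C x)"
proof (rule resolvent_eqI)
  show 1: "s (C x) \<in> dom A" by (rule resolvent_s)
  show "a (s (C x)) \<in> dom A" by (simp add: resolvent_s subspace_diff lin_rules(1) x gram_resolvent_dom)
  show "s (a (s (C x))) = s x - s (C x)" by (simp add: resolvent_s(2) s_rules(4) x gram_resolvent_dom)
qed

lemma bounded_linear_Y: "bounded_linear (\<lambda>z. a (C z))"
  by (rule bounded_linear_op_resolvent)

lemma bounded_linear_Y': "bounded_linear (\<lambda>z. s (C z))"
  using closed_linear_op.bounded_linear_op_resolvent[OF adj_closed_linear] by (simp add: gram_resolvent_adj)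

lemma commutes_Y: "commutes (\<lambda>z. a (C z)) C" and commutes_Y': "commutes (\<lambda>z. s (C z)) C"
  by (simp_all add: commutes_def resolvent_commutes_a resolvent_commutes_s gram_resolvent_dom)

text \<open>
  Writing \<open>y = C y + A\<^sup>*A C y\<close>, and likewise x, turns both sides into
  \<open>\<langle>C x, A\<^sup>*C y\<rangle> + \<langle>A A C x, A C y\<rangle>\<close>.
\<close>

lemma adj_Y: "inner (a (C x)) y = inner x (s (C y))"
proof -
  have "inner (a (C x)) y = inner (a (C x)) (C y) + inner (a (C x)) (s (a (C y)))"
    by (simp add: resolvent_a(2) inner_diff_right)
  also have "inner (a (C x)) (s (a (C y))) = inner (a (a (C x))) (a (C y))"
    by (simp add: adj resolvent_a(1))
  also have "\<dots> = inner (s (a (C x))) (s (C y))"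
  proof -
    have "inner (s (C y)) (s (a (C x))) = inner (a (s (C y))) (a (C x))"
      by (simp only: adj[OF resolvent_s(1) resolvent_a(1)])
    also have "\<dots> = inner (s (a (C y))) (a (C x))" by (simp only: resolvent_a(2) resolvent_s(2))
    also have "\<dots> = inner (a (C x)) (s (a (C y)))" by (rule inner_commute)
    also have "\<dots> = inner (a (a (C x))) (a (C y))" by (simp only: adj[OF resolvent_a(1) resolvent_a(1)])
    finally show ?thesis by (simp add: inner_commute)
  qed
  also have "inner (a (C x)) (C y) = inner (C x) (s (C y))" by (rule adj[OF gram_resolvent_dom gram_resolvent_dom])
  finally show ?thesis by (simp add: resolvent_a(2) inner_diff_left)
qed

end

section \<open>Spectral cutoffs\<close>

lemma heinz_bounded:
  fixes h p :: "'a::complex_hilbert_space \<Rightarrow> 'a"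
  assumes h: "\<And>u v. inner (h u) v = inner u (h v)"
    and p: "pos_bounded p" and pc: "\<And>c. commutes (\<lambda>x. c *\<^sub>C x) p"
    and le: "\<And>u. norm (h u) \<le> norm (p u)"
  shows "\<bar>inner (h x) x\<bar> \<le> inner (p x) x"
proof (rule heinz_form_bound[where D = UNIV])
  show "\<exists>u\<in>UNIV. p u + e *\<^sub>R u = y" if "e > 0" for e y
    using positive_selfadjoint_shift_onto[OF positive_selfadjoint_total[OF p pc] that, of y] by auto
qed (use assms pos_boundedD[OF p] in \<open>simp_all add: linear_map_on_UNIV\<close>)

text \<open>
  Put \<open>R = \<bar>C - e\<bar>\<close>.  The vectors with \<open>R x = (C - e) x\<close> form the spectral subspace of C for the
  half line from e upwards, and \<open>R + (C - e)\<close> maps into it.  The map \<open>R - (C - e)\<close> is twice the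
  negative part of \<open>C - e\<close>, which is at most e because C is positive; this bound is the form
  inequality applied to \<open>\<parallel>R x\<parallel> = \<parallel>(C - e) x\<parallel> \<le> \<parallel>(C + e) x\<parallel>\<close>.  On the spectral subspace C is
  bounded below by e and hence invertible, with inverse that of \<open>R + e\<close>.
\<close>

lemma spectral_cutoff:
  fixes C :: "'a::complex_hilbert_space \<Rightarrow> 'a"
  assumes C: "pos_bounded C" and Cc: "\<And>c. commutes (\<lambda>x. c *\<^sub>C x) C" and e: "e > 0"
  obtains R where "pos_bounded R"
    "\<And>X. bounded_linear X \<Longrightarrow> commutes X C \<Longrightarrow> commutes X R"
    "\<And>x. R (R x + (C x - e *\<^sub>R x)) = C (R x + (C x - e *\<^sub>R x)) - e *\<^sub>R (R x + (C x - e *\<^sub>R x))"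
    "\<And>x. norm (R x - (C x - e *\<^sub>R x)) \<le> 2 * e * norm x"
    "\<And>x. R x = C x - e *\<^sub>R x \<Longrightarrow> \<exists>u. R u = C u - e *\<^sub>R u \<and> C u = x \<and> e * norm u \<le> norm x"
proof -
  note CD = pos_boundedD[OF C]
  define d where "d x = C x - e *\<^sub>R x" for x
  have db: "bounded_linear d" unfolding d_def
    by (intro bounded_linear_sub CD(1) bounded_linear_scaleR_right)
  have dl: "linear d" using db by (rule bounded_linear.linear)
  have ds: "inner (d x) y = inner x (d y)" for x y by (simp add: d_def inner_diff CD(3))
  have d_comm: "commutes X d" if "bounded_linear X" "commutes X C" for X
    using that by (auto simp: commutes_def d_def linear_diff linear_cmul dest!: bounded_linear.linear)
  obtain R where R: "pos_bounded R" "\<And>x. R (R x) = d (d x)"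
    by (rule bounded_sqrt_exists[OF pos_bounded_gram[OF db db ds]]) (rule that)
  note RD = pos_boundedD[OF R(1)]
  have Rcomm: "commutes X R" if X: "bounded_linear X" "commutes X C" for X
    by (rule bounded_sqrt_commutes[OF R X(1)]) (use d_comm[OF X] in \<open>simp add: commutes_def\<close>)
  have Rc: "commutes (\<lambda>x. c *\<^sub>C x) R" for c by (rule Rcomm[OF bounded_linear_scaleC Cc])
  have CR: "C (R x) = R (C x)" for x using Rcomm[OF CD(1)] by (simp add: commutes_def)
  have dR: "d (R x) = R (d x)" for x
    by (simp add: d_def CR linear_diff[OF RD(2)] linear_cmul[OF RD(2)])
  have nRd: "norm (R x) = norm (d x)" for x
  proof -
    have "inner (R x) (R x) = inner (d x) (d x)" by (simp add: RD(3) R(2) ds)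
    then show ?thesis by (simp add: norm_eq)
  qed
  have lower: "\<bar>inner (d x) x\<bar> \<le> inner (R x) x" for x
    by (rule heinz_bounded[OF ds R(1) Rc]) (simp add: nRd)
  define q where "q x = C x + e *\<^sub>R x" for x
  have qb: "bounded_linear q" unfolding q_def
    by (intro bounded_linear_add CD(1) bounded_linear_scaleR_right)
  have qp: "pos_bounded q"
    by (rule pos_boundedI[OF qb]) (use CD(3,4) e in \<open>simp_all add: q_def inner_add\<close>)
  have qc: "commutes (\<lambda>x. c *\<^sub>C x) q" for c
    using Cc[of c] by (simp add: commutes_def q_def scaleC_add_right scaleR_scaleC_commute)
  have "norm (R x) \<le> norm (q x)" for x
  proof -
    have "inner (d x) (d x) \<le> inner (q x) (q x)"
      using mult_nonneg_nonneg[OF less_imp_le[OF e] CD(4)[of x]]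
      by (simp add: d_def q_def inner_add inner_diff inner_commute)
    then show ?thesis by (simp add: nRd norm_le)
  qed
  then have upper: "\<bar>inner (R x) x\<bar> \<le> inner (q x) x" for x
    by (rule heinz_bounded[OF RD(3) qp qc])
  define n where "n x = R x - d x" for x
  have nb: "bounded_linear n" unfolding n_def by (intro bounded_linear_sub RD(1) db)
  have np: "pos_bounded n"
  proof (rule pos_boundedI[OF nb])
    show "inner (n x) y = inner x (n y)" for x y by (simp add: n_def inner_diff ds RD(3))
    show "0 \<le> inner (n x) x" for x using lower[of x] by (simp add: n_def inner_diff)
  qed
  have n_le: "norm (n x) \<le> 2 * e * norm x" for x
  proof (rule pos_bounded_norm_le[OF np])
    show "inner (n x) x \<le> 2 * e * (norm x)\<^sup>2" for x
      using upper[of x] by (simp add: n_def q_def d_def inner_diff inner_add power2_norm_eq_inner)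
  qed (use e in simp)
  have range: "R (R x + d x) = d (R x + d x)" for x
    by (simp add: linear_add[OF RD(2)] linear_add[OF dl] R(2) dR)
  have inv: "\<exists>u. R u = d u \<and> C u = x \<and> e * norm u \<le> norm x" if x: "R x = d x" for x
  proof -
    obtain u where u: "R u + e *\<^sub>R u = x"
      using positive_selfadjoint_shift_onto[OF positive_selfadjoint_total[OF R(1) Rc] e, of x] by auto
    have low: "e * norm v \<le> norm (R v + e *\<^sub>R v)" for v
    proof (cases "v = 0")
      case False
      have "e * norm v * norm v \<le> inner (R v + e *\<^sub>R v) v"
        using RD(4)[of v] by (simp add: inner_add_left power2_norm_eq_inner[symmetric] power2_eq_square)
      also have "\<dots> \<le> norm (R v + e *\<^sub>R v) * norm v" by (rule norm_cauchy_schwarz)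
      finally show ?thesis using False by simp
    qed simp
    have "R (n u) + e *\<^sub>R n u = n x"
    proof -
      have "n x = n (R u) + e *\<^sub>R n u"
        unfolding u[symmetric] by (simp add: linear_add[OF pos_boundedD(2)[OF np]] linear_cmul[OF pos_boundedD(2)[OF np]])
      moreover have "n (R u) = R (n u)" by (simp add: n_def linear_diff[OF RD(2)] dR)
      ultimately show ?thesis by simp
    qed
    also have "n x = 0" using x by (simp add: n_def)
    finally have "n u = 0" using low[of "n u"] e by (simp add: mult_le_0_iff)
    then have Ru: "R u = d u" by (simp add: n_def)
    then have "C u = x" using u by (simp add: d_def)
    then show ?thesis using Ru low[of u] u by auto
  qed
  show thesis
    by (rule that[OF R(1) Rcomm]) (use range n_le inv in \<open>simp_all add: n_def d_def\<close>)
qed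

section \<open>Fuglede's theorem\<close>

text \<open>
  A polynomial with vector coefficients, of which only the constant and the linear one are named.
  All coefficients lie in W, so that a map which is linear on W only may be applied to each of them.
\<close>

definition vector_poly :: "'a::complex_hilbert_space set \<Rightarrow> (complex \<Rightarrow> 'a) \<Rightarrow> 'a \<Rightarrow> 'a \<Rightarrow> bool" where
  "vector_poly W \<phi> c0 c1 \<longleftrightarrow> (\<exists>m c. c 0 = c0 \<and> c 1 = c1 \<and> (\<forall>k. c k \<in> W) \<and> (\<forall>k>m. c k = 0)
     \<and> \<phi> = (\<lambda>z. \<Sum>k\<le>m. z ^ k *\<^sub>C c k))"

text \<open>Cauchy's estimate for the linear coefficient, by averaging over roots of unity.\<close>

lemma vector_poly_linear_coeff_bound:
  assumes poly: "vector_poly W \<phi> c0 c1" and \<rho>: "\<rho> \<ge> 0" and K: "\<And>z. cmod z = \<rho> \<Longrightarrow> norm (\<phi> z) \<le> K"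
  shows "\<rho> * norm c1 \<le> K"
proof -
  obtain m c where c: "c 1 = c1" "\<And>k. k > m \<Longrightarrow> c k = 0" "\<phi> = (\<lambda>z. \<Sum>k\<le>m. z ^ k *\<^sub>C c k)"
    using poly unfolding vector_poly_def by blast
  \<comment> \<open>The order N exceeds the degree, so that among the exponents \<open>k - 1\<close> with \<open>k \<le> m\<close> only \<open>0\<close> is
    divisible by N; the exponent \<open>N - 1\<close> below stands for \<open>- 1\<close>.\<close>
  define N where "N = m + 2"
  define w where "w = exp (2 * complex_of_real pi * \<i> / N)"
  have N: "N \<noteq> 0" by (simp add: N_def)
  have wpow: "w ^ j = exp (2 * complex_of_real pi * \<i> * j / N)" for j
    by (simp add: w_def exp_of_nat_mult[symmetric] mult_ac)
  have w1: "w ^ j = 1 \<longleftrightarrow> N dvd j" for j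
    using complex_root_unity_eq_1[of N j] N by (simp add: wpow)
  have wn: "cmod w = 1" by (simp add: w_def norm_exp_eq_Re)
  define S where "S = (\<Sum>j<N. (w ^ j) ^ (N - 1) *\<^sub>C \<phi> (\<rho> * w ^ j))"
  have geo: "(\<Sum>j<N. (w ^ (N - 1 + k)) ^ j) = (if k = 1 then of_nat N else 0)" if "k \<le> m" for k
  proof (cases "k = 1")
    case True
    then have "N - 1 + k = N" by (simp add: N_def)
    then have "w ^ (N - 1 + k) = 1" using w1[of N] by simp
    then have "(\<Sum>j<N. (w ^ (N - 1 + k)) ^ j) = of_nat N"
      by (simp only: power_one sum_constant card_lessThan mult_1_right)
    then show ?thesis using True by (simp only: if_True simp_thms)
  next
    case False
    have "\<not> N dvd N - 1 + k"
    proof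
      assume "N dvd N - 1 + k"
      then obtain q where q: "N - 1 + k = N * q" by blast
      have "N - 1 + k < N * 2" "0 < N - 1 + k" using that by (auto simp: N_def)
      then have "N * q < N * 2" "0 < N * q" unfolding q by simp_all
      then have "q = 1" by simp
      then show False using q False by (simp add: N_def)
    qed
    then have ne: "w ^ (N - 1 + k) \<noteq> 1" using w1 by simp
    have "(w ^ (N - 1 + k)) ^ N = 1" using w1[of N] by (metis dvd_refl power_mult mult.commute power_one)
    then show ?thesis using geometric_sum[OF ne, of N] False by simp
  qed
  have coeff: "(w ^ j) ^ (N - 1) * (complex_of_real \<rho> * w ^ j) ^ k = complex_of_real (\<rho> ^ k) * (w ^ (N - 1 + k)) ^ j" for j k
  proof -
    have "(w ^ (N - 1 + k)) ^ j = (w ^ j) ^ (N - 1 + k)" by (metis power_mult mult.commute)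
    then show ?thesis by (simp only: power_add power_mult_distrib of_real_power mult_ac)
  qed
  have "S = (\<Sum>j<N. \<Sum>k\<le>m. (\<rho> ^ k * (w ^ (N - 1 + k)) ^ j) *\<^sub>C c k)"
    unfolding S_def c(3) scaleC_sum_right scaleC_scaleC coeff ..
  also have "\<dots> = (\<Sum>k\<le>m. \<Sum>j<N. (\<rho> ^ k * (w ^ (N - 1 + k)) ^ j) *\<^sub>C c k)" by (rule sum.swap)
  also have "\<dots> = (\<Sum>k\<le>m. (\<rho> ^ k * (\<Sum>j<N. (w ^ (N - 1 + k)) ^ j)) *\<^sub>C c k)"
    by (simp add: sum_distrib_left scaleC_sum_left)
  also have "\<dots> = (\<Sum>k\<le>m. if k = 1 then complex_of_real (\<rho> * N) *\<^sub>C c1 else 0)"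
  proof (intro sum.cong refl)
    fix k assume "k \<in> {..m}"
    then have "k \<le> m" by simp
    show "(complex_of_real (\<rho> ^ k) * (\<Sum>j<N. (w ^ (N - 1 + k)) ^ j)) *\<^sub>C c k
        = (if k = 1 then complex_of_real (\<rho> * N) *\<^sub>C c1 else 0)"
      unfolding geo[OF \<open>k \<le> m\<close>] using c(1) by (auto simp: scaleC_zero_left)
  qed
  also have "\<dots> = complex_of_real (\<rho> * N) *\<^sub>C c1"
  proof (cases "m \<ge> 1")
    case True then show ?thesis by (simp add: sum.delta)
  next
    case False then have "c1 = 0" using c(1) c(2)[of 1] by simp
    then show ?thesis by (simp add: scaleC_zero_right)
  qed
  finally have "S = complex_of_real (\<rho> * N) *\<^sub>C c1" .
  then have "N * (\<rho> * norm c1) = norm S" using \<rho> by (simp add: norm_scaleC norm_mult)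
  also have "\<dots> \<le> (\<Sum>j<N. K)"
    unfolding S_def
  proof (rule sum_norm_le)
    fix j
    have "norm (\<phi> (\<rho> * w ^ j)) \<le> K" by (rule K) (use \<rho> in \<open>simp add: norm_mult norm_power wn\<close>)
    then show "norm ((w ^ j) ^ (N - 1) *\<^sub>C \<phi> (\<rho> * w ^ j)) \<le> K" by (simp add: norm_scaleC norm_power wn)
  qed
  finally have "N * (\<rho> * norm c1) \<le> N * K" by simp
  then show ?thesis using N by simp
qed

definition complex_linear_on :: "'a::complex_hilbert_space set \<Rightarrow> ('a \<Rightarrow> 'a) \<Rightarrow> bool" where
  "complex_linear_on W f \<longleftrightarrow> 0 \<in> W \<and> (\<forall>x\<in>W. \<forall>y\<in>W. x + y \<in> W \<and> f (x + y) = f x + f y)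
     \<and> (\<forall>c. \<forall>x\<in>W. c *\<^sub>C x \<in> W \<and> f (c *\<^sub>C x) = c *\<^sub>C f x)"

lemma complex_linear_onD:
  assumes "complex_linear_on W f"
  shows "0 \<in> W" "x \<in> W \<Longrightarrow> y \<in> W \<Longrightarrow> x + y \<in> W" "x \<in> W \<Longrightarrow> y \<in> W \<Longrightarrow> f (x + y) = f x + f y"
    "x \<in> W \<Longrightarrow> c *\<^sub>C x \<in> W" "x \<in> W \<Longrightarrow> f (c *\<^sub>C x) = c *\<^sub>C f x" "f 0 = 0"
proof -
  note * = assms[unfolded complex_linear_on_def]
  show 0: "0 \<in> W" using * by blast
  show "x \<in> W \<Longrightarrow> y \<in> W \<Longrightarrow> x + y \<in> W" "x \<in> W \<Longrightarrow> y \<in> W \<Longrightarrow> f (x + y) = f x + f y"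
    "x \<in> W \<Longrightarrow> c *\<^sub>C x \<in> W" "x \<in> W \<Longrightarrow> f (c *\<^sub>C x) = c *\<^sub>C f x" using * by blast+
  have "f (0 *\<^sub>C 0) = 0 *\<^sub>C f 0" using * 0 by blast
  then show "f 0 = 0" by (simp add: scaleC_zero_left)
qed

lemma complex_linear_on_sum:
  assumes f: "complex_linear_on W f" and g: "\<And>i. i \<in> I \<Longrightarrow> g i \<in> W"
  shows "(\<Sum>i\<in>I. g i) \<in> W \<and> f (\<Sum>i\<in>I. g i) = (\<Sum>i\<in>I. f (g i))"
  using g by (induction I rule: infinite_finite_induct) (simp_all add: complex_linear_onD[OF f])

lemma complex_linear_on_poly:
  assumes f: "complex_linear_on W f" and c: "\<And>k. c k \<in> W"
  shows "f (\<Sum>k\<le>(m::nat). z ^ k *\<^sub>C c k) = (\<Sum>k\<le>m. z ^ k *\<^sub>C f (c k))"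
proof -
  have "f (\<Sum>k\<le>m. z ^ k *\<^sub>C c k) = (\<Sum>k\<le>m. f (z ^ k *\<^sub>C c k))"
    using complex_linear_on_sum[OF f, of "{..m}" "\<lambda>k. z ^ k *\<^sub>C c k"] complex_linear_onD(4)[OF f c] by blast
  then show ?thesis by (simp add: complex_linear_onD(5)[OF f c])
qed

lemma vector_poly_map:
  assumes f: "complex_linear_on W f" and W: "f ` W \<subseteq> W" and poly: "vector_poly W \<phi> c0 c1"
  shows "vector_poly W (\<lambda>z. f (\<phi> z)) (f c0) (f c1)"
proof -
  obtain m c where c: "c 0 = c0" "c 1 = c1" "\<And>k. c k \<in> W" "\<And>k. k > m \<Longrightarrow> c k = 0" "\<phi> = (\<lambda>z. \<Sum>k\<le>m. z ^ k *\<^sub>C c k)"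
    using poly unfolding vector_poly_def by blast
  have "(\<lambda>z. f (\<phi> z)) = (\<lambda>z. \<Sum>k\<le>m. z ^ k *\<^sub>C f (c k))"
    by (simp only: c(5) complex_linear_on_poly[OF f c(3)])
  then show ?thesis
    unfolding vector_poly_def using c W complex_linear_onD(6)[OF f]
    by (intro exI[of _ m] exI[of _ "\<lambda>k. f (c k)"]) auto
qed

lemma vector_poly_shift:
  assumes f: "complex_linear_on W f" and W: "f ` W \<subseteq> W" and poly: "vector_poly W \<phi> c0 c1"
  shows "vector_poly W (\<lambda>z. \<phi> z + (\<sigma> * z) *\<^sub>C f (\<phi> z)) c0 (c1 + \<sigma> *\<^sub>C f c0)"
proof -
  obtain m c where c: "c 0 = c0" "c 1 = c1" "\<And>k. c k \<in> W" "\<And>k. k > m \<Longrightarrow> c k = 0" "\<phi> = (\<lambda>z. \<Sum>k\<le>m. z ^ k *\<^sub>C c k)"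
    using poly unfolding vector_poly_def by blast
  define b where "b k = (case k of 0 \<Rightarrow> 0 | Suc j \<Rightarrow> \<sigma> *\<^sub>C f (c j))" for k
  have bW: "b k \<in> W" for k
    using W c(3) complex_linear_onD(1,4)[OF f] by (auto simp: b_def split: nat.splits)
  have eq: "\<phi> z + (\<sigma> * z) *\<^sub>C f (\<phi> z) = (\<Sum>k\<le>Suc m. z ^ k *\<^sub>C (c k + b k))" for z
  proof -
    have "f (\<phi> z) = (\<Sum>k\<le>m. z ^ k *\<^sub>C f (c k))"
      by (simp only: c(5) complex_linear_on_poly[OF f c(3)])
    then have "(\<sigma> * z) *\<^sub>C f (\<phi> z) = (\<Sum>k\<le>m. z ^ Suc k *\<^sub>C b (Suc k))"
      by (simp add: scaleC_sum_right scaleC_scaleC b_def mult_ac)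
    also have "\<dots> = (\<Sum>k\<le>Suc m. z ^ k *\<^sub>C b k)"
      by (simp only: sum.atMost_Suc_shift) (simp add: b_def scaleC_zero_right)
    finally have "(\<sigma> * z) *\<^sub>C f (\<phi> z) = (\<Sum>k\<le>Suc m. z ^ k *\<^sub>C b k)" .
    moreover have "\<phi> z = (\<Sum>k\<le>Suc m. z ^ k *\<^sub>C c k)" by (simp add: c(4,5) scaleC_zero_right)
    ultimately show ?thesis by (simp only: sum.distrib[symmetric] scaleC_add_right)
  qed
  show ?thesis
    unfolding vector_poly_def
  proof (intro exI conjI allI impI)
    show "c k + b k \<in> W" for k using c(3) bW complex_linear_onD(2)[OF f] by blast
    show "(\<lambda>z. \<phi> z + (\<sigma> * z) *\<^sub>C f (\<phi> z)) = (\<lambda>z. \<Sum>k\<le>Suc m. z ^ k *\<^sub>C (c k + b k))" using eq by blast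
    show "c k + b k = 0" if "k > Suc m" for k
      using that c(4) complex_linear_onD(6)[OF f]
      by (auto simp: b_def scaleC_zero_right split: nat.splits)
    show "c 0 + b 0 = c0" "c 1 + b 1 = c1 + \<sigma> *\<^sub>C f c0" by (simp_all only: c(1,2)) (simp_all add: b_def c(1))
  qed
qed

lemma vector_poly_const:
  assumes "x \<in> W" "0 \<in> W"
  shows "vector_poly W (\<lambda>z. x) x 0"
  unfolding vector_poly_def
  by (intro exI[of _ 0] exI[of _ "\<lambda>k. if k = 0 then x else 0"]) (use assms in \<open>simp add: scaleC_one\<close>)

lemma vector_poly_funpow_shift:
  assumes f: "complex_linear_on W f" and W: "f ` W \<subseteq> W" and poly: "vector_poly W \<phi> c0 c1"
  shows "vector_poly W (\<lambda>z. ((\<lambda>w. w + (\<sigma> * z) *\<^sub>C f w) ^^ n) (\<phi> z)) c0 (c1 + (of_nat n * \<sigma>) *\<^sub>C f c0)"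
proof (induction n)
  case 0 then show ?case using poly by (simp add: scaleC_zero_left)
next
  case (Suc n)
  have "c1 + (of_nat n * \<sigma>) *\<^sub>C f c0 + \<sigma> *\<^sub>C f c0 = c1 + (of_nat (Suc n) * \<sigma>) *\<^sub>C f c0"
    by (simp add: add.assoc distrib_right add.commute[of \<sigma>] flip: scaleC_add_left)
  then show ?case using vector_poly_shift[OF f W Suc, of \<sigma>] by (simp add: add.assoc del: of_nat_Suc)
qed

lemma funpow_norm_bound:
  fixes f :: "'a::real_normed_vector \<Rightarrow> 'a"
  assumes "f ` M \<subseteq> M" "\<And>v. v \<in> M \<Longrightarrow> norm (f v) \<le> b * norm v" "0 \<le> b" "v \<in> M"
  shows "(f ^^ n) v \<in> M \<and> norm ((f ^^ n) v) \<le> b ^ n * norm v"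
proof (induction n)
  case (Suc n)
  then have "norm (f ((f ^^ n) v)) \<le> b * (b ^ n * norm v)"
    using assms(2)[of "(f ^^ n) v"] mult_left_mono[OF conjunct2[OF Suc] assms(3)] by linarith
  then show ?case using Suc assms(1) by (auto simp: mult.assoc)
qed (use assms(4) in simp)

lemma funpow_invariant: "f ` W \<subseteq> W \<Longrightarrow> w \<in> W \<Longrightarrow> (f ^^ n) w \<in> W"
  by (induction n) auto

lemma funpow_commute_on:
  assumes "f ` W \<subseteq> W" "g ` W \<subseteq> W" "\<And>w. w \<in> W \<Longrightarrow> f (g w) = g (f w)" "w \<in> W"
  shows "(f ^^ n) (g w) = g ((f ^^ n) w)"
  using assms(4)
proof (induction n)
  case (Suc n)
  then show ?case using assms(3)[OF funpow_invariant[OF assms(1)]] by simp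
qed simp

context normal_operator
begin

text \<open>
  The intersection of the domains of all powers of A, as the union of the invariant subsets of the
  domain: membership is shown by exhibiting an invariant set.
\<close>

definition Dinf where "Dinf = \<Union>{Z. Z \<subseteq> dom A \<and> a ` Z \<subseteq> Z}"

lemma Dinf_dom: "w \<in> Dinf \<Longrightarrow> w \<in> dom A" and Dinf_a: "w \<in> Dinf \<Longrightarrow> a w \<in> Dinf"
  by (auto simp: Dinf_def)

lemma Dinf_coinduct: "Z \<subseteq> dom A \<Longrightarrow> a ` Z \<subseteq> Z \<Longrightarrow> z \<in> Z \<Longrightarrow> z \<in> Dinf"
  by (auto simp: Dinf_def)

lemma Dinf_comm: "w \<in> Dinf \<Longrightarrow> a (s w) = s (a w)"
  using adj_dom_commute(2) Dinf_dom Dinf_a by blast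

lemma Dinf_s:
  assumes w: "w \<in> Dinf"
  shows "s w \<in> Dinf"
proof (rule Dinf_coinduct)
  show "s ` Dinf \<subseteq> dom A" using adj_dom_commute(1) Dinf_dom Dinf_a by blast
  show "a ` s ` Dinf \<subseteq> s ` Dinf" using Dinf_comm Dinf_a by auto
qed (use w in blast)

lemma Dinf_linear: "complex_linear_on Dinf a" "complex_linear_on Dinf s"
proof -
  have "0 \<in> Dinf"
    by (rule Dinf_coinduct[of "{0}"]) (use subspace_0[OF lin_rules(1)] lin_rules(5) in auto)
  moreover have "x + y \<in> Dinf" if "x \<in> Dinf" "y \<in> Dinf" for x y
  proof (rule Dinf_coinduct)
    let ?Z = "{u + v | u v. u \<in> Dinf \<and> v \<in> Dinf}"
    show "?Z \<subseteq> dom A" using subspace_add[OF lin_rules(1)] Dinf_dom by blast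
    show "a ` ?Z \<subseteq> ?Z"
    proof
      fix p assume "p \<in> a ` ?Z"
      then obtain u v where "p = a (u + v)" "u \<in> Dinf" "v \<in> Dinf" by blast
      then show "p \<in> ?Z" using lin_rules(2)[OF Dinf_dom Dinf_dom, of u v] Dinf_a by blast
    qed
    show "x + y \<in> ?Z" using that by blast
  qed
  moreover have "c *\<^sub>C x \<in> Dinf" if x: "x \<in> Dinf" for c x
  proof (rule Dinf_coinduct)
    let ?Z = "(\<lambda>u. c *\<^sub>C u) ` Dinf"
    show "?Z \<subseteq> dom A" using a_scaleC(1) Dinf_dom by blast
    show "a ` ?Z \<subseteq> ?Z" using a_scaleC(2)[OF Dinf_dom] Dinf_a by auto
    show "c *\<^sub>C x \<in> ?Z" using x by blast
  qed
  ultimately show "complex_linear_on Dinf a" "complex_linear_on Dinf s"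
    unfolding complex_linear_on_def
    using lin_rules(2) s_rules(2) a_scaleC(2) s_scaleC(2) Dinf_dom by simp_all
qed

text \<open>For a normal operator, \<open>1 + c A\<^sup>*\<close> is the adjoint of the normal operator \<open>1 + cnj c A\<close>.\<close>

lemma shift_norm_eq:
  assumes x: "x \<in> dom A"
  shows "norm (x + c *\<^sub>C s x) = norm (x + cnj c *\<^sub>C a x)"
proof -
  have "inner (cnj c *\<^sub>C a x) x = inner (a (cnj c *\<^sub>C x)) x" by (simp add: a_scaleC x)
  also have "\<dots> = inner (cnj c *\<^sub>C x) (s x)" by (rule adj[OF a_scaleC(1)[OF x] x])
  finally have 1: "inner x (c *\<^sub>C s x) = inner x (cnj c *\<^sub>C a x)"
    by (simp add: inner_scaleC_left inner_commute)
  have "norm (c *\<^sub>C s x) = norm (cnj c *\<^sub>C a x)" by (simp add: norm_scaleC norm_adj x)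
  then have 2: "inner (c *\<^sub>C s x) (c *\<^sub>C s x) = inner (cnj c *\<^sub>C a x) (cnj c *\<^sub>C a x)"
    by (simp add: norm_eq)
  have "inner (x + c *\<^sub>C s x) (x + c *\<^sub>C s x) = inner (x + cnj c *\<^sub>C a x) (x + cnj c *\<^sub>C a x)"
    using 1 2 inner_commute[of "c *\<^sub>C s x" x] inner_commute[of "cnj c *\<^sub>C a x" x]
    by (simp add: inner_add)
  then show ?thesis by (simp add: norm_eq)
qed

text \<open>
  The product \<open>(1 + cnj c A) (1 - c A\<^sup>*)\<close> is \<open>1 + K - \<bar>c\<bar>\<^sup>2 A A\<^sup>*\<close> with the skew operator
  \<open>K = cnj c A - c A\<^sup>*\<close>.  Therefore \<open>\<parallel>(1 + K) v\<parallel>\<^sup>2 = \<parallel>v\<parallel>\<^sup>2 + \<parallel>K v\<parallel>\<^sup>2\<close>, and the norm exceeds that of v only in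
  second order in c.
\<close>

lemma almost_isometry:
  assumes v: "v \<in> dom A" "s v \<in> dom A" and r: "0 \<le> r"
    and bv: "norm (a v) \<le> r * norm v" and bs: "norm (a (s v)) \<le> r * norm (s v)"
  shows "norm ((v + (- c) *\<^sub>C s v) + cnj c *\<^sub>C a (v + (- c) *\<^sub>C s v)) \<le> (1 + 3 * (cmod c * r)\<^sup>2) * norm v"
proof -
  define t where "t = (cmod c * r)\<^sup>2"
  define k where "k = cnj c *\<^sub>C a v - c *\<^sub>C s v"
  have sv: "norm (s v) \<le> r * norm v" using bv norm_adj[OF v(1)] by simp
  have "inner (cnj c *\<^sub>C a v) v = inner (a (cnj c *\<^sub>C v)) v" by (simp add: a_scaleC v)
  also have "\<dots> = inner (cnj c *\<^sub>C v) (s v)" by (rule adj[OF a_scaleC(1)[OF v(1)] v(1)])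
  also have "\<dots> = inner (c *\<^sub>C s v) v" by (simp add: inner_scaleC_left inner_commute)
  finally have skew: "inner v k = 0" "inner k v = 0" by (simp_all add: k_def inner_diff inner_commute)
  have "norm k \<le> cmod c * norm (a v) + cmod c * norm (s v)"
    using norm_triangle_ineq4[of "cnj c *\<^sub>C a v" "c *\<^sub>C s v"] by (simp add: k_def norm_scaleC)
  also have "\<dots> \<le> cmod c * (r * norm v) + cmod c * (r * norm v)"
    by (intro add_mono mult_left_mono bv sv) simp_all
  finally have "norm k \<le> 2 * (cmod c * r) * norm v" by (simp add: mult_ac)
  then have "(norm k)\<^sup>2 \<le> (2 * (cmod c * r) * norm v)\<^sup>2" by (rule power_mono) simp
  then have k2: "(norm k)\<^sup>2 \<le> 4 * t * (norm v)\<^sup>2" by (simp add: t_def power_mult_distrib)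
  have "(norm (v + k))\<^sup>2 = (norm v)\<^sup>2 + (norm k)\<^sup>2"
    using skew by (simp add: power2_norm_eq_inner inner_add)
  also have "\<dots> \<le> (1 + 4 * t) * (norm v)\<^sup>2" using k2 by (simp add: algebra_simps)
  also have "\<dots> \<le> (1 + 2 * t)\<^sup>2 * (norm v)\<^sup>2" by (intro mult_right_mono) (simp_all add: power2_eq_square algebra_simps)
  finally have "(norm (v + k))\<^sup>2 \<le> ((1 + 2 * t) * norm v)\<^sup>2" by (simp add: power_mult_distrib)
  then have vk: "norm (v + k) \<le> (1 + 2 * t) * norm v"
    by (rule power2_le_imp_le) (simp add: t_def)
  have "norm ((cnj c * c) *\<^sub>C a (s v)) = (cmod c)\<^sup>2 * norm (a (s v))"
    by (simp add: norm_scaleC norm_mult power2_eq_square)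
  also have "\<dots> \<le> (cmod c)\<^sup>2 * (r * (r * norm v))"
    by (intro mult_left_mono order_trans[OF bs] r sv) simp
  finally have aas: "norm ((cnj c * c) *\<^sub>C a (s v)) \<le> t * norm v"
    by (simp add: t_def power_mult_distrib power2_eq_square mult_ac)
  have "a (v + (- c) *\<^sub>C s v) = a v - c *\<^sub>C a (s v)"
    using lin_rules(2)[OF v(1) a_scaleC(1)[OF v(2), of "- c"]] a_scaleC(2)[OF v(2), of "- c"]
    by (simp add: scaleC_minus_left)
  then have "cnj c *\<^sub>C a (v + (- c) *\<^sub>C s v) = cnj c *\<^sub>C a v - (cnj c * c) *\<^sub>C a (s v)"
    by (simp add: linear_diff[OF bounded_linear.linear[OF bounded_linear_scaleC]] scaleC_scaleC)
  then have eq: "(v + (- c) *\<^sub>C s v) + cnj c *\<^sub>C a (v + (- c) *\<^sub>C s v) = (v + k) - (cnj c * c) *\<^sub>C a (s v)"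
    by (simp add: k_def scaleC_minus_left)
  have "(1 + 3 * t) * norm v = (1 + 2 * t) * norm v + t * norm v" by (simp add: algebra_simps)
  then show ?thesis
    unfolding eq t_def[symmetric]
    using norm_triangle_ineq4[of "v + k" "(cnj c * c) *\<^sub>C a (s v)"] vk aas by linarith
qed

text \<open>
  A polynomial version of Rosenblum's argument.  Consider
  \<open>\<phi>(z) = (1 + z A\<^sup>*)\<^sup>n B (1 - z A\<^sup>*)\<^sup>n x\<close>, a polynomial in z with linear coefficient
  \<open>n (A\<^sup>*B - B A\<^sup>*) x\<close>.  By normality \<open>(1 + z A\<^sup>*)\<^sup>n\<close> may be replaced by \<open>(1 + cnj z A)\<^sup>n\<close> under the norm,
  and the latter commutes with B, so \<open>\<parallel>\<phi>(z)\<parallel> \<le> \<parallel>B\<parallel> \<parallel>((1 + cnj z A) (1 - z A\<^sup>*))\<^sup>n x\<parallel>\<close>, which is at most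
  \<open>\<parallel>B\<parallel> (1 + 3 \<bar>z\<bar>\<^sup>2 r\<^sup>2)\<^sup>n \<parallel>x\<parallel>\<close>.  On the circle \<open>\<bar>z\<bar> = 1 / (r sqrt n)\<close> this is bounded independently of n,
  and Cauchy's estimate gives \<open>\<parallel>(A\<^sup>*B - B A\<^sup>*) x\<parallel> = O(1 / sqrt n)\<close>.
\<close>

lemma fuglede_on_bounded_part:
  assumes B: "bounded_linear B" "\<And>c. commutes (\<lambda>x. c *\<^sub>C x) B"
    and BA: "\<And>x. x \<in> dom A \<Longrightarrow> B x \<in> dom A \<and> a (B x) = B (a x)"
    and M: "M \<subseteq> dom A" "a ` M \<subseteq> M" "s ` M \<subseteq> M" "complex_linear_on M (\<lambda>x. x)"
    and r: "0 < r" "\<And>x. x \<in> M \<Longrightarrow> norm (a x) \<le> r * norm x"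
    and x: "x \<in> M"
  shows "s (B x) = B (s x)"
proof -
  obtain L where L: "L > 0" "\<And>x. norm (B x) \<le> norm x * L"
    using bounded_linear.pos_bounded[OF B(1)] by blast
  define \<Delta> where "\<Delta> = s (B x) - B (s x)"
  let ?S = "\<lambda>c w. w + c *\<^sub>C s w" and ?A = "\<lambda>c w. w + c *\<^sub>C a w"
  note Wa = complex_linear_onD[OF Dinf_linear(1)] and Ws = complex_linear_onD[OF Dinf_linear(2)]
  have MW: "w \<in> Dinf" if "w \<in> M" for w using Dinf_coinduct[OF M(1,2) that] .
  have BW: "B w \<in> Dinf" if w: "w \<in> Dinf" for w
  proof (rule Dinf_coinduct)
    show "B ` Dinf \<subseteq> dom A" using BA Dinf_dom by blast
    show "a ` B ` Dinf \<subseteq> B ` Dinf" using BA Dinf_dom Dinf_a by auto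
  qed (use w in blast)
  have SW: "?S c ` Dinf \<subseteq> Dinf" for c using Wa(2,4) Dinf_s by blast
  have AW: "?A c ` Dinf \<subseteq> Dinf" for c using Wa(2,4) Dinf_a by blast
  have SM: "?S c ` M \<subseteq> M" for c using complex_linear_onD(2,4)[OF M(4)] M(3) by blast
  have AM: "?A c ` M \<subseteq> M" for c using complex_linear_onD(2,4)[OF M(4)] M(2) by blast
  have SA: "?A c (?S d w) = ?S d (?A c w)" if "w \<in> Dinf" for c d w
  proof -
    have "a (w + d *\<^sub>C s w) = a w + d *\<^sub>C s (a w)"
      using Wa(3)[OF that Wa(4)[OF Dinf_s[OF that]]] Wa(5)[OF Dinf_s[OF that]] Dinf_comm[OF that] by simp
    moreover have "s (w + c *\<^sub>C a w) = s w + c *\<^sub>C s (a w)"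
      using Ws(3)[OF that Wa(4)[OF Dinf_a[OF that]]] Ws(5)[OF Dinf_a[OF that]] by simp
    ultimately show ?thesis
      by (simp only: scaleC_add_right scaleC_scaleC mult.commute[of d c]) (simp only: add_ac)
  qed
  have normS: "norm (((?S c) ^^ n) w) = norm (((?A (cnj c)) ^^ n) w)" if "w \<in> Dinf" for c n w
    using that
  proof (induction n arbitrary: w)
    case (Suc n)
    have "norm (((?S c) ^^ Suc n) w) = norm (((?S c) ^^ n) (?S c w))" by (simp only: funpow_Suc_right o_apply)
    also have "\<dots> = norm (((?A (cnj c)) ^^ n) (?S c w))" using Suc SW by blast
    also have "((?A (cnj c)) ^^ n) (?S c w) = ?S c (((?A (cnj c)) ^^ n) w)"
      by (rule funpow_commute_on[where f = "?A (cnj c)" and g = "?S c" and W = Dinf];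
          (rule AW SW Suc.prems | erule SA))
    also have "norm \<dots> = norm (?A (cnj c) (((?A (cnj c)) ^^ n) w))"
      by (rule shift_norm_eq[OF Dinf_dom[OF funpow_invariant[OF AW Suc.prems]]])
    finally show ?case by simp
  qed simp
  have AB: "((?A c) ^^ n) (B w) = B (((?A c) ^^ n) w)" if "w \<in> Dinf" for c n w
  proof (rule funpow_commute_on[where f = "?A c" and g = B and W = Dinf])
    show "?A c ` Dinf \<subseteq> Dinf" by (rule AW)
    show "w \<in> Dinf" by (rule that)
    show "B ` Dinf \<subseteq> Dinf" using BW by blast
    show "?A c (B w) = B (?A c w)" if "w \<in> Dinf" for w
      using BA[OF Dinf_dom[OF that]] B(2) linear_add[OF bounded_linear.linear[OF B(1)]]
      by (simp add: commutes_def)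
  qed
  have estimate: "norm (((?S c) ^^ n) (B (((?S (- c)) ^^ n) x)))
      \<le> L * ((1 + 3 * (cmod c * r)\<^sup>2) ^ n * norm x)" for c n
  proof -
    let ?f = "\<lambda>w. ?A (cnj c) (?S (- c) w)"
    have fM: "?f ` M \<subseteq> M" using SM AM by blast
    have "((?A (cnj c)) ^^ n) (((?S (- c)) ^^ n) w) = (?f ^^ n) w" if "w \<in> M" for w
      using that
    proof (induction n arbitrary: w)
      case (Suc n)
      have "((?A (cnj c)) ^^ Suc n) (((?S (- c)) ^^ Suc n) w)
          = ?A (cnj c) (((?A (cnj c)) ^^ n) (?S (- c) (((?S (- c)) ^^ n) w)))" by simp
      also have "((?A (cnj c)) ^^ n) (?S (- c) (((?S (- c)) ^^ n) w))
          = ?S (- c) (((?A (cnj c)) ^^ n) (((?S (- c)) ^^ n) w))"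
        by (rule funpow_commute_on[where f = "?A (cnj c)" and g = "?S (- c)" and W = Dinf];
            (rule AW SW MW[OF funpow_invariant[OF SM Suc.prems]] | erule SA))
      finally show ?case using Suc by simp
    qed simp
    moreover have "norm ((?f ^^ n) x) \<le> (1 + 3 * (cmod c * r)\<^sup>2) ^ n * norm x"
    proof (rule conjunct2[OF funpow_norm_bound[OF fM _ _ x]])
      fix v assume v: "v \<in> M"
      then have "s v \<in> M" using M(3) by blast
      then show "norm (?f v) \<le> (1 + 3 * (cmod c * r)\<^sup>2) * norm v"
        using v M(1) r by (intro almost_isometry) auto
    qed simp
    moreover have "norm (((?S c) ^^ n) (B (((?S (- c)) ^^ n) x))) = norm (B (((?A (cnj c)) ^^ n) (((?S (- c)) ^^ n) x)))"
      using MW[OF funpow_invariant[OF SM x]] by (simp add: normS BW AB)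
    ultimately have "norm (((?S c) ^^ n) (B (((?S (- c)) ^^ n) x))) = norm (B ((?f ^^ n) x))"
      and le: "norm ((?f ^^ n) x) \<le> (1 + 3 * (cmod c * r)\<^sup>2) ^ n * norm x" using x by simp_all
    note this(1)
    also have "norm (B ((?f ^^ n) x)) \<le> L * norm ((?f ^^ n) x)" using L(2) by (simp add: mult.commute)
    also have "\<dots> \<le> L * ((1 + 3 * (cmod c * r)\<^sup>2) ^ n * norm x)"
      using L(1) by (intro mult_left_mono le) simp
    finally show ?thesis .
  qed
  have Bl: "complex_linear_on Dinf B"
    using Wa B(2) linear_add[OF bounded_linear.linear[OF B(1)]] by (simp add: complex_linear_on_def commutes_def)
  have sW: "s ` Dinf \<subseteq> Dinf" using Dinf_s by blast
  have poly: "vector_poly Dinf (\<lambda>z. ((?S z) ^^ n) (B (((?S (- z)) ^^ n) x))) (B x) (of_nat n *\<^sub>C \<Delta>)" for n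
  proof -
    have "vector_poly Dinf (\<lambda>z. ((\<lambda>w. w + ((- 1) * z) *\<^sub>C s w) ^^ n) x) x (0 + (of_nat n * (- 1)) *\<^sub>C s x)"
      by (rule vector_poly_funpow_shift[OF Dinf_linear(2) sW vector_poly_const[OF MW[OF x] Wa(1)]])
    then have "vector_poly Dinf (\<lambda>z. ((?S (- z)) ^^ n) x) x (- (of_nat n *\<^sub>C s x))"
      by (simp add: scaleC_minus_left)
    from vector_poly_map[OF Bl _ this]
    have "vector_poly Dinf (\<lambda>z. B (((?S (- z)) ^^ n) x)) (B x) (- (of_nat n *\<^sub>C B (s x)))"
      using BW B(2) linear_neg[OF bounded_linear.linear[OF B(1)]] by (auto simp: commutes_def)
    from vector_poly_funpow_shift[OF Dinf_linear(2) sW this, where \<sigma> = 1 and n = n]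
    show ?thesis
      by (simp add: \<Delta>_def linear_diff[OF bounded_linear.linear[OF bounded_linear_scaleC]])
  qed
  have bound: "sqrt n * norm \<Delta> \<le> r * (L * (exp 3 * norm x))" if n: "n > 0" for n :: nat
  proof -
    \<comment> \<open>This radius makes \<open>(1 + 3 \<rho>\<^sup>2 r\<^sup>2)\<^sup>n\<close> bounded while \<open>n \<rho>\<close> still tends to infinity.\<close>
    define \<rho> where "\<rho> = 1 / (r * sqrt n)"
    have \<rho>: "\<rho> > 0" using r(1) n by (simp add: \<rho>_def)
    have "(\<rho> * r)\<^sup>2 = 1 / n" using r(1) n by (simp add: \<rho>_def power_divide power_mult_distrib)
    moreover have "(1 + 3 * (1 / real n)) ^ n \<le> exp 3"
    proof -
      have "(1 + 3 / n) ^ n \<le> exp (3 / n) ^ n" by (intro power_mono exp_ge_add_one_self) simp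
      also have "\<dots> = exp 3" using n by (simp flip: exp_of_nat_mult)
      finally show ?thesis by simp
    qed
    ultimately have e3: "(1 + 3 * (\<rho> * r)\<^sup>2) ^ n \<le> exp 3" by simp
    have "\<rho> * norm (of_nat n *\<^sub>C \<Delta>) \<le> L * (exp 3 * norm x)"
    proof (rule vector_poly_linear_coeff_bound[OF poly])
      fix z :: complex assume z: "cmod z = \<rho>"
      have "L * ((1 + 3 * (\<rho> * r)\<^sup>2) ^ n * norm x) \<le> L * (exp 3 * norm x)"
        using L(1) e3 by (intro mult_left_mono mult_right_mono) auto
      then show "norm (((?S z) ^^ n) (B (((?S (- z)) ^^ n) x))) \<le> L * (exp 3 * norm x)"
        using estimate[where c = z and n = n] z by simp
    qed (use \<rho> in simp)
    then have "r * (\<rho> * (n * norm \<Delta>)) \<le> r * (L * (exp 3 * norm x))"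
      using r(1) by (simp add: norm_scaleC)
    moreover have "r * (\<rho> * (n * norm \<Delta>)) = sqrt n * norm \<Delta>"
      using r(1) n by (simp add: \<rho>_def field_simps flip: real_sqrt_mult)
    ultimately show ?thesis by simp
  qed
  have "\<Delta> = 0"
  proof (rule ccontr)
    assume "\<Delta> \<noteq> 0"
    define b where "b = r * (L * (exp 3 * norm x)) / norm \<Delta>"
    obtain n :: nat where n: "b\<^sup>2 < n" using reals_Archimedean2 by blast
    then have n0: "n > 0" using zero_le_power2[of b] by (cases n) auto
    have "sqrt n \<le> b" using bound[OF n0] \<open>\<Delta> \<noteq> 0\<close> by (simp add: b_def field_simps)
    then have "(sqrt n)\<^sup>2 \<le> b\<^sup>2" by (rule power_mono) simp
    then show False using n by simp
  qed
  then show ?thesis by (simp add: \<Delta>_def)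
qed

end

context normal_operator
begin

text \<open>From \<open>\<parallel>A C u\<parallel>\<^sup>2 = \<langle>(1 - C) u, C u\<rangle>\<close>.\<close>

lemma bounded_part_bound:
  assumes e: "e > 0" and u: "e * norm u \<le> norm (C u)"
  shows "norm (a (C u)) \<le> (1 / sqrt e) * norm (C u)"
proof (rule power2_le_imp_le)
  have "(norm (a (C u)))\<^sup>2 = inner (u - C u) (C u)"
    using gram_resolvent_inner[OF gram_resolvent_dom, of u u] by (simp add: power2_norm_eq_inner)
  also have "\<dots> \<le> inner u (C u)" by (simp add: inner_diff_left)
  also have "\<dots> \<le> norm u * norm (C u)" by (rule norm_cauchy_schwarz)
  also have "\<dots> \<le> (norm (C u) / e) * norm (C u)"
    using u e by (intro mult_right_mono) (simp_all add: pos_le_divide_eq mult.commute)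
  also have "\<dots> = ((1 / sqrt e) * norm (C u))\<^sup>2"
    using e by (simp add: power_mult_distrib power_divide power2_eq_square)
  finally show "(norm (a (C u)))\<^sup>2 \<le> ((1 / sqrt e) * norm (C u))\<^sup>2" .
qed (use e in simp)

text \<open>
  The spectral subspace M of C for the half line from e upwards is invariant under A and \<open>A\<^sup>*\<close>, and A
  is bounded by \<open>1 / sqrt e\<close> on it.  The vector g is the value at y of the positive part of
  \<open>C - e\<close>, which differs from C by at most \<open>2 e\<close>.
\<close>

lemma fuglede_approximants:
  assumes B: "bounded_linear B" "\<And>c. commutes (\<lambda>x. c *\<^sub>C x) B"
    and BA: "\<And>x. x \<in> dom A \<Longrightarrow> B x \<in> dom A \<and> a (B x) = B (a x)"
    and e: "e > 0"
  shows "\<exists>g. norm (g - C y) \<le> 2 * e * norm y \<and> s (B (C g)) = B (s (C g))"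
proof -
  note Cb = pos_boundedD[OF gram_resolvent_pos]
  have Cc: "commutes (\<lambda>x. c *\<^sub>C x) C" for c by (simp add: commutes_def gram_resolvent_scaleC)
  obtain R where R: "pos_bounded R"
    "\<And>X. bounded_linear X \<Longrightarrow> commutes X C \<Longrightarrow> commutes X R"
    "\<And>x. R (R x + (C x - e *\<^sub>R x)) = C (R x + (C x - e *\<^sub>R x)) - e *\<^sub>R (R x + (C x - e *\<^sub>R x))"
    "\<And>x. norm (R x - (C x - e *\<^sub>R x)) \<le> 2 * e * norm x"
    "\<And>x. R x = C x - e *\<^sub>R x \<Longrightarrow> \<exists>u. R u = C u - e *\<^sub>R u \<and> C u = x \<and> e * norm u \<le> norm x"
    by (rule spectral_cutoff[OF gram_resolvent_pos Cc e]) (rule that)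
  define M where "M = {x. R x = C x - e *\<^sub>R x}"
  have M_inv: "X u \<in> M" if X: "bounded_linear X" "commutes X C" and u: "u \<in> M" for X u
  proof -
    interpret X: bounded_linear X by (rule X(1))
    have "R (X u) = X (R u)" using R(2)[OF X] by (simp add: commutes_def)
    also have "\<dots> = C (X u) - e *\<^sub>R X u"
      using u X(2) by (simp add: M_def X.diff X.scaleR commutes_def)
    finally show ?thesis by (simp add: M_def)
  qed
  have rep: "\<exists>u\<in>M. C u = x \<and> e * norm u \<le> norm x" if "x \<in> M" for x
    using R(5)[of x] that by (auto simp: M_def)
  have fug: "s (B x) = B (s x)" if x: "x \<in> M" for x
  proof (rule fuglede_on_bounded_part[OF B BA])
    show "M \<subseteq> dom A" using rep gram_resolvent_dom by blast
    show "a ` M \<subseteq> M" using rep M_inv[OF bounded_linear_Y commutes_Y] by blast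
    show "s ` M \<subseteq> M" using rep M_inv[OF bounded_linear_Y' commutes_Y'] by blast
    show "0 < 1 / sqrt e" using e by simp
    show "norm (a x) \<le> 1 / sqrt e * norm x" if "x \<in> M" for x
      using rep[OF that] bounded_part_bound[OF e] by blast
    have "x + y \<in> M" if "x \<in> M" "y \<in> M" for x y
      using that linear_add[OF pos_boundedD(2)[OF R(1)]] by (simp add: M_def gram_resolvent_add scaleR_add_right)
    moreover have "0 \<in> M" using linear_0[OF pos_boundedD(2)[OF R(1)]] linear_0[OF Cb(2)] by (simp add: M_def)
    ultimately show "complex_linear_on M (\<lambda>x. x)"
      using M_inv[OF bounded_linear_scaleC Cc] by (simp add: complex_linear_on_def)
  qed (use x in auto)
  define G where "G = R y + (C y - e *\<^sub>R y)"
  have "G \<in> M" using R(3)[of y] by (simp add: M_def G_def)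
  define g where "g = (1/2) *\<^sub>R G"
  have "g \<in> M"
    using M_inv[OF bounded_linear_scaleC Cc \<open>G \<in> M\<close>, of "complex_of_real (1/2)"]
    unfolding g_def scaleC_of_real .
  then have "C g \<in> M" by (intro M_inv[OF Cb(1)]) (simp_all add: commutes_def)
  moreover have "norm (g - C y) \<le> 2 * e * norm y"
  proof -
    have "2 *\<^sub>R (g - C y) = (R y - (C y - e *\<^sub>R y)) - (2 * e) *\<^sub>R y"
    proof -
      have "2 *\<^sub>R (g - C y) = G - 2 *\<^sub>R C y" by (simp add: g_def scaleR_diff_right)
      moreover have "(2 * e) *\<^sub>R y = e *\<^sub>R y + e *\<^sub>R y" by (simp flip: scaleR_left_distrib)
      ultimately show ?thesis by (simp add: G_def scaleR_2)
    qed
    then have "2 * norm (g - C y) = norm ((R y - (C y - e *\<^sub>R y)) - (2 * e) *\<^sub>R y)"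
      by (metis norm_scaleR abs_numeral)
    also have "\<dots> \<le> norm (R y - (C y - e *\<^sub>R y)) + norm ((2 * e) *\<^sub>R y)"
      by (rule norm_triangle_ineq4)
    also have "\<dots> \<le> 2 * e * norm y + 2 * e * norm y" using R(4)[of y] e by simp
    finally show ?thesis by simp
  qed
  ultimately show ?thesis using fug by blast
qed

lemma fuglede_limit:
  assumes B: "bounded_linear B" and BA: "\<And>x. x \<in> dom A \<Longrightarrow> B x \<in> dom A"
    and u: "\<And>n. u n \<in> dom A" "u \<longlonglongrightarrow> x" "(\<lambda>n. s (u n)) \<longlonglongrightarrow> y"
    and eq: "\<And>n. s (B (u n)) = B (s (u n))"
  shows "s (B x) = B y"
proof -
  interpret B: bounded_linear B by (rule B)
  have "adj A (B x) = Some (B y)"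
    by (rule s_closed[of "\<lambda>n. B (u n)"]) (use BA u B.tendsto in \<open>auto simp: eq\<close>)
  then show ?thesis by simp
qed

text \<open>
  The equation holds at vectors \<open>C g\<close> with g close to \<open>C y\<close>.  Closedness of the adjoint extends it
  to the range of \<open>C\<^sup>2\<close>, then, as the range of C is dense and \<open>A\<^sup>*C\<close> is bounded, to the range of C,
  and finally, as that is a core, to the domain of A.
\<close>

theorem fuglede:
  assumes B: "bounded_linear B" "\<And>c. commutes (\<lambda>x. c *\<^sub>C x) B"
    and BA: "\<And>x. x \<in> dom A \<Longrightarrow> B x \<in> dom A \<and> a (B x) = B (a x)"
    and x: "x \<in> dom A"
  shows "s (B x) = B (s x)"
proof -
  note Cb = pos_boundedD[OF gram_resolvent_pos]
  interpret C: bounded_linear C by (rule Cb(1))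
  interpret Y': bounded_linear "\<lambda>z. s (C z)" by (rule bounded_linear_Y')
  have BD: "B v \<in> dom A" if "v \<in> dom A" for v using BA that by blast
  have limit: "s (B v) = B y"
    if "\<And>n. u n \<in> dom A" "u \<longlonglongrightarrow> v" "(\<lambda>n. s (u n)) \<longlonglongrightarrow> y" "\<And>n. s (B (u n)) = B (s (u n))" for u v y
    by (rule fuglede_limit[where u = u, OF B(1) BD that])
  have CC: "s (B (C (C y))) = B (s (C (C y)))" for y
  proof -
    have "\<exists>g. norm (g - C y) \<le> 2 * (1 / Suc n) * norm y \<and> s (B (C g)) = B (s (C g))" for n
      by (rule fuglede_approximants[OF B BA]) simp_all
    then obtain g where g: "\<And>n::nat. norm (g n - C y) \<le> 2 * (1 / Suc n) * norm y"
      "\<And>n. s (B (C (g n))) = B (s (C (g n)))" by metis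
    have "(\<lambda>n. g n - C y) \<longlonglongrightarrow> 0"
    proof (rule Lim_null_comparison)
      show "\<forall>\<^sub>F n in sequentially. norm (g n - C y) \<le> 2 * (1 / Suc n) * norm y"
        by (rule always_eventually) (use g(1) in blast)
      have "(\<lambda>n. 2 * (1 / Suc n) * norm y) \<longlonglongrightarrow> 2 * 0 * norm y"
        using LIMSEQ_inverse_real_of_nat by (intro tendsto_intros) (simp add: inverse_eq_divide)
      then show "(\<lambda>n. 2 * (1 / Suc n) * norm y) \<longlonglongrightarrow> 0" by (simp only: mult_zero_left mult_zero_right)
    qed
    then have "g \<longlonglongrightarrow> C y" by (rule LIM_zero_cancel)
    from C.tendsto[OF this] Y'.tendsto[OF this] show ?thesis
      by (rule limit[where u = "\<lambda>n. C (g n)", OF gram_resolvent_dom _ _ g(2)])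
  qed
  have "closure (range C) = UNIV"
  proof (rule subspace_denseI)
    show "subspace (range C)" by (intro linear_subspace_image Cb(2) subspace_UNIV)
    fix y assume "\<And>u. u \<in> range C \<Longrightarrow> inner y u = 0"
    then have "inner y (C (C y)) = 0" by blast
    then have "inner (C y) (C y) = 0" by (simp only: Cb(3))
    then show "y = 0" by (rule gram_resolvent_injective[OF iffD1[OF inner_eq_zero_iff]])
  qed
  then have dense: "\<exists>y. (\<lambda>n. C (y n)) \<longlonglongrightarrow> z" for z
  proof -
    obtain v where v: "\<And>n. v n \<in> range C" "v \<longlonglongrightarrow> z"
      using closure_sequential[of z "range C"] \<open>closure (range C) = UNIV\<close> by auto
    obtain y where "\<And>n. v n = C (y n)" using v(1) unfolding image_iff by metis
    then have "v = (\<lambda>n. C (y n))" by blast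
    then show ?thesis using v(2) by blast
  qed
  have C1: "s (B (C z)) = B (s (C z))" for z
  proof -
    obtain y where y: "(\<lambda>n. C (y n)) \<longlonglongrightarrow> z" using dense by blast
    show ?thesis
      by (rule limit[where u = "\<lambda>n. C (C (y n))", OF gram_resolvent_dom C.tendsto[OF y] Y'.tendsto[OF y] CC])
  qed
  obtain z where z: "(\<lambda>n. C (z n)) \<longlonglongrightarrow> x" "(\<lambda>n. a (C (z n))) \<longlonglongrightarrow> a x"
    using gram_resolvent_core[OF x] by blast
  have "norm (s (C (z n)) - s x) = norm (a (C (z n)) - a x)" for n
    using norm_adj[OF subspace_diff[OF lin_rules(1) gram_resolvent_dom x], of "z n"]
    by (simp add: lin_rules(4) s_rules(4) gram_resolvent_dom x)
  then have "(\<lambda>n. s (C (z n)) - s x) \<longlonglongrightarrow> 0"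
    using tendsto_norm_zero[OF LIM_zero[OF z(2)]] by - (rule tendsto_norm_zero_cancel, simp)
  then have "(\<lambda>n. s (C (z n))) \<longlonglongrightarrow> s x" by (rule LIM_zero_cancel)
  then show ?thesis by (rule limit[where u = "\<lambda>n. C (z n)", OF gram_resolvent_dom z(1) _ C1])
qed

lemma fuglede_resolvent:
  assumes B: "bounded_linear B" "\<And>c. commutes (\<lambda>x. c *\<^sub>C x) B"
    and BA: "\<And>x. x \<in> dom A \<Longrightarrow> B x \<in> dom A \<and> a (B x) = B (a x)"
  shows "commutes B C"
  unfolding commutes_def
proof
  fix z
  have "C (B z) = B (C z)"
  proof (rule resolvent_eqI)
    show "B (C z) \<in> dom A" "a (B (C z)) \<in> dom A"
      using BA[OF gram_resolvent_dom] BA[OF resolvent_a(1)] by simp_all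
    show "s (a (B (C z))) = B z - B (C z)"
      using BA[OF gram_resolvent_dom] fuglede[OF B BA resolvent_a(1)]
      by (simp add: resolvent_a(2) linear_diff[OF bounded_linear.linear[OF B(1)]])
  qed
  then show "B (C z) = C (B z)" by simp
qed

section \<open>The interaction term\<close>

text \<open>
  On the range of C the form \<open>- Re \<langle>A x, B x\<rangle>\<close> is that of the symmetric operator
  \<open>- (A\<^sup>*B + B\<^sup>*A) / 2\<close>.  Since everything commutes, \<open>\<parallel>A\<^sup>*B x\<parallel> = \<parallel>\<bar>B\<bar> \<bar>A\<bar> x\<parallel>\<close>, and hyponormality gives
  \<open>\<parallel>B\<^sup>*A x\<parallel> \<le> \<parallel>B A x\<parallel> = \<parallel>\<bar>B\<bar> \<bar>A\<bar> x\<parallel>\<close>.  The form inequality therefore bounds this form by that of the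
  positive operator \<open>\<bar>A\<bar> \<bar>B\<bar>\<close>; the resolvent C on both sides keeps all operators bounded.
\<close>

lemma interaction_bound:
  assumes B: "bounded_linear B" "\<And>c. commutes (\<lambda>x. c *\<^sub>C x) B"
    and BA: "\<And>x. x \<in> dom A \<Longrightarrow> B x \<in> dom A \<and> a (B x) = B (a x)"
    and B': "bounded_linear B'" "\<And>x y. inner (B x) y = inner x (B' y)"
    and hypo: "\<And>x. norm (B' x) \<le> norm (B x)"
    and b: "pos_bounded b" "\<And>x. b (b x) = B' (B x)" "\<And>c. commutes (\<lambda>x. c *\<^sub>C x) b"
    and x: "x \<in> dom A"
  shows "- inner (a x) (B x) \<le> inner (the (abs_op A x)) (b x)"
proof -
  note absA = abs_op[OF closed_dense_op_axioms]
  define f where "f x = the (abs_op A x)" for x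
  define E where "E z = f (C z)" for z
  note Cb = pos_boundedD[OF gram_resolvent_pos] and bb = pos_boundedD[OF b(1)]
  have Cc: "commutes (\<lambda>x. c *\<^sub>C x) C" for c by (simp add: commutes_def gram_resolvent_scaleC)
  have E_eq: "E = (\<lambda>z. the (abs_op A (C z)))" by (simp add: E_def f_def fun_eq_iff)
  have E: "pos_bounded E" "\<And>z. E (E z) = C (z - C z)"
    using root_resolvent_pos[OF absA(1)] root_resolvent_square[OF absA(1)]
    by (simp_all add: absA(2) E_eq)
  note Eb = pos_boundedD[OF E(1)]
  have E_comm: "commutes X E" if "bounded_linear X" "commutes X C" for X
    by (rule bounded_sqrt_commutes[OF E that(1)])
      (use that in \<open>simp add: commutes_def linear_diff[OF bounded_linear.linear]\<close>)
  have Ec: "commutes (\<lambda>x. c *\<^sub>C x) E" for c by (rule E_comm[OF bounded_linear_scaleC Cc])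
  have BC: "commutes B C" by (rule fuglede_resolvent[OF B BA])
  then have BCx: "B (C v) = C (B v)" for v by (simp add: commutes_def)
  have eqI: "u = v" if "\<And>w. inner u w = inner v w" for u v :: 'a
  proof -
    have "inner (u - v) (u - v) = 0" using that by (simp add: inner_diff_left)
    then show ?thesis by simp
  qed
  have B'_left: "inner (B' u) v = inner u (B v)" for u v by (metis B'(2) inner_commute)
  have B'C: "B' (C v) = C (B' v)" for v
    by (rule eqI) (simp add: B'_left Cb(3) BCx)
  have bC: "commutes b C"
  proof -
    have "commutes C b"
      by (rule bounded_sqrt_commutes[OF b(1,2) Cb(1)]) (simp add: commutes_def BCx B'C)
    then show ?thesis by (simp add: commutes_def)
  qed
  have BE: "B (E v) = E (B v)" and bE: "b (E v) = E (b v)" for v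
    using E_comm[OF B(1) BC] E_comm[OF bb(1) bC] by (simp_all add: commutes_def)
  define Y where "Y z = a (C z)" for z
  define Y' where "Y' z = s (C z)" for z
  have Yadj: "inner (Y u) v = inner u (Y' v)" for u v by (simp add: Y_def Y'_def adj_Y)
  have Y'left: "inner (Y' u) v = inner u (Y v)" for u v by (metis Yadj inner_commute)
  have YC: "Y (C z) = C (Y z)" for z by (simp add: Y_def resolvent_commutes_a gram_resolvent_dom)
  have YB: "Y (B z) = B (Y z)" for z
    using BA[OF gram_resolvent_dom] by (simp add: Y_def flip: BCx)
  have nE: "norm (E v) = norm (Y v)" for v
    using absA(4)[OF gram_resolvent_dom] by (simp add: E_def f_def Y_def)
  have nY': "norm (Y' v) = norm (Y v)" for v by (simp add: Y'_def Y_def norm_adj gram_resolvent_dom)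
  have nb: "norm (b v) = norm (B v)" for v
  proof -
    have "inner (b v) (b v) = inner (B v) (B v)" by (simp add: bb(3) b(2) B'(2))
    then show ?thesis by (simp add: norm_eq)
  qed
  define h where "h z = - (1/2) *\<^sub>R (Y' (B (C z)) + C (B' (Y z)))" for z
  define p where "p z = E (b (C z))" for z
  have h_sym: "inner (h u) v = inner u (h v)" for u v
    by (simp add: h_def inner_add Y'left Yadj Cb(3) B'(2) B'_left)
  have bCp: "pos_bounded (\<lambda>z. b (C z))"
    by (rule pos_bounded_compose_commuting[OF b(1) gram_resolvent_pos bC])
  have p_pos: "pos_bounded p"
    unfolding p_def
  proof (rule pos_bounded_compose_commuting[OF E(1) bCp])
    have "commutes C E" by (rule E_comm[OF Cb(1)]) (simp add: commutes_def)
    then show "commutes E (\<lambda>z. b (C z))" by (simp add: commutes_def bE)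
  qed
  have pc: "commutes (\<lambda>x. c *\<^sub>C x) p" for c
    using Ec[of c] b(3)[of c] Cc[of c] by (simp add: commutes_def p_def)
  have EC: "E (C z) = C (E z)" for z
    using E_comm[OF Cb(1)] by (simp add: commutes_def)
  have "norm (h z) \<le> norm (p z)" for z
  proof -
    have np: "norm (p z) = norm (Y (B (C z)))"
    proof -
      have "norm (p z) = norm (b (E (C z)))" by (simp add: p_def bE)
      also have "\<dots> = norm (E (B (C z)))" by (simp add: nb BE)
      finally show ?thesis by (simp add: nE)
    qed
    have 1: "norm (Y' (B (C z))) = norm (p z)" by (simp add: nY' np)
    have "norm (C (B' (Y z))) = norm (B' (Y (C z)))" by (simp add: YC B'C)
    also have "\<dots> \<le> norm (B (Y (C z)))" by (rule hypo)
    also have "\<dots> = norm (p z)" by (simp add: np YB)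
    finally have 2: "norm (C (B' (Y z))) \<le> norm (p z)" .
    have "norm (h z) = (1/2) * norm (Y' (B (C z)) + C (B' (Y z)))" by (simp add: h_def)
    then show ?thesis using norm_triangle_ineq[of "Y' (B (C z))" "C (B' (Y z))"] 1 2 by simp
  qed
  then have "\<bar>inner (h z) z\<bar> \<le> inner (p z) z" for z by (rule heinz_bounded[OF h_sym p_pos pc])
  moreover have "inner (h z) z = - inner (a (C z)) (B (C z))" for z
  proof -
    have "inner (Y' (B (C z))) z = inner (Y z) (B (C z))" by (simp only: Y'left[of "B (C z)" z] inner_commute[of "B (C z)"])
    moreover have "inner (C (B' (Y z))) z = inner (Y z) (B (C z))" by (simp add: Cb(3) B'_left)
    ultimately show ?thesis by (simp add: h_def inner_add_left Y_def)
  qed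
  moreover have "inner (p z) z = inner (f (C z)) (b (C z))" for z
    unfolding p_def Eb(3) by (simp add: E_def inner_commute)
  ultimately have range_C: "- inner (a (C z)) (B (C z)) \<le> inner (f (C z)) (b (C z))" for z
    by (metis abs_ge_self order_trans)
  obtain z where z: "(\<lambda>n. C (z n)) \<longlonglongrightarrow> x" "(\<lambda>n. a (C (z n))) \<longlonglongrightarrow> a x"
    using gram_resolvent_core[OF x] by blast
  have fd: "f (u - v) = f u - f v" if "u \<in> dom A" "v \<in> dom A" for u v
    using linear_opD(4)[OF positive_selfadjointD(1)[OF absA(1)]] that by (simp add: f_def absA(3))
  have "norm (f (C (z n)) - f x) = norm (a (C (z n)) - a x)" for n
    using absA(4)[OF subspace_diff[OF lin_rules(1) gram_resolvent_dom x], of "z n"]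
    by (simp add: lin_rules(4) fd gram_resolvent_dom x flip: f_def)
  then have "(\<lambda>n. f (C (z n)) - f x) \<longlonglongrightarrow> 0"
    using tendsto_norm_zero[OF LIM_zero[OF z(2)]] by - (rule tendsto_norm_zero_cancel, simp)
  then have fl: "(\<lambda>n. f (C (z n))) \<longlonglongrightarrow> f x" by (rule LIM_zero_cancel)
  have "- inner (a x) (B x) \<le> inner (f x) (b x)"
  proof (rule LIMSEQ_le)
    show "(\<lambda>n. - inner (a (C (z n))) (B (C (z n)))) \<longlonglongrightarrow> - inner (a x) (B x)"
      by (intro tendsto_intros z(2) bounded_linear.tendsto[OF B(1) z(1)])
    show "(\<lambda>n. inner (f (C (z n))) (b (C (z n)))) \<longlonglongrightarrow> inner (f x) (b x)"
      by (intro tendsto_intros fl bounded_linear.tendsto[OF bb(1) z(1)])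
  qed (use range_C in blast)
  then show ?thesis by (simp add: f_def)
qed

end

section \<open>The triangle inequality\<close>

text \<open>A bounded summand does not change the domain of the adjoint.\<close>

lemma positive_selfadjoint_plus_total:
  assumes S: "positive_selfadjoint_op S" and p: "pos_bounded p" "\<And>c. commutes (\<lambda>x. c *\<^sub>C x) p"
  shows "positive_selfadjoint_op (S +\<^sub>m (\<lambda>x. Some (p x)))"
proof -
  note SD = positive_selfadjointD[OF S] and Sl = linear_opD[OF positive_selfadjointD(1)[OF S]]
  let ?R = "S +\<^sub>m (\<lambda>x. Some (p x))"
  have d: "dom ?R = dom S" by (auto simp: op_plus_def dom_def)
  have v: "the (?R x) = the (S x) + p x" if "x \<in> dom S" for x using that by (simp add: op_plus_def dom_def)
  have "linear_op ?R"
    unfolding linear_op_def d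
    using SD(1) p(2) linear_add[OF pos_boundedD(2)[OF p(1)]]
    by (auto simp: linear_op_def v commutes_def scaleC_add_right simp del: domIff)
  then show ?thesis
  proof (rule positive_selfadjoint_maximalI; unfold d)
    show "closure (dom S) = UNIV" using SD(2) by (simp add: densely_defined_def)
    show "inner (the (?R x)) y = inner x (the (?R y))" if "x \<in> dom S" "y \<in> dom S" for x y
      using that by (simp add: v inner_add SD(5) pos_boundedD(3)[OF p(1)])
    show "0 \<le> inner (the (?R x)) x" if "x \<in> dom S" for x
      using SD(6)[OF that] pos_boundedD(4)[OF p(1), of x] by (simp add: v[OF that] inner_add)
    fix y z assume a: "\<And>x. x \<in> dom S \<Longrightarrow> inner (the (?R x)) y = inner x z"
    have "inner (the (S x)) y = inner x (z - p y)" if "x \<in> dom S" for x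
      using a[OF that] by (simp add: v[OF that] inner_add inner_diff pos_boundedD(3)[OF p(1)])
    then have "S y = Some (z - p y)" using adj_eq_Some_iff[OF SD(1,2)] SD(4) by metis
    then show "?R y = Some z" by (auto simp: op_plus_def)
  qed
qed

text \<open>
  The Heinz inequality for unbounded operators.  The form inequality settles it on the domain of R,
  which is a core of the root of R.
\<close>

lemma op_le_if_norm_le:
  assumes S: "positive_selfadjoint_op S" and R: "positive_selfadjoint_op R"
    and dom: "dom R \<subseteq> dom S" and le: "\<And>x. x \<in> dom R \<Longrightarrow> norm (the (S x)) \<le> norm (the (R x))"
  shows "S \<le>\<^sub>m R"
proof -
  note SD = positive_selfadjointD[OF S] and RD = positive_selfadjointD[OF R]
  let ?s = "sqrt_op S" and ?r = "sqrt_op R"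
  note s = sqrt_op[OF S] and r = sqrt_op[OF R]
  interpret s: closed_dense_op ?s by (rule closed_dense_op_positive_selfadjoint[OF s(1)])
  interpret r: closed_dense_op ?r by (rule closed_dense_op_positive_selfadjoint[OF r(1)])
  have root_norm: "x \<in> dom (sqrt_op T) \<and> (norm (the (sqrt_op T x)))\<^sup>2 = inner (the (T x)) x"
    if T: "positive_selfadjoint_op T" and x: "x \<in> dom T" for T :: "'a \<rightharpoonup> 'a" and x
  proof -
    obtain y where y: "T x = Some y" using x by blast
    then have "(sqrt_op T \<circ>\<^sub>m sqrt_op T) x = Some y" using sqrt_op(2)[OF T] by simp
    then obtain w where w: "sqrt_op T x = Some w" "sqrt_op T w = Some y" by (auto simp: map_comp_eq_Some_iff)
    then have "x \<in> dom (sqrt_op T)" "w \<in> dom (sqrt_op T)" by auto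
    from positive_selfadjointD(5)[OF sqrt_op(1)[OF T] this] show ?thesis
      using w y by (auto simp: power2_norm_eq_inner inner_commute)
  qed
  have form: "inner (the (S x)) x \<le> inner (the (R x)) x" if "x \<in> dom R" for x
  proof -
    have "\<bar>inner (the (S x)) x\<bar> \<le> inner (the (R x)) x"
    proof (rule heinz_form_bound[where D = "dom R"])
      show "inner (the (S u)) v = inner u (the (S v))" if "u \<in> dom R" "v \<in> dom R" for u v
        using SD(5) dom that by blast
      show "linear_map_on (dom R) (\<lambda>x. the (R x))" by (rule linear_op_map_on[OF RD(1)])
      show "\<exists>u\<in>dom R. the (R u) + e *\<^sub>R u = y" if "e > 0" for e y
        by (rule positive_selfadjoint_shift_onto[OF R that])
    qed (use RD(5,6) le that in auto)
    then show ?thesis by simp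
  qed
  have core: "norm (the (?s x)) \<le> norm (the (?r x))" if x: "x \<in> dom R" for x
  proof (rule power2_le_imp_le)
    show "(norm (the (?s x)))\<^sup>2 \<le> (norm (the (?r x)))\<^sup>2"
      using root_norm[OF S subsetD[OF dom x]] root_norm[OF R x] form[OF x] by simp
  qed simp
  have "x \<in> dom ?s \<and> norm (the (?s x)) \<le> norm (the (?r x))" if x: "x \<in> dom ?r" for x
  proof -
    obtain z where z: "(\<lambda>n. r.C (z n)) \<longlonglongrightarrow> x" "(\<lambda>n. the (?r (r.C (z n)))) \<longlonglongrightarrow> the (?r x)"
      using r.gram_resolvent_core[OF x] by blast
    have CR: "r.C u \<in> dom R" for u
      using r.gram_resolvent_in_gram[of u] positive_selfadjointD(4)[OF r(1)] r(2) by auto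
    have Cs: "r.C u \<in> dom ?s" for u using root_norm[OF S] CR dom by blast
    have "1 * norm (the (?s (r.C (z m))) - the (?s (r.C (z n)))) \<le> norm (the (?r (r.C (z m))) - the (?r (r.C (z n))))" for m n
      using core[OF subspace_diff[OF linear_opD(1)[OF RD(1)] CR CR], of "z m" "z n"]
      by (simp add: s.lin_rules(4) r.lin_rules(4) Cs r.gram_resolvent_dom)
    moreover have "convergent (\<lambda>n. the (?r (r.C (z n))))" using z(2) convergent_def by blast
    ultimately obtain y where y: "(\<lambda>n. the (?s (r.C (z n)))) \<longlonglongrightarrow> y"
      using complete_space_Cauchy_bound[of "\<lambda>n. the (?r (r.C (z n)))" 1 "\<lambda>n. the (?s (r.C (z n)))"] by auto
    have sx: "?s x = Some y" by (rule closed_opD[OF s.cl Cs z(1) y])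
    have "norm y \<le> norm (the (?r x))"
      by (rule LIMSEQ_le[OF tendsto_norm[OF y] tendsto_norm[OF z(2)]]) (use core[OF CR] in blast)
    then show ?thesis using sx by auto
  qed
  then show ?thesis unfolding op_le_def using S R by blast
qed

lemma closed_dense_op_minus_bounded:
  assumes A: "closed_dense_op A" and B: "linear_op B" "dom B = UNIV" "bounded_linear (\<lambda>x. the (B x))"
  shows "closed_dense_op (A -\<^sub>m B)" "dom (A -\<^sub>m B) = dom A"
    "x \<in> dom A \<Longrightarrow> the ((A -\<^sub>m B) x) = the (A x) - the (B x)"
proof -
  interpret A: closed_dense_op A by (rule A)
  let ?T = "A -\<^sub>m B"
  show d: "dom ?T = dom A" using B(2) by (auto simp: op_minus_def dom_def)
  have v: "the (?T x) = the (A x) - the (B x)" if "x \<in> dom A" for x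
    using that B(2) by (simp add: op_minus_def)
  then show "x \<in> dom A \<Longrightarrow> the (?T x) = the (A x) - the (B x)" .
  have "linear_op ?T"
    unfolding linear_op_def d
  proof (intro conjI ballI allI)
    show "0 \<in> dom A" by (rule subspace_0[OF A.lin_rules(1)])
    fix x assume x: "x \<in> dom A"
    show "c *\<^sub>C x \<in> dom A" for c by (rule linear_op_scaleC(1)[OF A.lin x])
    then show "the (?T (c *\<^sub>C x)) = c *\<^sub>C the (?T x)" for c
      using x linear_op_scaleC(2)[OF A.lin x] linear_op_scaleC(2)[OF B(1), of x] B(2)
      by (simp add: v linear_diff[OF bounded_linear.linear[OF bounded_linear_scaleC]])
    fix y assume y: "y \<in> dom A"
    show xy: "x + y \<in> dom A" by (rule subspace_add[OF A.lin_rules(1) x y])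
    show "the (?T (x + y)) = the (?T x) + the (?T y)"
      by (simp add: v x y xy A.lin_rules(2) linear_add[OF bounded_linear.linear[OF B(3)]])
  qed
  moreover have "closed_op ?T"
  proof (rule closed_opI)
    fix u x y assume u: "\<And>n. u n \<in> dom ?T" "u \<longlonglongrightarrow> x" "(\<lambda>n. the (?T (u n))) \<longlonglongrightarrow> y"
    have ud: "u n \<in> dom A" for n using u(1) d by blast
    have "(\<lambda>n. the (?T (u n)) + the (B (u n))) \<longlonglongrightarrow> y + the (B x)"
      by (intro tendsto_add u(3) bounded_linear.tendsto[OF B(3) u(2)])
    then have "A x = Some (y + the (B x))"
      by (intro closed_opD[OF A.cl ud u(2)]) (simp add: v ud)
    then show "?T x = Some y" using B(2) by (auto simp: op_minus_def)
  qed
  moreover have "densely_defined ?T" using A.dense by (simp add: densely_defined_def d)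
  ultimately show "closed_dense_op ?T" by unfold_locales
qed

theorem corollary3p4:
  fixes A B :: "'a::complex_hilbert_space \<rightharpoonup> 'a"
  assumes "normal_op A"
    and "bounded_op B" and "hyponormal_op B"
    and "B \<circ>\<^sub>m A \<subseteq>\<^sub>m A \<circ>\<^sub>m B"
  shows "abs_op (A -\<^sub>m B) \<le>\<^sub>m abs_op A +\<^sub>m abs_op B"
proof -
  interpret normal_operator A
    using assms(1) by unfold_locales (simp_all add: normal_op_def)
  have Bl: "linear_op B" and Bd: "dom B = UNIV"
    using assms(2) by (simp_all add: bounded_op_def)
  have Bs: "B x = Some (the (B x))" for x using Bd by (metis UNIV_I domD option.sel)
  have Bdd: "densely_defined B" by (simp add: densely_defined_def Bd)
  have hypo: "dom (adj B) = UNIV" "\<And>x. norm (the (adj B x)) \<le> norm (the (B x))"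
    using assms(3) by (auto simp: hyponormal_op_def Bd)
  have adjs: "adj B x = Some (the (adj B x))" for x using hypo(1) by (metis UNIV_I domD option.sel)
  define g where "g x = the (B x)" for x
  define g' where "g' x = the (adj B x)" for x
  obtain K where K: "\<And>x. norm (g x) \<le> K * norm x"
    using assms(2) by (auto simp: bounded_op_def g_def)
  have gb: "bounded_linear g"
    by (rule bounded_linear_intro[where K = K])
      (use linear_opD(2,3)[OF Bl] Bd K in \<open>simp_all add: g_def mult.commute\<close>)
  have g'b: "bounded_linear g'"
  proof (rule bounded_linear_intro[where K = K])
    note l = linear_opD(2,3)[OF linear_op_adj[OF Bl Bdd]]
    show "g' (x + y) = g' x + g' y" "g' (r *\<^sub>R x) = r *\<^sub>R g' x" for x y r
      using l hypo(1) by (simp_all add: g'_def)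
    show "norm (g' x) \<le> norm x * K" for x
      using order_trans[OF hypo(2)[of x] K[of x, unfolded g_def]] by (simp add: g'_def mult.commute)
  qed
  have adj_g: "inner (g x) y = inner x (g' y)" for x y
    using adj_inner[OF Bl Bdd, of x y] by (simp add: g_def g'_def Bd hypo(1))
  have gc: "commutes (\<lambda>x. c *\<^sub>C x) g" for c
    using linear_op_scaleC(2)[OF Bl] Bd by (simp add: commutes_def g_def)
  have g'c: "commutes (\<lambda>x. c *\<^sub>C x) g'" for c
    using linear_op_scaleC(2)[OF linear_op_adj[OF Bl Bdd]] hypo(1) by (simp add: commutes_def g'_def)
  obtain b where b: "pos_bounded b" "\<And>x. b (b x) = g' (g x)"
    "\<And>X. bounded_linear X \<Longrightarrow> commutes X (\<lambda>x. g' (g x)) \<Longrightarrow> commutes X b"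
    by (rule bounded_sqrt_exists[OF pos_bounded_gram[OF gb g'b adj_g]]) (rule that)
  have bc: "commutes (\<lambda>x. c *\<^sub>C x) b" for c
    by (rule b(3)[OF bounded_linear_scaleC]) (use gc[of c] g'c[of c] in \<open>simp add: commutes_def\<close>)
  have absB: "abs_op B = (\<lambda>x. Some (b x))"
    unfolding abs_op_def
  proof (rule sqrt_op_eqI[OF positive_selfadjoint_total[OF b(1) bc]])
    have "adj B (the (B x)) = Some (b (b x))" for x
      using adjs[of "the (B x)"] by (simp add: b(2) g_def g'_def)
    then show "(\<lambda>x. Some (b x)) \<circ>\<^sub>m (\<lambda>x. Some (b x)) = adj B \<circ>\<^sub>m B"
      using Bs by (auto simp: map_comp_def fun_eq_iff split: option.splits) (metis option.sel)
  qed
  have comm: "g x \<in> dom A \<and> a (g x) = g (a x)" if x: "x \<in> dom A" for x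
  proof -
    obtain y where y: "A x = Some y" using x by blast
    have "(B \<circ>\<^sub>m A) x = Some (g y)" using Bs[of y] y by (simp add: map_comp_eq_Some_iff g_def)
    then have "(A \<circ>\<^sub>m B) x = Some (g y)" using assms(4) by (auto simp: map_le_def dom_def)
    then have "A (g x) = Some (g y)" by (auto simp: map_comp_eq_Some_iff g_def)
    then show ?thesis using y by auto
  qed
  note T = closed_dense_op_minus_bounded[OF closed_dense_op_axioms Bl Bd, folded g_def, OF gb]
  note absA = abs_op[OF closed_dense_op_axioms] and absT = abs_op[OF T(1)]
  have dR: "dom (abs_op A +\<^sub>m abs_op B) = dom A"
    by (auto simp: absB op_plus_def dom_def absA(3)[unfolded dom_def set_eq_iff, simplified] split: if_splits)
  show ?thesis
  proof (rule op_le_if_norm_le)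
    show "positive_selfadjoint_op (abs_op (A -\<^sub>m B))" by (rule absT(1))
    show "positive_selfadjoint_op (abs_op A +\<^sub>m abs_op B)"
      unfolding absB by (rule positive_selfadjoint_plus_total[OF absA(1) b(1) bc])
    show "dom (abs_op A +\<^sub>m abs_op B) \<subseteq> dom (abs_op (A -\<^sub>m B))"
      unfolding dR absT(3) T(2) by simp
    fix x assume "x \<in> dom (abs_op A +\<^sub>m abs_op B)"
    then have x: "x \<in> dom A" by (simp only: dR)
    have R: "the ((abs_op A +\<^sub>m abs_op B) x) = the (abs_op A x) + b x"
      using x absA(3) by (simp add: op_plus_def absB dom_def)
    have nb: "inner (b x) (b x) = inner (g x) (g x)"
      by (simp add: pos_boundedD(3)[OF b(1)] b(2) adj_g)
    have na: "inner (the (abs_op A x)) (the (abs_op A x)) = inner (a x) (a x)"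
      using absA(4)[OF x] by (simp add: norm_eq)
    have gg': "norm (g' v) \<le> norm (g v)" for v using hypo(2)[of v] by (simp only: g_def g'_def)
    have "- inner (a x) (g x) \<le> inner (the (abs_op A x)) (b x)"
      by (rule interaction_bound[OF gb gc comm g'b adj_g gg' b(1,2) bc x])
    then have "norm (a x - g x) \<le> norm (the (abs_op A x) + b x)"
      by (simp add: norm_le inner_add inner_diff nb na inner_commute)
    then show "norm (the (abs_op (A -\<^sub>m B) x)) \<le> norm (the ((abs_op A +\<^sub>m abs_op B) x))"
      using absT(4)[of x] T(2,3) x by (simp add: R)
  qed
qed

end
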